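(* Let $d\ge 3$. There exists a constant $C_d>0$ depending only on $d$ such that for every $N\ge 1$ and every $X\subset\mathbb{Z}^d$ with $\#X=N$ the following hold: (i) (capacity) if $\mathrm{cap}_N(X)=m_N$, then $\mathrm{diam}(X)\le C_d N^{1/d}$; (ii) (relative capacity) if $R>0$, $X\subset B_{RN^{1/d}}$ and $\mathrm{cap}_N(X,R)=m_N(R)$, then $\mathrm{diam}(X)\le C_d N^{1/d}$; (iii) (first Dirichlet eigenvalue) if $\lambda_N(X)=m_{\lambda,N}$, then $\mathrm{diam}(X)\le C_d N^{1/d}$.
   Context: $B_r$ is the open Euclidean ball of radius $r$ in $\mathbb{R}^d$ centred at $0$; $\mathrm{diam}$ is the Euclidean diameter. For $u\colon\mathbb{Z}^d\to\mathbb{R}$ set $$E_N(u)=N^{\frac{2-d}{d}}\sum_{(i,j)\in(\mathbb{Z}^d)^2,\ |i-j|=1}|u(i)-u(j)|^2 .$$ For $X\subset\mathbb{Z}^d$ with $\#X=N$, the discrete capacity is $$\mathrm{cap}_N(X)=\inf\{E_N(u): u\colon\mathbb{Z}^d\to\mathbb{R},\ \#\mathrm{supp}(u)<+\infty,\ u\ge 1\text{ on }X\},$$ and $m_N=\inf\{\mathrm{cap}_N(X): X\subset\mathbb{Z}^d,\ \#X=N\}$. For $R>0$ and $X\subset B_{RN^{1/d}}\cap\mathbb{Z}^d$ with $\#X=N$, the discrete relative capacity is $$\mathrm{cap}_N(X,R)=\inf\{E_N(u): u\colon\mathbb{Z}^d\to\mathbb{R},\ \mathrm{supp}(u)\subset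 B_{RN^{1/d}},\ u\ge 1\text{ on }X\},$$ and $m_N(R)=\inf\{\mathrm{cap}_N(X,R): X\subset B_{RN^{1/d}}\cap\mathbb{Z}^d,\ \#X=N\}$. The first Dirichlet eigenvalue of the combinatorial Laplacian of $X\subset\mathbb{Z}^d$ with $\#X=N$ is $$\lambda_N(X)=\min\Bigl\{E_N(u): u\colon\mathbb{Z}^d\to\mathbb{R},\ u=0\text{ on }\mathbb{Z}^d\setminus X,\ \tfrac1N\sum_{i\in\mathbb{Z}^d}|u(i)|^2=1\Bigr\},$$ and $m_{\lambda,N}=\inf\{\lambda_N(X): X\subset\mathbb{Z}^d,\ \#X=N\}$. *)

theory Defs
  imports "HOL-Analysis.Analysis"
begin

text \<open>The lattice of integer points of dimension \<open>d = CARD('n)\<close> is the type \<^typ>\<open>int^'n\<close>;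
  Euclidean notions are those of \<^typ>\<open>real^'n\<close> along the inclusion below.\<close>

definition emb :: "int^'n \<Rightarrow> real^'n" where
  "emb z = (\<chi> k. real_of_int (z $ k))"

definition supp :: "(int^'n \<Rightarrow> real) \<Rightarrow> (int^'n) set" where
  "supp u = {i. u i \<noteq> 0}"

definition lattice_ball :: "real \<Rightarrow> (int^'n) set" where
  "lattice_ball r = {i. emb i \<in> ball 0 r}"

text \<open>The sum runs over ordered pairs, so every bond is counted twice. As a real-valued sum it is
  only meaningful when it converges; below it is only evaluated on finitely supported functions.\<close>

definition energy :: "nat \<Rightarrow> (int^'n \<Rightarrow> real) \<Rightarrow> real" where
  "energy N u = real N powr ((2 - real CARD('n)) / real CARD('n)) *
     (\<Sum>\<^sub>\<infinity>(i, j)\<in>{(i, j). norm (emb i - emb j) = 1}. \<bar>u i - u j\<bar>\<^sup>2)"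

text \<open>In the following definitions \<open>N\<close> is intended to be the cardinality of the finite
  nonempty set \<open>X\<close>. All infima are of sets bounded below
  by zero; only the one in \<open>min_rel_cap\<close> can be over an empty set, namely when the ball has fewer
  than \<open>N\<close> lattice points.\<close>

definition cap :: "nat \<Rightarrow> (int^'n) set \<Rightarrow> real" where
  "cap N X = Inf {energy N u |u. finite (supp u) \<and> (\<forall>i\<in>X. u i \<ge> 1)}"

definition min_cap :: "('n::finite) itself \<Rightarrow> nat \<Rightarrow> real" where
  "min_cap _ N = Inf {cap N X |X :: (int^'n) set. finite X \<and> card X = N}"

definition rel_cap :: "nat \<Rightarrow> (int^'n) set \<Rightarrow> real \<Rightarrow> real" where
  "rel_cap N X R = Inf {energy N u |u.
     supp u \<subseteq> lattice_ball (R * real N powr (1 / real CARD('n))) \<and> (\<forall>i\<in>X. u i \<ge> 1)}"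

definition min_rel_cap :: "('n::finite) itself \<Rightarrow> nat \<Rightarrow> real \<Rightarrow> real" where
  "min_rel_cap _ N R = Inf {rel_cap N X R |X :: (int^'n) set.
     X \<subseteq> lattice_ball (R * real N powr (1 / real CARD('n))) \<and> finite X \<and> card X = N}"

definition dirichlet_eigenvalue :: "nat \<Rightarrow> (int^'n) set \<Rightarrow> real" where
  "dirichlet_eigenvalue N X = (LEAST e. \<exists>u :: int^'n \<Rightarrow> real. e = energy N u \<and>
     (\<forall>i. i \<notin> X \<longrightarrow> u i = 0) \<and> (1 / real N) * (\<Sum>\<^sub>\<infinity>i\<in>UNIV. \<bar>u i\<bar>\<^sup>2) = 1)"

definition min_dirichlet_eigenvalue :: "('n::finite) itself \<Rightarrow> nat \<Rightarrow> real" where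
  "min_dirichlet_eigenvalue _ N =
     Inf {dirichlet_eigenvalue N X |X :: (int^'n) set. finite X \<and> card X = N}"

end

theory Submission imports Defs begin

text \<open>
  For a reflection \<open>\<sigma>\<close> of the lattice in a plane \<open>x\<^sub>k = m/2\<close> or \<open>x\<^sub>k - x\<^sub>l = m\<close>, the two-point
  polarization of \<open>u\<close> takes the larger of \<open>u x, u (\<sigma> x)\<close> on one side and the smaller on the other. It
  rearranges superlevel sets and does not increase the Dirichlet energy, so it preserves optimality.
  Equality of the energies forbids \<open>w = u - u \<circ> \<sigma>\<close> to change sign along a bond, and the
  Euler--Lagrange equations of \<open>u\<close>, \<open>u \<circ> \<sigma>\<close> and the polarization let zeros of \<open>w\<close> spread. Hence \<open>w\<close> has
  one sign on each component of the half space minus the points where both functions are 1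
  (for eigenfunctions: of the part of the half space where they do not both vanish).
  If the polarized set is already decreasing away from some centre under all reflections, then there
  is only one relevant component, so the original set was polarized or the mirror image of a polarized
  set. A descent on the second moment of the optimal set then shows that every optimal
  set is decreasing away from a lattice point \<open>c\<close>. A set of this kind with a point whose \<open>k\<close>-th coordinate
  differs by \<open>M + 1\<close> from that of \<open>c\<close> contains a simplex of size \<open>M\<close> (slide the point
  \<open>c + M e\<^sub>k\<close> in the directions \<open>e\<^sub>l - e\<^sub>k\<close>), so \<open>M \<le> d N\<^bsup>1/d\<^esup>\<close>.
  In a ball this works when the radius is a large multiple of \<open>N\<^bsup>1/d\<^esup>\<close>; smaller radii
  bound the diameter directly.
\<close>

section \<open>The Dirichlet sum on the lattice\<close>

text \<open>Rigidity is claimed only when the polarized set is already centred: for an arbitrary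
  optimal set the region that matters may fall into several components, each with its own sign of
  \<open>w\<close>. The induction on the moment supplies this hypothesis. Set and function have to
  be polarized together, so it is first shown that an optimal set is exactly a superlevel set,
  respectively the support, of its minimizer. In a ball a polarization is known to respect the
  domain only when it goes towards the side of 0. Hence 0 is the only centre available there, and
  the mirror image alternative must be excluded by the boundary values. In the capacity problems the
  dimension enters twice: through transience, which makes minimizing sequences converge uniformly,
  and through a coordinate direction parallel to any given mirror. For centred sets the argument
  gives the constant 2d(d+1); the final 2d(d+2) comes from the balls that are too small for
  it.\<close>

definition sqd :: "int^'n \<Rightarrow> int^'n \<Rightarrow> int" where
  "sqd x y = (\<Sum>k\<in>UNIV. (x $ k - y $ k)\<^sup>2)"

definition adj :: "int^'n \<Rightarrow> int^'n \<Rightarrow> bool" where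
  "adj x y \<longleftrightarrow> norm (emb x - emb y) = 1"

definition vupd :: "int^'n \<Rightarrow> 'n \<Rightarrow> int \<Rightarrow> int^'n" where
  "vupd x k t = (\<chi> l. if l = k then t else x $ l)"

definition nbhd :: "int^'n \<Rightarrow> (int^'n) set" where
  "nbhd x = {y. adj x y}"

lemma vupd_nth [simp]: "vupd x k t $ l = (if l = k then t else x $ l)"
  by (simp add: vupd_def)

lemma vupd_same [simp]: "vupd x k (x $ k) = x"
  by (simp add: vec_eq_iff)

lemma norm_emb_diff_sq: "(norm (emb x - emb y))\<^sup>2 = real_of_int (sqd x y)"
  by (simp add: sqd_def emb_def norm_vec_def L2_set_def sum_nonneg power2_eq_square)

lemma sqd_nonneg: "sqd x y \<ge> 0"
  by (simp add: sqd_def sum_nonneg)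

lemma sqd_commute: "sqd x y = sqd y x"
  by (simp add: sqd_def power2_commute)

lemma sqd_self [simp]: "sqd x x = 0"
  by (simp add: sqd_def)

lemma adj_iff: "adj x y \<longleftrightarrow> sqd x y = 1"
proof -
  have "adj x y \<longleftrightarrow> (norm (emb x - emb y))\<^sup>2 = 1"
    by (simp add: adj_def power2_eq_1_iff) (smt (verit) norm_ge_zero)
  then show ?thesis by (simp add: norm_emb_diff_sq)
qed

lemma adj_commute: "adj x y = adj y x"
  by (simp add: adj_iff sqd_commute)

lemma sqd_vupd: "sqd (vupd x k t) y = sqd x y - (x $ k - y $ k)\<^sup>2 + (t - y $ k)\<^sup>2"
proof -
  have "sqd (vupd x k t) y = (t - y $ k)\<^sup>2 + (\<Sum>l\<in>UNIV-{k}. (x $ l - y $ l)\<^sup>2)"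
    unfolding sqd_def by (subst sum.remove[of _ k]) (auto intro!: sum.cong)
  moreover have "sqd x y = (x $ k - y $ k)\<^sup>2 + (\<Sum>l\<in>UNIV-{k}. (x $ l - y $ l)\<^sup>2)"
    unfolding sqd_def by (subst sum.remove[of _ k]) auto
  ultimately show ?thesis by simp
qed

lemma adj_vupdI: "t = x $ k + 1 \<or> t = x $ k - 1 \<Longrightarrow> adj x (vupd x k t)"
  by (auto simp: adj_iff sqd_commute[of x] sqd_vupd)

text \<open>If integer squares sum to 1, one of them is 1 and all others vanish.\<close>

lemma adjE:
  assumes "adj x y"
  obtains k t where "y = vupd x k t" "t = x $ k + 1 \<or> t = x $ k - 1"
proof -
  have s: "(\<Sum>k\<in>UNIV. (x $ k - y $ k)\<^sup>2) = 1" using assms by (simp add: adj_iff sqd_def)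
  obtain k where k: "(x $ k - y $ k)\<^sup>2 \<noteq> 0"
    using s by (metis (mono_tags, lifting) sum.neutral zero_neq_one)
  have s2: "(x $ k - y $ k)\<^sup>2 + (\<Sum>l\<in>UNIV-{k}. (x $ l - y $ l)\<^sup>2) = 1"
    using s by (subst (asm) sum.remove[of _ k]) auto
  have p: "(x $ k - y $ k)\<^sup>2 \<ge> 1" using k by (smt (verit) zero_le_power2)
  have nn: "(\<Sum>l\<in>UNIV-{k}. (x $ l - y $ l)\<^sup>2) \<ge> 0" by (simp add: sum_nonneg)
  have z: "(\<Sum>l\<in>UNIV-{k}. (x $ l - y $ l)\<^sup>2) = 0" and e: "(x $ k - y $ k)\<^sup>2 = 1"
    using s2 p nn by linarith+
  have "\<forall>l\<in>UNIV-{k}. (x $ l - y $ l)\<^sup>2 = 0"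
    using z by (subst (asm) sum_nonneg_eq_0_iff) auto
  then have "y = vupd x k (y $ k)" by (auto simp: vec_eq_iff)
  moreover have "y $ k = x $ k + 1 \<or> y $ k = x $ k - 1"
    using e by (auto simp: power2_eq_1_iff)
  ultimately show ?thesis using that by blast
qed

lemma nbhd_eq: "nbhd x = (\<lambda>k. vupd x k (x $ k + 1)) ` UNIV \<union> (\<lambda>k. vupd x k (x $ k - 1)) ` UNIV"
  by (auto simp: nbhd_def intro: adj_vupdI elim!: adjE)

lemma finite_nbhd [simp]: "finite (nbhd x)"
  by (simp add: nbhd_eq)

lemma vupd_eq_iff: "vupd x k s = vupd x l t \<longleftrightarrow> (k = l \<and> s = t) \<or> (k \<noteq> l \<and> s = x $ k \<and> t = x $ l)"
  by (auto simp: vec_eq_iff)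

lemma sum_nbhd:
  "sum h (nbhd x) = (\<Sum>k\<in>UNIV. h (vupd x k (x $ k + 1)) + h (vupd x k (x $ k - 1)))"
proof -
  have i: "inj (\<lambda>k. vupd x k (x $ k + 1))" "inj (\<lambda>k. vupd x k (x $ k - 1))"
    by (auto simp: inj_on_def vupd_eq_iff)
  have "(\<lambda>k. vupd x k (x $ k + 1)) ` UNIV \<inter> (\<lambda>k. vupd x k (x $ k - 1)) ` UNIV = {}"
    by (auto simp: vupd_eq_iff)
  then have "sum h (nbhd x) = sum h ((\<lambda>k. vupd x k (x $ k + 1)) ` UNIV) + sum h ((\<lambda>k. vupd x k (x $ k - 1)) ` UNIV)"
    unfolding nbhd_eq by (intro sum.union_disjoint) auto
  also have "\<dots> = (\<Sum>k\<in>UNIV. h (vupd x k (x $ k + 1))) + (\<Sum>k\<in>UNIV. h (vupd x k (x $ k - 1)))"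
    by (simp add: sum.reindex[OF i(1)] sum.reindex[OF i(2)])
  finally show ?thesis by (simp add: sum.distrib)
qed

definition bonds :: "((int^'n) \<times> (int^'n)) set" where
  "bonds = {(i, j). adj i j}"

definition bond_sq :: "(int^'n \<Rightarrow> real) \<Rightarrow> (int^'n) \<times> (int^'n) \<Rightarrow> real" where
  "bond_sq u b = (u (fst b) - u (snd b))\<^sup>2"

definition dirichlet :: "(int^'n \<Rightarrow> real) \<Rightarrow> real" where
  "dirichlet u = (\<Sum>\<^sub>\<infinity>b\<in>bonds. bond_sq u b)"

text \<open>The infimum defining the capacity is in general not attained at a finitely supported function;
  it is attained at a tame one. The second condition says that \<open>u\<close> vanishes at infinity.\<close>

definition tame :: "(int^'n \<Rightarrow> real) \<Rightarrow> bool" where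
  "tame u \<longleftrightarrow> bond_sq u summable_on bonds \<and> (\<forall>e>0. finite {i. \<bar>u i\<bar> \<ge> e})"

text \<open>For fixed \<open>N\<close> this positive factor does not affect minimization; the proof
  works with \<open>dirichlet\<close> and restores the factor at the end.\<close>

definition escale :: "('n::finite) itself \<Rightarrow> nat \<Rightarrow> real" where
  "escale _ N = real N powr ((2 - real CARD('n)) / real CARD('n))"

lemma energy_eq: "energy N (u :: int^'n \<Rightarrow> real) = escale TYPE('n) N * dirichlet u"
  unfolding energy_def escale_def dirichlet_def bonds_def adj_def bond_sq_def
  by (simp add: case_prod_beta')

lemma escale_pos: "N \<ge> 1 \<Longrightarrow> escale TYPE('n::finite) N > 0"
  by (simp add: escale_def)

lemma bond_sq_nonneg [simp]: "bond_sq u b \<ge> 0"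
  by (simp add: bond_sq_def)

lemma dirichlet_nonneg: "dirichlet u \<ge> 0"
  unfolding dirichlet_def by (rule infsum_nonneg) simp

lemma finite_bonds_touching:
  assumes "finite A"
  shows "finite {b \<in> bonds. fst b \<in> A \<or> snd b \<in> A}"
proof -
  have "{b \<in> bonds. fst b \<in> A \<or> snd b \<in> A} \<subseteq>
    (\<Union>a\<in>A. (\<lambda>j. (a, j)) ` nbhd a) \<union> (\<Union>a\<in>A. (\<lambda>j. (j, a)) ` nbhd a)"
    by (auto simp: bonds_def nbhd_def adj_commute)
  then show ?thesis using assms by (rule_tac finite_subset) auto
qed

lemma dirichlet_finite:
  assumes "finite A" "supp u \<subseteq> A"
  shows "dirichlet u = (\<Sum>b\<in>{b \<in> bonds. fst b \<in> A \<or> snd b \<in> A}. bond_sq u b)"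
    and "bond_sq u summable_on bonds"
proof -
  let ?F = "{b \<in> bonds. fst b \<in> A \<or> snd b \<in> A}"
  have "bond_sq u b = 0" if "b \<in> bonds - ?F" for b
  proof -
    have "u (fst b) = 0" "u (snd b) = 0" using that assms(2) by (auto simp: supp_def subset_iff)
    then show ?thesis by (simp add: bond_sq_def)
  qed
  then have "(bond_sq u has_sum (\<Sum>b\<in>?F. bond_sq u b)) bonds"
    by (intro has_sum_finite_neutralI[OF finite_bonds_touching[OF assms(1)]]) auto
  then show "dirichlet u = (\<Sum>b\<in>?F. bond_sq u b)" "bond_sq u summable_on bonds"
    by (auto simp: dirichlet_def infsumI dest: has_sum_imp_summable)
qed

lemma dirichlet_mono:
  assumes "bond_sq u summable_on bonds" "\<And>b. b \<in> bonds \<Longrightarrow> bond_sq v b \<le> bond_sq u b"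
  shows "bond_sq v summable_on bonds" "dirichlet v \<le> dirichlet u"
proof -
  show s: "bond_sq v summable_on bonds"
    by (rule summable_on_comparison_test[OF assms(1)]) (auto intro: assms)
  show "dirichlet v \<le> dirichlet u" unfolding dirichlet_def
    by (rule infsum_mono[OF s assms(1)]) (rule assms)
qed

lemma dirichlet_cmult: "dirichlet (\<lambda>i. a * u i) = a\<^sup>2 * dirichlet u"
proof -
  have "bond_sq (\<lambda>i. a * u i) = (\<lambda>b. a\<^sup>2 * bond_sq u b)"
    by (auto simp: bond_sq_def power2_eq_square algebra_simps)
  then show ?thesis by (simp add: dirichlet_def infsum_cmult_right')
qed

text \<open>This makes minimizing sequences of the capacity problem Cauchy in energy.\<close>

lemma dirichlet_parallelogram:
  assumes "finite (supp u)" "finite (supp v)"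
  shows "dirichlet (\<lambda>i. u i - v i) + dirichlet (\<lambda>i. u i + v i) = 2 * dirichlet u + 2 * dirichlet v"
proof -
  define A where "A = supp u \<union> supp v"
  have A: "finite A" "supp u \<subseteq> A" "supp v \<subseteq> A" "supp (\<lambda>i. u i - v i) \<subseteq> A" "supp (\<lambda>i. u i + v i) \<subseteq> A"
    using assms by (auto simp: A_def supp_def)
  show ?thesis
    unfolding dirichlet_finite(1)[OF A(1,2)] dirichlet_finite(1)[OF A(1,3)] dirichlet_finite(1)[OF A(1,4)]
      dirichlet_finite(1)[OF A(1,5)] sum_distrib_left sum.distrib[symmetric]
    by (rule sum.cong) (auto simp: bond_sq_def power2_eq_square algebra_simps)
qed

definition lap :: "(int^'n \<Rightarrow> real) \<Rightarrow> int^'n \<Rightarrow> real" where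
  "lap u i = (\<Sum>j\<in>nbhd i. u j - u i)"

lemma not_adj_self: "\<not> adj i i"
  by (simp add: adj_iff)

text \<open>Only the bonds at \<open>i\<close> change, and each of them occurs in both orders; this
  doubles the usual coefficients 2 and 1. Summability suffices, so the formula also covers
  potentials of infinite support.\<close>

lemma dirichlet_perturb:
  fixes u :: "int^'n \<Rightarrow> real" and i :: "int^'n"
  assumes "bond_sq u summable_on bonds"
  defines "u' \<equiv> (\<lambda>t. u(i := u i + t))"
  shows "bond_sq (u' t) summable_on bonds"
    and "dirichlet (u' t) = dirichlet u - 4 * t * lap u i + 2 * real (card (nbhd i)) * t\<^sup>2"
proof -
  let ?F = "{b \<in> bonds. fst b \<in> {i} \<or> snd b \<in> {i}}"
  let ?d = "\<lambda>b. bond_sq (u' t) b - bond_sq u b"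
  have f: "finite ?F" by (rule finite_bonds_touching) simp
  have z: "?d b = 0" if "b \<in> bonds - ?F" for b
    using that by (auto simp: bond_sq_def u'_def)
  have hs: "(?d has_sum (\<Sum>b\<in>?F. ?d b)) bonds"
    by (rule has_sum_finite_neutralI[OF f]) (use z in auto)
  have h2: "(bond_sq u has_sum dirichlet u) bonds" unfolding dirichlet_def using assms(1) by (rule has_sum_infsum)
  have h3: "(bond_sq (u' t) has_sum (dirichlet u + (\<Sum>b\<in>?F. ?d b))) bonds"
    using has_sum_add[OF h2 hs] by simp
  show "bond_sq (u' t) summable_on bonds" using h3 by (rule has_sum_imp_summable)
  have F: "?F = Pair i ` nbhd i \<union> (\<lambda>j. (j, i)) ` nbhd i"
    by (auto simp: bonds_def nbhd_def adj_commute)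
  have disj: "Pair i ` nbhd i \<inter> (\<lambda>j. (j, i)) ` nbhd i = {}"
    by (auto simp: nbhd_def not_adj_self)
  have ne: "j \<noteq> i" if "j \<in> nbhd i" for j using that not_adj_self by (auto simp: nbhd_def)
  have "(\<Sum>b\<in>?F. ?d b) = (\<Sum>b\<in>Pair i ` nbhd i. ?d b) + (\<Sum>b\<in>(\<lambda>j. (j, i)) ` nbhd i. ?d b)"
    unfolding F using disj by (intro sum.union_disjoint) auto
  also have "(\<Sum>b\<in>Pair i ` nbhd i. ?d b) = (\<Sum>j\<in>nbhd i. ?d (i, j))"
    by (subst sum.reindex) (auto simp: inj_on_def)
  also have "(\<Sum>b\<in>(\<lambda>j. (j, i)) ` nbhd i. ?d b) = (\<Sum>j\<in>nbhd i. ?d (j, i))"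
    by (subst sum.reindex) (auto simp: inj_on_def)
  also have "(\<Sum>j\<in>nbhd i. ?d (i, j)) = (\<Sum>j\<in>nbhd i. - 2 * t * (u j - u i) + t\<^sup>2)"
    by (rule sum.cong) (use ne in \<open>auto simp: bond_sq_def u'_def power2_eq_square algebra_simps\<close>)
  also have "(\<Sum>j\<in>nbhd i. ?d (j, i)) = (\<Sum>j\<in>nbhd i. - 2 * t * (u j - u i) + t\<^sup>2)"
    by (rule sum.cong) (use ne in \<open>auto simp: bond_sq_def u'_def power2_eq_square algebra_simps\<close>)
  finally have "(\<Sum>b\<in>?F. ?d b) = 2 * (\<Sum>j\<in>nbhd i. - 2 * t * (u j - u i) + t\<^sup>2)" by simp
  also have "\<dots> = - 4 * t * lap u i + 2 * real (card (nbhd i)) * t\<^sup>2"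
    unfolding sum.distrib lap_def sum_distrib_left[symmetric] sum_constant by (simp add: algebra_simps)
  finally show "dirichlet (u' t) = dirichlet u - 4 * t * lap u i + 2 * real (card (nbhd i)) * t\<^sup>2"
    using h3 by (simp add: dirichlet_def infsumI)
qed

lemma linear_coeff_zero:
  fixes a b d :: real
  assumes "d > 0" "\<And>t. \<bar>t\<bar> < d \<Longrightarrow> a * t + b * t\<^sup>2 \<ge> 0"
  shows "a = 0"
proof (rule ccontr)
  assume a: "a \<noteq> 0"
  \<comment> \<open>The test value \<open>- a * r\<close> stays inside the interval by the first
    bound, and by the second the quadratic term is too small to outweigh the negative linear
    one.\<close>
  define r where "r = min (d / 2 / \<bar>a\<bar>) (1 / (2 * (\<bar>b\<bar> + 1)))"
  have r: "r > 0" "r \<le> d / 2 / \<bar>a\<bar>" "r \<le> 1 / (2 * (\<bar>b\<bar> + 1))"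
    using a assms(1) unfolding r_def by auto
  have "\<bar>a\<bar> * r \<le> d / 2" using r(2) a by (simp add: field_simps)
  then have "\<bar>- a * r\<bar> < d" using r(1) assms(1) by (simp add: abs_mult)
  then have "a * (- a * r) + b * (- a * r)\<^sup>2 \<ge> 0" by (rule assms(2))
  then have "a\<^sup>2 * r * (b * r - 1) \<ge> 0" by (simp add: power2_eq_square algebra_simps)
  moreover have "b * r < 1"
  proof -
    have "b * r \<le> \<bar>b\<bar> * (1 / (2 * (\<bar>b\<bar> + 1)))"
      using r by (intro mult_mono) auto
    also have "\<dots> < 1" by (simp add: field_simps)
    finally show ?thesis .
  qed
  ultimately show False using a r(1) by (smt (verit) mult_pos_neg mult_pos_pos zero_less_power2)
qed

section \<open>Polarization\<close>

definition polF :: "(int^'n \<Rightarrow> int^'n) \<Rightarrow> (int^'n) set \<Rightarrow> (int^'n \<Rightarrow> real) \<Rightarrow> int^'n \<Rightarrow> real" where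
  "polF \<sigma> H u x = (if x \<in> H then max (u x) (u (\<sigma> x))
     else if \<sigma> x \<in> H then min (u x) (u (\<sigma> x)) else u x)"

text \<open>In the locale below the last branch concerns only points of the mirror, where
  \<open>\<sigma> x = x\<close>.\<close>

definition polS :: "('a \<Rightarrow> 'a) \<Rightarrow> 'a set \<Rightarrow> 'a set \<Rightarrow> 'a set" where
  "polS \<sigma> H X = {x. if x \<in> H then x \<in> X \<or> \<sigma> x \<in> X
     else if \<sigma> x \<in> H then x \<in> X \<and> \<sigma> x \<in> X else x \<in> X}"

lemma mem_polS:
  "x \<in> polS \<sigma> H X \<longleftrightarrow> (if x \<in> H then x \<in> X \<or> \<sigma> x \<in> X
     else if \<sigma> x \<in> H then x \<in> X \<and> \<sigma> x \<in> X else x \<in> X)"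
  by (simp add: polS_def)

lemma polF_superlevel:
  "{x. polF \<sigma> H u x \<ge> t} = polS \<sigma> H {x. u x \<ge> t}"
  "{x. polF \<sigma> H u x > t} = polS \<sigma> H {x. u x > t}"
  by (auto simp: polF_def polS_def split: if_splits)

text \<open>Taking maxima and minima either keeps the partners or exchanges them. An exchange occurs
  for oppositely ordered pairs and changes the sum by \<open>2 * ((a - a') * (b - b'))\<close>,
  which is then not positive.\<close>

lemma max_min_dist_sq:
  fixes a b a' b' :: real
  shows "(max a a' - max b b')\<^sup>2 + (min a a' - min b b')\<^sup>2 \<le> (a - b)\<^sup>2 + (a' - b')\<^sup>2"
    and "a > a' \<Longrightarrow> b < b' \<Longrightarrow>
      (max a a' - max b b')\<^sup>2 + (min a a' - min b b')\<^sup>2 < (a - b)\<^sup>2 + (a' - b')\<^sup>2"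
proof -
  have e: "(a - b')\<^sup>2 + (a' - b)\<^sup>2 = (a - b)\<^sup>2 + (a' - b')\<^sup>2 + 2 * ((a - a') * (b - b'))"
    by (simp add: power2_eq_square algebra_simps)
  have "(a - a') * (b - b') < 0" if "a > a'" "b < b'" using that by (simp add: mult_pos_neg)
  then show "a > a' \<Longrightarrow> b < b' \<Longrightarrow>
      (max a a' - max b b')\<^sup>2 + (min a a' - min b b')\<^sup>2 < (a - b)\<^sup>2 + (a' - b')\<^sup>2"
    using e by (simp add: max_def min_def)
  have "(a - a') * (b - b') \<le> 0" if "a > a' \<and> b \<le> b' \<or> a \<le> a' \<and> b > b'"
    using that by (auto simp: mult_le_0_iff)
  then show "(max a a' - max b b')\<^sup>2 + (min a a' - min b b')\<^sup>2 \<le> (a - b)\<^sup>2 + (a' - b')\<^sup>2"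
    using e by (auto simp: max_def min_def not_le)
qed

text \<open>\<open>H\<close> is one side of a mirror of \<open>\<sigma>\<close>. By the last condition a bond can only cross the mirror
  between a point and its mirror image; this keeps the energy from increasing.\<close>

locale polarization =
  fixes \<sigma> :: "int^'n \<Rightarrow> int^'n" and H :: "(int^'n) set"
  assumes invol [simp]: "\<sigma> (\<sigma> x) = x"
    and adj_refl: "adj (\<sigma> x) (\<sigma> y) = adj x y"
    and half: "x \<in> H \<Longrightarrow> \<sigma> x \<notin> H"
    and mirror: "x \<notin> H \<Longrightarrow> \<sigma> x \<notin> H \<Longrightarrow> \<sigma> x = x"
    and cross: "x \<in> H \<Longrightarrow> \<sigma> y \<in> H \<Longrightarrow> adj x y \<Longrightarrow> y = \<sigma> x"
begin

lemma inj_\<sigma>: "inj \<sigma>"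
  by (metis injI invol)

lemma nbhd_refl: "nbhd (\<sigma> i) = \<sigma> ` nbhd i"
proof (rule set_eqI)
  show "x \<in> nbhd (\<sigma> i) \<longleftrightarrow> x \<in> \<sigma> ` nbhd i" for x
    by (metis (mono_tags, lifting) adj_refl image_iff invol mem_Collect_eq nbhd_def)
qed

lemma sum_nbhd_refl: "(\<Sum>j\<in>nbhd (\<sigma> i). h j) = (\<Sum>j\<in>nbhd i. h (\<sigma> j))"
  unfolding nbhd_refl by (subst sum.reindex) (auto intro: inj_on_subset[OF inj_\<sigma>])

lemma lap_refl: "lap u (\<sigma> i) = (\<Sum>j\<in>nbhd i. u (\<sigma> j) - u (\<sigma> i))"
  unfolding lap_def by (rule sum_nbhd_refl)

lemma bij_bonds: "bij_betw (map_prod \<sigma> \<sigma>) bonds bonds"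
  by (rule bij_betwI[where g = "map_prod \<sigma> \<sigma>"]) (auto simp: bonds_def adj_refl)

text \<open>A single bond may gain energy, so a bond is compared together with its mirror image.
  Inside one half this is \<open>max_min_dist_sq\<close>; a bond across the mirror joins
  \<open>i\<close> to \<open>\<sigma> i\<close> and keeps its energy; if one end is on the mirror,
  the two bonds are at most exchanged.\<close>

lemma pair_bond:
  fixes u :: "int^'n \<Rightarrow> real"
  assumes "adj i j"
  defines "v \<equiv> polF \<sigma> H u"
  shows "bond_sq v (i, j) + bond_sq v (\<sigma> i, \<sigma> j) \<le> bond_sq u (i, j) + bond_sq u (\<sigma> i, \<sigma> j)" 
    and "i \<in> H \<Longrightarrow> j \<in> H \<Longrightarrow> u i > u (\<sigma> i) \<Longrightarrow> u j < u (\<sigma> j) \<Longrightarrow>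
      bond_sq v (i, j) + bond_sq v (\<sigma> i, \<sigma> j) < bond_sq u (i, j) + bond_sq u (\<sigma> i, \<sigma> j)"
proof -
  show "i \<in> H \<Longrightarrow> j \<in> H \<Longrightarrow> u i > u (\<sigma> i) \<Longrightarrow> u j < u (\<sigma> j) \<Longrightarrow>
      bond_sq v (i, j) + bond_sq v (\<sigma> i, \<sigma> j) < bond_sq u (i, j) + bond_sq u (\<sigma> i, \<sigma> j)"
    using max_min_dist_sq(2)[of "u (\<sigma> i)" "u i" "u j" "u (\<sigma> j)"]
    by (simp add: v_def polF_def bond_sq_def half min.commute)
  let ?le = "\<lambda>i j. bond_sq v (i, j) + bond_sq v (\<sigma> i, \<sigma> j) \<le> bond_sq u (i, j) + bond_sq u (\<sigma> i, \<sigma> j)"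
  have base: "?le i j" if "i \<in> H" "adj i j" for i j
  proof -
    consider "j \<in> H" | "\<sigma> j \<in> H" | "\<sigma> j = j" "j \<notin> H" using mirror by blast
    then show ?thesis
    proof cases
      case 1
      then show ?thesis using max_min_dist_sq(1)[of "u i" "u (\<sigma> i)" "u j" "u (\<sigma> j)"] that
        by (simp add: v_def polF_def bond_sq_def half min.commute)
    next
      case 2
      then have "j = \<sigma> i" using cross that by blast
      then show ?thesis using that
        by (simp add: v_def polF_def bond_sq_def half power2_commute max_def min_def)
    next
      case 3
      then show ?thesis using that
        by (simp add: v_def polF_def bond_sq_def half power2_commute max_def min_def)
    qed
  qed
  have sym: "?le i j" if "i \<in> H \<or> j \<in> H" "adj i j" for i j
  proof (cases "i \<in> H")
    case True
    then show ?thesis using base that by blast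
  next
    case False
    then have "bond_sq v (j, i) + bond_sq v (\<sigma> j, \<sigma> i) \<le> bond_sq u (j, i) + bond_sq u (\<sigma> j, \<sigma> i)"
      using base[of j i] that by (simp add: adj_commute)
    then show ?thesis by (simp add: bond_sq_def power2_commute)
  qed
  consider "i \<in> H \<or> j \<in> H" | "\<sigma> i \<in> H \<or> \<sigma> j \<in> H" | "\<sigma> i = i" "\<sigma> j = j" "i \<notin> H" "j \<notin> H"
    using mirror by metis
  then show "?le i j"
  proof cases
    case 2
    then show ?thesis using sym[of "\<sigma> i" "\<sigma> j"] assms(1) by (simp add: adj_refl)
  qed (use sym assms(1) in \<open>auto simp: v_def polF_def bond_sq_def\<close>)
qed

text \<open>Summing a bond and its mirror image over all bonds counts the energy twice, so the
  pairwise comparison adds up.\<close>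

lemma dirichlet_pol:
  fixes u :: "int^'n \<Rightarrow> real"
  assumes su: "bond_sq u summable_on bonds"
  defines "v \<equiv> polF \<sigma> H u"
  shows "bond_sq v summable_on bonds" and "dirichlet v \<le> dirichlet u"
    and "dirichlet v = dirichlet u \<Longrightarrow> adj i j \<Longrightarrow> i \<in> H \<Longrightarrow> j \<in> H \<Longrightarrow> u i > u (\<sigma> i) \<Longrightarrow> u j \<ge> u (\<sigma> j)"
proof -
  let ?s = "map_prod \<sigma> \<sigma>"
  define p where "p z b = bond_sq z b + bond_sq z (?s b)" for z :: "int^'n \<Rightarrow> real" and b
  have hs: "(p z has_sum 2 * dirichlet z) bonds" if "bond_sq z summable_on bonds" for z
  proof -
    have 1: "(bond_sq z has_sum dirichlet z) bonds" using that by (simp add: dirichlet_def)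
    have "((\<lambda>b. bond_sq z (?s b)) has_sum dirichlet z) bonds"
      using has_sum_reindex_bij_betw[OF bij_bonds, of "bond_sq z" "dirichlet z"] 1 by simp
    from has_sum_add[OF 1 this] show ?thesis by (simp add: p_def[abs_def])
  qed
  have le: "p v b \<le> p u b" if "b \<in> bonds" for b
    using that pair_bond(1)[of "fst b" "snd b" u] by (cases b) (auto simp: p_def v_def bonds_def)
  have "bond_sq v b \<le> p u b" if "b \<in> bonds" for b
    using le[OF that] by (smt (verit) bond_sq_nonneg p_def)
  then show sv: "bond_sq v summable_on bonds"
    by (intro summable_on_comparison_test[OF has_sum_imp_summable[OF hs[OF su]]]) auto
  show "dirichlet v \<le> dirichlet u"
    using has_sum_mono[OF hs[OF sv] hs[OF su] le] by simp
  assume eq: "dirichlet v = dirichlet u" and b: "adj i j" "i \<in> H" "j \<in> H" "u i > u (\<sigma> i)"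
  show "u j \<ge> u (\<sigma> j)"
  proof (rule ccontr)
    assume "\<not> u j \<ge> u (\<sigma> j)"
    then have lt: "p v (i, j) < p u (i, j)" using pair_bond(2)[of i j u] b by (simp add: p_def v_def)
    \<comment> \<open>The pairwise losses are nonnegative and sum to 0, so each of them vanishes,
      also the strict one at \<open>(i, j)\<close>.\<close>
    have "((\<lambda>b. p u b - p v b) has_sum (2 * dirichlet u - 2 * dirichlet v)) bonds"
      using has_sum_add[OF hs[OF su] has_sum_cmult_right[OF hs[OF sv], of "-1"]] by simp
    then have z: "((\<lambda>b. p u b - p v b) has_sum 0) bonds" using eq by simp
    have "p u (i, j) - p v (i, j) = 0"
      by (rule nonneg_has_sum_le_0D[OF z]) (use le b in \<open>auto simp: bonds_def\<close>)
    then show False using lt by simp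
  qed
qed

text \<open>A strong maximum principle: \<open>u\<close> and its reflection agree with
  \<open>v\<close> at \<open>i\<close> and lie below \<open>v\<close> at every neighbour. With equal
  Laplacians the nonnegative differences sum to 0, so both equal \<open>v\<close> at all
  neighbours.\<close>

lemma zero_spreads:
  fixes u :: "int^'n \<Rightarrow> real"
  defines "v \<equiv> polF \<sigma> H u"
  assumes i: "i \<in> H" "u (\<sigma> i) = u i"
    and l: "lap u i = a" "lap u (\<sigma> i) = a" "lap v i = a"
    and j: "adj i j" "j \<in> H"
  shows "u (\<sigma> j) = u j"
proof -
  have vi: "v i = u i" using i by (simp add: v_def polF_def)
  have le: "u k \<le> v k" "u (\<sigma> k) \<le> v k" if "k \<in> nbhd i" for k
  proof -
    have ik: "adj i k" using that by (simp add: nbhd_def)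
    consider "k \<in> H" | "\<sigma> k \<in> H" "k \<notin> H" | "\<sigma> k = k" "k \<notin> H" using mirror by blast
    \<comment> \<open>Outside \<open>H\<close> the only possible neighbours are mirror points and
      \<open>\<sigma> i\<close> itself, where the hypothesis at \<open>i\<close> applies.\<close>
    then have "u k \<le> v k \<and> u (\<sigma> k) \<le> v k"
    proof cases
      case 2
      then have "k = \<sigma> i" using cross[OF i(1) _ ik] by simp
      then show ?thesis using 2 i by (simp add: v_def polF_def)
    qed (simp_all add: v_def polF_def)
    then show "u k \<le> v k" "u (\<sigma> k) \<le> v k" by auto
  qed
  have z1: "(\<Sum>k\<in>nbhd i. v k - u k) = 0"
    using l(1,3) vi by (simp add: lap_def sum_subtractf)
  have z2: "(\<Sum>k\<in>nbhd i. v k - u (\<sigma> k)) = 0"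
    using l(2,3) vi i(2) by (simp add: lap_refl sum_subtractf) (simp add: lap_def sum_subtractf)
  have "j \<in> nbhd i" using j by (simp add: nbhd_def)
  then have "v j - u j = 0" "v j - u (\<sigma> j) = 0"
    using z1 z2 le sum_nonneg_0[of "nbhd i" "\<lambda>k. v k - u k"] sum_nonneg_0[of "nbhd i" "\<lambda>k. v k - u (\<sigma> k)"]
    by (meson diff_ge_0_iff_ge finite_nbhd)+
  then show ?thesis by simp
qed

lemma refl_polS:
  "\<sigma> x \<in> polS \<sigma> H X \<longleftrightarrow> (if x \<in> H then x \<in> X \<and> \<sigma> x \<in> X else if \<sigma> x \<in> H then x \<in> X \<or> \<sigma> x \<in> X else x \<in> X)"
proof -
  consider "x \<in> H" "\<sigma> x \<notin> H" | "x \<notin> H" "\<sigma> x \<in> H" | "x \<notin> H" "\<sigma> x \<notin> H" "\<sigma> x = x"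
    using half mirror by blast
  then show ?thesis by cases (auto simp: polS_def)
qed

text \<open>Exactly the points that have a vacant mirror image in \<open>H\<close> are reflected.
  The explicit bijection gives the cardinality and also tracks the moment.\<close>

lemma polS_bij: "bij_betw (\<lambda>x. if \<sigma> x \<in> H \<and> \<sigma> x \<notin> X then \<sigma> x else x) X (polS \<sigma> H X)"
  (is "bij_betw ?h _ _")
proof (rule bij_betw_imageI)
  show "inj_on ?h X" by (auto simp: inj_on_def split: if_splits) (metis invol)+
  show "?h ` X = polS \<sigma> H X"
  proof (intro equalityI subsetI)
    fix y assume "y \<in> ?h ` X"
    then show "y \<in> polS \<sigma> H X" using half mirror by (auto simp: polS_def split: if_splits)
  next
    fix y assume y: "y \<in> polS \<sigma> H X"
    show "y \<in> ?h ` X"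
    proof (cases "y \<in> X")
      case True
      have "\<not> (\<sigma> y \<in> H \<and> \<sigma> y \<notin> X)"
      proof
        assume a: "\<sigma> y \<in> H \<and> \<sigma> y \<notin> X"
        then have "y \<notin> H" using half[of y] by blast
        then show False using a y by (simp add: polS_def)
      qed
      then have "?h y = y" by (rule if_not_P)
      from image_eqI[of y ?h y, OF this[symmetric] True] show ?thesis .
    next
      case False
      have y': "if y \<in> H then y \<in> X \<or> \<sigma> y \<in> X else if \<sigma> y \<in> H then y \<in> X \<and> \<sigma> y \<in> X else y \<in> X"
        using y unfolding polS_def mem_Collect_eq .
      have "y \<in> H" using y' False by presburger
      moreover have "\<sigma> y \<in> X" using y' False by presburger
      ultimately have "?h (\<sigma> y) = y" using False invol[of y] by presburger
      from image_eqI[of y ?h "\<sigma> y", OF this[symmetric] \<open>\<sigma> y \<in> X\<close>] show ?thesis .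
    qed
  qed
qed

lemma card_polS: "card (polS \<sigma> H X) = card X"
  using bij_betw_same_card[OF polS_bij] by simp

lemma finite_polS: "finite (polS \<sigma> H X) \<longleftrightarrow> finite X"
  using bij_betw_finite[OF polS_bij] by simp

lemma tame_pol:
  assumes "tame u"
  shows "tame (polF \<sigma> H u)"
proof -
  have "finite {i. \<bar>polF \<sigma> H u i\<bar> \<ge> e}" if "e > 0" for e
  proof (rule finite_subset)
    have f: "finite {i. \<bar>u i\<bar> \<ge> e}" using assms that by (auto simp: tame_def)
    then show "finite ({i. \<bar>u i\<bar> \<ge> e} \<union> \<sigma> ` {i. \<bar>u i\<bar> \<ge> e})" by simp
    have "\<bar>u i\<bar> \<ge> e \<or> \<bar>u (\<sigma> i)\<bar> \<ge> e" if "\<bar>polF \<sigma> H u i\<bar> \<ge> e" for i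
      using that by (auto simp: polF_def max_def min_def split: if_splits)
    then show "{i. \<bar>polF \<sigma> H u i\<bar> \<ge> e} \<subseteq> {i. \<bar>u i\<bar> \<ge> e} \<union> \<sigma> ` {i. \<bar>u i\<bar> \<ge> e}"
      by auto (metis (mono_tags, lifting) image_eqI invol mem_Collect_eq)
  qed
  then show ?thesis using assms dirichlet_pol(1) by (auto simp: tame_def)
qed

end

section \<open>Lattice reflections and the descent on the second moment\<close>

text \<open>Reflection in the plane x_k = m/2. For odd \<open>m\<close> the mirror runs between
  lattice points.\<close>

definition refl1 :: "'n \<Rightarrow> int \<Rightarrow> int^'n \<Rightarrow> int^'n" where
  "refl1 k m x = vupd x k (m - x $ k)"

text \<open>Reflection in the plane x_k - x_l = m, for distinct \<open>k\<close> and
  \<open>l\<close>.\<close>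

definition refl2 :: "'n \<Rightarrow> 'n \<Rightarrow> int \<Rightarrow> int^'n \<Rightarrow> int^'n" where
  "refl2 k l m x = vupd (vupd x k (x $ l + m)) l (x $ k - m)"

inductive_set Refl :: "(int^'n \<Rightarrow> int^'n) set" where
  refl1: "refl1 k m \<in> Refl"
| refl2: "k \<noteq> l \<Longrightarrow> refl2 k l m \<in> Refl"

definition Hs :: "(int^'n \<Rightarrow> int^'n) \<Rightarrow> int^'n \<Rightarrow> (int^'n) set" where
  "Hs \<sigma> c = {x. sqd x c < sqd (\<sigma> x) c}"

text \<open>\<open>Hs \<sigma> c\<close> is the open side of the mirror of \<open>\<sigma>\<close> that contains \<open>c\<close>; it is empty if \<open>c\<close> lies on the mirror.\<close>

definition centred :: "int^'n \<Rightarrow> (int^'n) set \<Rightarrow> bool" where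
  "centred c X \<longleftrightarrow> (\<forall>\<sigma>\<in>Refl. \<forall>x\<in>Hs \<sigma> c. \<sigma> x \<in> X \<longrightarrow> x \<in> X)"

text \<open>The gain in squared distance is the product of the signed distances of \<open>c\<close>
  and \<open>x\<close> to the mirror, up to a constant. Membership in \<open>Hs\<close> thus becomes
  a sign condition on integers.\<close>

lemma sqd_refl1_diff: "sqd (refl1 k m x) c - sqd x c = (m - 2 * c $ k) * (m - 2 * x $ k)"
  by (simp add: refl1_def sqd_vupd power2_eq_square algebra_simps)

lemma sqd_refl2_diff:
  "k \<noteq> l \<Longrightarrow> sqd (refl2 k l m x) c - sqd x c = 2 * (m - (c $ k - c $ l)) * (m - (x $ k - x $ l))"
  by (simp add: refl2_def sqd_vupd power2_eq_square algebra_simps)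

lemma Hs_refl1: "Hs (refl1 k m) c = {x. (m - 2 * c $ k) * (m - 2 * x $ k) > 0}"
  unfolding Hs_def sqd_refl1_diff[symmetric] by simp

lemma Hs_refl2:
  assumes "k \<noteq> l"
  shows "Hs (refl2 k l m) c = {x. (m - (c $ k - c $ l)) * (m - (x $ k - x $ l)) > 0}"
proof -
  have *: "2 * a * b > 0 \<longleftrightarrow> a * b > 0" for a b :: int
    by (simp add: mult.assoc)
  have "x \<in> Hs (refl2 k l m) c \<longleftrightarrow> 0 < sqd (refl2 k l m x) c - sqd x c" for x
    by (simp add: Hs_def)
  then show ?thesis unfolding sqd_refl2_diff[OF assms] * by blast
qed

lemma refl1_fixed: "refl1 k m x = x \<longleftrightarrow> m = 2 * x $ k"
  by (auto simp: refl1_def vec_eq_iff)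

lemma refl2_fixed: "k \<noteq> l \<Longrightarrow> refl2 k l m x = x \<longleftrightarrow> m = x $ k - x $ l"
  by (auto simp: refl2_def vec_eq_iff)

lemma refl2_swap: "k \<noteq> l \<Longrightarrow> refl2 k l m = refl2 l k (- m)"
  by (auto simp: fun_eq_iff refl2_def vec_eq_iff)

lemma Refl_invol: "\<sigma> \<in> Refl \<Longrightarrow> \<sigma> (\<sigma> x) = x"
  by (erule Refl.cases) (auto simp: refl1_def refl2_def vec_eq_iff)

lemma sqd_refl:
  assumes "\<sigma> \<in> Refl"
  shows "sqd (\<sigma> x) (\<sigma> y) = sqd x y"
  using assms
proof cases
  case (refl1 k m)
  show ?thesis unfolding refl1 refl1_def sqd_def
    by (rule sum.cong) (auto simp: power2_commute)
next
  case (refl2 k l m)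
  have *: "sqd a b = (a $ k - b $ k)\<^sup>2 + ((a $ l - b $ l)\<^sup>2 + (\<Sum>j\<in>UNIV-{k}-{l}. (a $ j - b $ j)\<^sup>2))" for a b
    unfolding sqd_def using refl2(2) by (subst sum.remove[of _ k], simp, simp, subst sum.remove[of _ l]) auto
  have "(\<Sum>j\<in>UNIV-{k}-{l}. (\<sigma> x $ j - \<sigma> y $ j)\<^sup>2) = (\<Sum>j\<in>UNIV-{k}-{l}. (x $ j - y $ j)\<^sup>2)"
    by (rule sum.cong) (auto simp: refl2(1) refl2_def)
  then show ?thesis using refl2(2) unfolding *[of "\<sigma> x"] *[of x] by (simp add: refl2(1) refl2_def)
qed

lemma Hs_empty: "\<sigma> \<in> Refl \<Longrightarrow> \<sigma> c = c \<Longrightarrow> Hs \<sigma> c = {}"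
  unfolding Hs_def using sqd_refl by (metis (mono_tags, lifting) empty_Collect_eq less_irrefl)

lemma polarization_Refl:
  assumes "\<sigma> \<in> Refl" "\<sigma> c \<noteq> c"
  shows "polarization \<sigma> (Hs \<sigma> c)"
proof
  fix x y
  show inv: "\<sigma> (\<sigma> x) = x" for x using Refl_invol[OF assms(1)] .
  show "adj (\<sigma> x) (\<sigma> y) = adj x y" using sqd_refl[OF assms(1)] by (simp add: adj_iff)
  show "\<sigma> x \<notin> Hs \<sigma> c" if "x \<in> Hs \<sigma> c" using that inv by (auto simp: Hs_def)
  show "\<sigma> x = x" if "x \<notin> Hs \<sigma> c" "\<sigma> x \<notin> Hs \<sigma> c"
  proof -
    have "sqd (\<sigma> x) c - sqd x c = 0" using that by (simp add: Hs_def inv)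
    from assms(1) this assms(2) show ?thesis
      by cases (auto simp: sqd_refl1_diff sqd_refl2_diff refl1_fixed refl2_fixed)
  qed
  assume a: "x \<in> Hs \<sigma> c" "\<sigma> y \<in> Hs \<sigma> c" "adj x y"
  have p: "sqd (\<sigma> x) c - sqd x c > 0" "sqd (\<sigma> y) c - sqd y c < 0"
    using a by (simp_all add: Hs_def inv)
  from a(3) obtain j t where y: "y = vupd x j t" "t = x $ j + 1 \<or> t = x $ j - 1" by (rule adjE)
  from assms(1) show "y = \<sigma> x"
  proof cases
    case (refl1 k m)
    \<comment> \<open>The integer \<open>m - 2 * x $ k\<close> changes by 2 along a bond in
      direction \<open>k\<close>; a sign change is only possible between 1 and -1, which makes the
      bond a mirror pair.\<close>
    have p': "(m - 2 * c $ k) * (m - 2 * x $ k) > 0" "(m - 2 * c $ k) * (m - 2 * y $ k) < 0"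
      using p unfolding refl1 sqd_refl1_diff by auto
    then have "m - 2 * x $ k > 0 \<and> m - 2 * y $ k < 0 \<or> m - 2 * x $ k < 0 \<and> m - 2 * y $ k > 0"
      by (auto simp: zero_less_mult_iff mult_less_0_iff)
    then have "j = k" "m - x $ k = t" using y by (auto split: if_splits)
    then show ?thesis by (simp add: refl1 y(1) refl1_def)
  next
    case (refl2 k l m)
    \<comment> \<open>Here the integer changes by at most 1 along a bond, so it cannot change sign
      without vanishing: no bond crosses a diagonal mirror.\<close>
    have p': "(m - (c $ k - c $ l)) * (m - (x $ k - x $ l)) > 0" "(m - (c $ k - c $ l)) * (m - (y $ k - y $ l)) < 0"
      using p unfolding refl2(1) sqd_refl2_diff[OF refl2(2)] by (auto simp: zero_less_mult_iff mult_less_0_iff)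
    then have "m - (x $ k - x $ l) > 0 \<and> m - (y $ k - y $ l) < 0 \<or> m - (x $ k - x $ l) < 0 \<and> m - (y $ k - y $ l) > 0"
      by (auto simp: zero_less_mult_iff mult_less_0_iff)
    then have False using y refl2(2) by (auto split: if_splits)
    then show ?thesis ..
  qed
qed

lemma Hs_other_side:
  assumes "\<sigma> \<in> Refl" "\<sigma> c \<noteq> c" "\<sigma> c' \<noteq> c'"
  shows "Hs \<sigma> c' = Hs \<sigma> c \<or> Hs \<sigma> c' = {x. \<sigma> x \<in> Hs \<sigma> c}"
proof -
  have *: "{x. \<sigma> x \<in> Hs \<sigma> c} = {x. sqd (\<sigma> x) c - sqd x c < 0}"
    by (auto simp: Hs_def Refl_invol[OF assms(1)])
  show ?thesis unfolding * using assms
    by (elim Refl.cases) (auto simp: Hs_refl1 Hs_refl2 sqd_refl1_diff sqd_refl2_diff refl1_fixed refl2_fixed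
        zero_less_mult_iff mult_less_0_iff)
qed

text \<open>Taken in the natural numbers, which makes the descent well-founded and guarantees a
  minimizing centre among infinitely many lattice points.\<close>

definition moment :: "int^'n \<Rightarrow> (int^'n) set \<Rightarrow> nat" where
  "moment c X = (\<Sum>x\<in>X. nat (sqd x c))"

lemma moment_polS:
  assumes "\<sigma> \<in> Refl" "\<sigma> c \<noteq> c" "finite X"
  shows "moment c' (polS \<sigma> (Hs \<sigma> c) X) = (\<Sum>x\<in>X. nat (sqd (if \<sigma> x \<in> Hs \<sigma> c \<and> \<sigma> x \<notin> X then \<sigma> x else x) c'))"
  unfolding moment_def
  by (rule sum.reindex_bij_betw[OF polarization.polS_bij[OF polarization_Refl[OF assms(1,2)]], symmetric])

text \<open>Every point that moves goes to the side of \<open>c\<close>, hence strictly closer to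
  \<open>c\<close>; if no point moved, the bijection would be the identity on
  \<open>X\<close>.\<close>

lemma moment_polS_less:
  assumes "\<sigma> \<in> Refl" "\<sigma> c \<noteq> c" "finite X" "polS \<sigma> (Hs \<sigma> c) X \<noteq> X"
  shows "moment c (polS \<sigma> (Hs \<sigma> c) X) < moment c X"
proof -
  interpret polarization \<sigma> "Hs \<sigma> c" using assms by (intro polarization_Refl)
  let ?H = "Hs \<sigma> c"
  let ?h = "\<lambda>x. if \<sigma> x \<in> ?H \<and> \<sigma> x \<notin> X then \<sigma> x else x"
  have le: "nat (sqd (?h x) c) \<le> nat (sqd x c)" for x
    by (auto simp: Hs_def)
  have "\<exists>x\<in>X. \<sigma> x \<in> ?H \<and> \<sigma> x \<notin> X"
  proof (rule ccontr)
    assume "\<not> ?thesis"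
    then have "?h x = x" if "x \<in> X" for x using that by auto
    then have "?h ` X = X" by (auto intro: rev_image_eqI)
    then show False using assms(4) bij_betw_imp_surj_on[OF polS_bij[of X]] by simp
  qed
  then obtain x where x: "x \<in> X" "\<sigma> x \<in> ?H" "\<sigma> x \<notin> X" by blast
  then have "nat (sqd (?h x) c) < nat (sqd x c)" using sqd_nonneg[of "\<sigma> x" c] by (auto simp: Hs_def)
  then have "(\<Sum>x\<in>X. nat (sqd (?h x) c)) < (\<Sum>x\<in>X. nat (sqd x c))"
    using x(1) le by (intro sum_strict_mono_ex1[OF assms(3)] ballI bexI[of _ x])
  then show ?thesis using moment_polS[OF assms(1-3)] by (simp add: moment_def)
qed

lemma moment_polS_fixed:
  assumes "\<sigma> \<in> Refl" "\<sigma> c \<noteq> c" "finite X" "\<sigma> c' = c'"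
  shows "moment c' (polS \<sigma> (Hs \<sigma> c) X) = moment c' X"
proof -
  have "sqd (\<sigma> x) c' = sqd x c'" for x using sqd_refl[OF assms(1), of x c'] assms(4) by simp
  then show ?thesis unfolding moment_polS[OF assms(1-3)] by (auto simp: moment_def intro!: sum.cong)
qed

lemma moment_refl:
  assumes "\<sigma> \<in> Refl"
  shows "moment (\<sigma> c) (\<sigma> ` X) = moment c X"
proof -
  have "inj_on \<sigma> X" by (rule inj_on_inverseI[of _ \<sigma>]) (rule Refl_invol[OF assms])
  then show ?thesis by (simp add: moment_def sum.reindex sqd_refl[OF assms])
qed

text \<open>If a polarization towards \<open>c\<close> changed \<open>X\<close>, it would lower the moment. By induction the result \<open>Y\<close> is
  centred at its own minimizing \<open>c'\<close>. If \<open>c'\<close> is on the mirror, then \<open>X\<close> and \<open>Y\<close> have the same moment about it; if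
  not, rigidity makes \<open>X\<close> equal to \<open>Y\<close> or a mirror image of \<open>Y\<close>. All cases contradict the minimality of \<open>c\<close>.\<close>

lemma moment_minimal_imp_centred:
  fixes \<O> :: "(int^'n) set set" and C :: "(int^'n) set"
  assumes fin: "\<And>X. X \<in> \<O> \<Longrightarrow> finite X"
    and closed: "\<And>X \<sigma> c. X \<in> \<O> \<Longrightarrow> \<sigma> \<in> Refl \<Longrightarrow> c \<in> C \<Longrightarrow> \<sigma> c \<noteq> c \<Longrightarrow> polS \<sigma> (Hs \<sigma> c) X \<in> \<O>"
    and rigid: "\<And>X \<sigma> c. X \<in> \<O> \<Longrightarrow> \<sigma> \<in> Refl \<Longrightarrow> c \<in> C \<Longrightarrow> \<sigma> c \<noteq> c \<Longrightarrow> centred c (polS \<sigma> (Hs \<sigma> c) X) \<Longrightarrow>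
       polS \<sigma> (Hs \<sigma> c) X = X \<or> X = \<sigma> ` polS \<sigma> (Hs \<sigma> c) X \<and> \<sigma> c \<in> C"
    and X: "X \<in> \<O>" "c \<in> C" "\<And>c'. c' \<in> C \<Longrightarrow> moment c X \<le> moment c' X"
  shows "centred c X"
  using X
proof (induction "moment c X" arbitrary: X c rule: less_induct)
  case less
  have "polS \<sigma> (Hs \<sigma> c) X = X" if \<sigma>: "\<sigma> \<in> Refl" "\<sigma> c \<noteq> c" for \<sigma>
  proof (rule ccontr)
    interpret polarization \<sigma> "Hs \<sigma> c" using \<sigma> by (intro polarization_Refl)
    define Y where "Y = polS \<sigma> (Hs \<sigma> c) X"
    assume "polS \<sigma> (Hs \<sigma> c) X \<noteq> X"
    then have neq: "Y \<noteq> X" and lt: "moment c Y < moment c X"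
      using moment_polS_less[OF \<sigma> fin] less.prems by (auto simp: Y_def)
    obtain c' where c': "c' \<in> C" "\<And>d. d \<in> C \<Longrightarrow> moment c' Y \<le> moment d Y"
      using ex_has_least_nat[of "\<lambda>d. d \<in> C" c "\<lambda>d. moment d Y"] less.prems(2) by blast
    have YO: "Y \<in> \<O>" unfolding Y_def using closed less.prems \<sigma> by blast
    have lt': "moment c' Y < moment c X" using c'(2)[OF less.prems(2)] lt by simp
    have cen: "centred c' Y" by (rule less.hyps[OF lt' YO c'])
    have nf: "\<sigma> c' \<noteq> c'"
    proof
      assume "\<sigma> c' = c'"
      then have "moment c' Y = moment c' X"
        unfolding Y_def using \<sigma> fin less.prems by (intro moment_polS_fixed) auto
      then show False using lt' less.prems(3)[OF c'(1)] by simp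
    qed
    from Hs_other_side[OF \<sigma> nf] show False
    proof
      assume e: "Hs \<sigma> c' = Hs \<sigma> c"
      then have Y: "Y = polS \<sigma> (Hs \<sigma> c') X" by (simp add: Y_def)
      have "X = \<sigma> ` Y \<and> \<sigma> c' \<in> C"
        using rigid[OF less.prems(1) \<sigma>(1) c'(1) nf] cen neq unfolding Y by metis
      then have "moment (\<sigma> c') X = moment c' Y" "\<sigma> c' \<in> C" using moment_refl[OF \<sigma>(1)] by auto
      then show False using lt' less.prems(3) by fastforce
    next
      \<comment> \<open>Being centred at \<open>c'\<close> favours one side of the mirror, being
        polarized towards \<open>c\<close> the other. So \<open>Y\<close> is symmetric under
        \<open>\<sigma>\<close>, which means that the polarization moved nothing.\<close>
      assume e: "Hs \<sigma> c' = {x. \<sigma> x \<in> Hs \<sigma> c}"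
      have st: "x \<in> Y" if "\<sigma> x \<in> Y" "\<sigma> x \<in> Hs \<sigma> c" for x
        using bspec[OF bspec[OF cen[unfolded centred_def] \<sigma>(1)], of x] that by (simp add: e)
      have "x \<in> Y \<longleftrightarrow> x \<in> X" for x
      proof -
        consider "x \<in> Hs \<sigma> c" "\<sigma> x \<notin> Hs \<sigma> c" | "x \<notin> Hs \<sigma> c" "\<sigma> x \<in> Hs \<sigma> c"
          | "x \<notin> Hs \<sigma> c" "\<sigma> x \<notin> Hs \<sigma> c"
          using half by blast
        then show ?thesis
          using st[of x] st[of "\<sigma> x"] refl_polS[of x X] mem_polS[of x \<sigma> "Hs \<sigma> c" X]
          by cases (simp_all add: Y_def, blast+)
      qed
      then show False using neq by blast
    qed
  qed note fixed = this
  show ?case unfolding centred_def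
  proof (intro ballI impI)
    fix \<sigma> x assume s: "\<sigma> \<in> Refl" "x \<in> Hs \<sigma> c" "\<sigma> x \<in> X"
    then have "\<sigma> c \<noteq> c" using Hs_empty by blast
    then have "polS \<sigma> (Hs \<sigma> c) X = X" using fixed s by blast
    then show "x \<in> X" using s(2,3) unfolding polS_def by auto
  qed
qed

section \<open>Sets decreasing away from a centre\<close>

text \<open>The mirror halfway between the old and the new coordinate exchanges the two points, and
  the new one is nearer to \<open>c\<close>.\<close>

lemma centred_vupd:
  assumes "centred c X" "x \<in> X" "\<bar>t - c $ k\<bar> < \<bar>x $ k - c $ k\<bar>"
  shows "vupd x k t \<in> X"
proof -
  define m where "m = t + x $ k"
  have "(t - c $ k)\<^sup>2 < (x $ k - c $ k)\<^sup>2" using assms(3) abs_le_square_iff[of "x $ k - c $ k" "t - c $ k"] by linarith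
  then have "(m - 2 * c $ k) * (m - 2 * t) > 0"
    by (simp add: m_def power2_eq_square algebra_simps)
  then have "vupd x k t \<in> Hs (refl1 k m) c" by (simp add: Hs_refl1)
  moreover have "refl1 k m (vupd x k t) = x" by (simp add: refl1_def m_def vec_eq_iff)
  ultimately show ?thesis
    using assms(1,2) Refl.refl1[of k m] unfolding centred_def by metis
qed

text \<open>With respect to \<open>c\<close>, the coordinate difference D becomes D - 2b; this is
  smaller in absolute value exactly for 0 < b < D.\<close>

lemma centred_diag:
  assumes "centred c X" "x \<in> X" "k \<noteq> l" "0 < b" "b < (x $ k - x $ l) - (c $ k - c $ l)"
  shows "vupd (vupd x k (x $ k - b)) l (x $ l + b) \<in> X"
proof -
  define m where "m = x $ k - x $ l - b"
  let ?y = "vupd (vupd x k (x $ k - b)) l (x $ l + b)"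
  have "(m - (c $ k - c $ l)) * (m - (?y $ k - ?y $ l)) > 0"
    using assms(3-5) by (simp add: m_def)
  then have "?y \<in> Hs (refl2 k l m) c" using assms(3) by (simp add: Hs_refl2)
  moreover have "refl2 k l m ?y = x" using assms(3) by (auto simp: refl2_def m_def vec_eq_iff)
  ultimately show ?thesis
    using assms(1,2) Refl.refl2[OF assms(3), of m] unfolding centred_def by metis
qed

lemma centred_box:
  assumes "centred c X" "x \<in> X" "\<And>k. z $ k = x $ k \<or> \<bar>z $ k - c $ k\<bar> < \<bar>x $ k - c $ k\<bar>"
  shows "z \<in> X"
proof -
  have "(\<chi> k. if k \<in> A then z $ k else x $ k) \<in> X" if "finite A" for A
    using that
  proof induction
    case empty
    have "(\<chi> k. x $ k) = x" by (simp add: vec_eq_iff)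
    then show ?case using assms(2) by simp
  next
    case (insert a A)
    let ?w = "\<chi> k. if k \<in> A then z $ k else x $ k"
    have e: "(\<chi> k. if k \<in> insert a A then z $ k else x $ k) = vupd ?w a (z $ a)"
      by (auto simp: vec_eq_iff)
    have wa: "?w $ a = x $ a" using insert(2) by simp
    show ?case
    proof (cases "z $ a = x $ a")
      case True
      then have "vupd ?w a (z $ a) = ?w" using wa vupd_same[of ?w a] by simp
      then show ?thesis unfolding e using insert(3) by simp
    next
      case False
      then show ?thesis unfolding e using assms(3)[of a] wa
        by (intro centred_vupd[OF assms(1) insert(3)]) simp
    qed
  qed
  from this[of UNIV] show ?thesis by simp
qed

lemma centred_simplex:
  fixes c :: "int^'n" and y :: "'n \<Rightarrow> int"
  assumes "centred c X" "x \<in> X" "M < \<bar>x $ k - c $ k\<bar>" "M > 0" "\<And>l. y l \<ge> 0" "finite A"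
    "k \<notin> A" "sum y A < M"
  shows "(\<chi> l. if l = k then c $ k + M - sum y A else if l \<in> A then c $ l + y l else c $ l) \<in> X"
  using assms(6-8)
proof (induction A)
  case empty
  \<comment> \<open>All coordinates but \<open>k\<close> are pulled back to those of
    \<open>c\<close>. Only absolute values matter, so \<open>x\<close> may lie on either side of
    \<open>c\<close>.\<close>
  show ?case by (rule centred_box[OF assms(1,2)]) (use assms(3,4) in auto)
next
  case (insert a A)
  let ?p = "\<lambda>A. \<chi> l. if l = k then c $ k + M - sum y A else if l \<in> A then c $ l + y l else c $ l"
  have s: "sum y (insert a A) = y a + sum y A" using insert by simp
  have IH: "?p A \<in> X" using insert assms(5)[of a] by (intro insert.IH) auto
  have ak: "a \<noteq> k" using insert by auto
  have e: "?p (insert a A) = vupd (vupd (?p A) k (?p A $ k - y a)) a (?p A $ a + y a)"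
    using insert ak by (auto simp: vec_eq_iff)
  show ?case
  proof (cases "y a = 0")
    case True
    then have "?p (insert a A) = ?p A" using insert ak by (auto simp: vec_eq_iff)
    then show ?thesis using IH by simp
  next
    case False
    have "vupd (vupd (?p A) k (?p A $ k - y a)) a (?p A $ a + y a) \<in> X"
      by (rule centred_diag[OF assms(1) IH])
        (use ak False assms(5)[of a] insert s in \<open>auto simp: less_le\<close>)
    then show ?thesis using e by simp
  qed
qed

text \<open>The simplex point has the prescribed coordinates except at \<open>k\<close>, where its
  offset is at least M - dq + q > q; lowering that offset to \<open>y k\<close> stays in
  \<open>X\<close>.\<close>

lemma centred_cube:
  fixes c :: "int^'n"
  assumes "centred c X" "x \<in> X" "M < \<bar>x $ k - c $ k\<bar>" "int CARD('n) * q < M" "q \<ge> 0"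
    "\<And>l. 0 \<le> y l \<and> y l \<le> q"
  shows "(\<chi> l. c $ l + y l) \<in> X"
proof -
  have "sum y (UNIV - {k}) \<le> (\<Sum>l\<in>UNIV-{k}. q)" using assms(6) by (intro sum_mono) auto
  also have "\<dots> = (int CARD('n) - 1) * q" by (simp add: card_Diff_singleton of_nat_diff Suc_leI)
  finally have s: "sum y (UNIV - {k}) \<le> int CARD('n) * q - q" by (simp add: algebra_simps)
  have M: "M > 0" using assms(4,5) by (smt (verit) mult_nonneg_nonneg of_nat_0_le_iff)
  let ?p = "\<chi> l. if l = k then c $ k + M - sum y (UNIV-{k}) else if l \<in> UNIV-{k} then c $ l + y l else c $ l"
  have "?p \<in> X" using assms s M by (intro centred_simplex[OF assms(1-3)]) auto
  then show ?thesis
    by (rule centred_box[OF assms(1)]) (use assms(4) s assms(6)[of k] in auto)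
qed

text \<open>A cube with (q+1)^d points fits into \<open>X\<close>, so q + 1 is at most N^(1/d),
  while M is at most d(q+1).\<close>

lemma centred_coord_bound:
  fixes c :: "int^'n"
  assumes "centred c X" "x \<in> X" "finite X" "card X = N" "N \<ge> 1"
  shows "real_of_int \<bar>x $ k - c $ k\<bar> \<le> (real CARD('n) + 1) * real N powr (1 / real CARD('n))"
proof -
  let ?d = "CARD('n)"
  define r where "r = real N powr (1 / real ?d)"
  have r1: "r \<ge> 1" using assms(5) by (simp add: r_def ge_one_powr_ge_zero)
  \<comment> \<open>The lost 1 is what \<open>centred_simplex\<close> needs for its strict
    inequality; it is absorbed by \<open>r \<ge> 1\<close>, which turns the factor d into d +
    1.\<close>
  define M where "M = \<bar>x $ k - c $ k\<bar> - 1"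
  have "M \<le> ?d * r"
  proof (cases "M \<le> 0")
    case True
    then show ?thesis using r1 by (smt (verit) mult_nonneg_nonneg of_int_le_0_iff of_nat_0_le_iff)
  next
    case False
    \<comment> \<open>The largest integer with \<open>int ?d * q < M\<close>.\<close>
    define q where "q = (M - 1) div int ?d"
    have q: "q \<ge> 0" "int ?d * q < M" "M \<le> int ?d * (q + 1)"
    proof -
      show "q \<ge> 0" using False by (simp add: q_def pos_imp_zdiv_nonneg_iff)
      have m: "M - 1 = int ?d * q + (M - 1) mod int ?d" by (simp add: q_def)
      have "(M - 1) mod int ?d \<ge> 0" "(M - 1) mod int ?d < int ?d" by auto
      then show "int ?d * q < M" "M \<le> int ?d * (q + 1)" unfolding distrib_left using m by linarith+
    qed
    define B where "B = (\<lambda>f. \<chi> l. c $ l + f l) ` (PiE (UNIV::'n set) (\<lambda>_. {0..q}))"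
    have "B \<subseteq> X"
      using centred_cube[OF assms(1,2), of M k q] q by (auto simp: B_def M_def PiE_iff)
    then have "card B \<le> N" using assms(3,4) card_mono by blast
    moreover have "card B = nat (q + 1) ^ ?d"
    proof -
      have "inj_on (\<lambda>f. \<chi> l. c $ l + f l) (PiE (UNIV::'n set) (\<lambda>_. {0..q}))"
        by (auto simp: inj_on_def vec_eq_iff)
      then have "card B = card (PiE (UNIV::'n set) (\<lambda>_. {0..q}))" unfolding B_def by (rule card_image)
      then show ?thesis by (simp add: card_PiE)
    qed
    ultimately have "real (nat (q + 1)) ^ ?d \<le> real N" by (metis of_nat_le_iff of_nat_power)
    then have "real_of_int (q + 1) ^ ?d \<le> real N" using q(1) by simp
    then have "(real_of_int (q + 1) powr real ?d) powr (1 / real ?d) \<le> r"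
      unfolding r_def using q(1) by (intro powr_mono2) (auto simp: powr_realpow)
    then have "real_of_int (q + 1) \<le> r" using q(1) by (simp add: powr_powr)
    then have "real ?d * real_of_int (q + 1) \<le> real ?d * r" by (simp add: mult_left_mono)
    moreover have "real_of_int M \<le> real ?d * real_of_int (q + 1)"
      using q(3) by (metis of_int_le_iff of_int_mult of_int_of_nat_eq)
    ultimately show ?thesis by linarith
  qed
  then show ?thesis using r1 by (simp add: M_def r_def algebra_simps)
qed

lemma diameter_emb_bound:
  fixes X :: "(int^'n) set"
  assumes "\<And>x k. x \<in> X \<Longrightarrow> real_of_int \<bar>x $ k - c $ k\<bar> \<le> r" "r \<ge> 0"
  shows "diameter (emb ` X) \<le> 2 * real CARD('n) * r"
proof (rule diameter_le)
  show "emb ` X \<noteq> {} \<or> 0 \<le> 2 * real CARD('n) * r" using assms(2) by simp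
  fix a b assume "a \<in> emb ` X" "b \<in> emb ` X"
  then obtain x y where xy: "x \<in> X" "y \<in> X" "a = emb x" "b = emb y" by auto
  have "norm (a - b) \<le> (\<Sum>k\<in>UNIV. \<bar>(a - b) $ k\<bar>)" by (rule norm_le_l1_cart)
  also have "\<dots> \<le> (\<Sum>k\<in>(UNIV::'n set). 2 * r)"
  proof (rule sum_mono)
    fix k
    have "\<bar>(a - b) $ k\<bar> = \<bar>real_of_int (x $ k - c $ k) - real_of_int (y $ k - c $ k)\<bar>"
      by (simp add: xy emb_def)
    then show "\<bar>(a - b) $ k\<bar> \<le> 2 * r" using assms(1)[OF xy(1), of k] assms(1)[OF xy(2), of k] by simp
  qed
  finally show "norm (a - b) \<le> 2 * real CARD('n) * r" by simp
qed

text \<open>Walk from \<open>x\<close> to \<open>q\<close> by unit steps that each approach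
  \<open>q\<close> in one coordinate. The spanned box only shrinks, so the path never leaves
  \<open>G\<close>.\<close>

lemma box_move:
  fixes x q :: "int^'n"
  assumes closed: "\<And>a b. a \<in> P \<Longrightarrow> a \<in> G \<Longrightarrow> b \<in> G \<Longrightarrow> adj a b \<Longrightarrow> b \<in> P"
    and hull: "\<And>z. (\<And>k. min (x $ k) (q $ k) \<le> z $ k \<and> z $ k \<le> max (x $ k) (q $ k)) \<Longrightarrow> z \<in> G"
    and "x \<in> P"
  shows "q \<in> P"
  using hull assms(3)
proof (induction "\<Sum>k\<in>UNIV. nat \<bar>x $ k - q $ k\<bar>" arbitrary: x rule: less_induct)
  case less
  show ?case
  proof (cases "x = q")
    case True
    then show ?thesis using less.prems(2) by simp
  next
    case False
    then obtain k where k: "x $ k \<noteq> q $ k" by (auto simp: vec_eq_iff)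
    define t where "t = (if x $ k < q $ k then x $ k + 1 else x $ k - 1)"
    let ?y = "vupd x k t"
    have a: "adj x ?y" by (rule adj_vupdI) (simp add: t_def)
    have xG: "x \<in> G" by (rule less.prems(1)) auto
    have yG: "?y \<in> G" by (rule less.prems(1)) (use k in \<open>auto simp: t_def\<close>)
    have yP: "?y \<in> P" by (rule closed[OF less.prems(2) xG yG a])
    have "nat \<bar>?y $ k - q $ k\<bar> < nat \<bar>x $ k - q $ k\<bar>" using k by (auto simp: t_def)
    then have lt: "(\<Sum>k\<in>UNIV. nat \<bar>?y $ k - q $ k\<bar>) < (\<Sum>k\<in>UNIV. nat \<bar>x $ k - q $ k\<bar>)"
      by (intro sum_strict_mono_ex1) auto
    show ?thesis
    proof (rule less.hyps[OF lt _ yP])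
      fix z assume z: "\<And>l. min (?y $ l) (q $ l) \<le> z $ l \<and> z $ l \<le> max (?y $ l) (q $ l)"
      show "z \<in> G"
      proof (rule less.prems(1))
        fix l
        show "min (x $ l) (q $ l) \<le> z $ l \<and> z $ l \<le> max (x $ l) (q $ l)"
          using z[of l] k by (cases "l = k") (auto simp: t_def split: if_splits)
      qed
    qed
  qed
qed

section \<open>Transience and capacitary potentials\<close>

lemma inverse_fourth_root_bound:
  fixes z :: real
  assumes "\<bar>z\<bar> \<le> 1/20"
  shows "(1 + z) powr (-1/4) \<le> 1 - z / 4 + 37/200 * z\<^sup>2"
proof (cases "z = 0")
  case False
  define diff :: "nat \<Rightarrow> real \<Rightarrow> real" where
    "diff m t = (if m = 0 then (1 + t) powr (-1/4) else if m = 1 then - 1/4 * (1 + t) powr (-5/4)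
       else 5/16 * (1 + t) powr (-9/4))" for m t
  have "\<exists>t. (if z < 0 then z < t \<and> t < 0 else 0 < t \<and> t < z) \<and>
      (1 + z) powr (-1/4) = (\<Sum>m<2. diff m 0 / fact m * (z - 0) ^ m) + diff 2 t / fact 2 * (z - 0) ^ 2"
  proof (rule Taylor[where a = "-1/20" and b = "1/20"])
    show "diff 0 = (\<lambda>z. (1 + z) powr (-1/4))" by (simp add: diff_def fun_eq_iff)
    show "\<forall>m t. m < 2 \<and> -1/20 \<le> t \<and> t \<le> 1/20 \<longrightarrow> DERIV (diff m) t :> diff (Suc m) t"
    proof (intro allI impI)
      fix m :: nat and t :: real assume *: "m < 2 \<and> -1/20 \<le> t \<and> t \<le> 1/20"
      then have "1 + t > 0" by simp
      have "m = 0 \<or> m = 1" using * by auto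
      then show "DERIV (diff m) t :> diff (Suc m) t"
        using \<open>1 + t > 0\<close> unfolding diff_def
        by (auto intro!: derivative_eq_intros simp: powr_diff field_simps)
    qed
  qed (use assms False in auto)
  then obtain t where t: "if z < 0 then z < t \<and> t < 0 else 0 < t \<and> t < z"
    and e: "(1 + z) powr (-1/4) = (\<Sum>m<2. diff m 0 / fact m * (z - 0) ^ m) + diff 2 t / fact 2 * (z - 0) ^ 2"
    by blast
  \<comment> \<open>The second derivative is largest at the left end of the interval, and half of
    5/16 times 1.17 is still below 37/200.\<close>
  have "(1 + t) powr (-9/4) \<le> (19/20) powr (-9/4)"
    using t assms by (intro powr_mono2') (auto split: if_splits)
  also have "\<dots> \<le> (19/20) powr (-3)" by (intro powr_mono') auto
  also have "\<dots> = 1 / (19/20) ^ 3" by (simp add: powr_minus_divide powr_numeral)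
  also have "\<dots> \<le> 1.17" by (simp add: power_divide)
  finally have "diff 2 t / fact 2 \<le> 37/200" by (simp add: diff_def)
  then have "diff 2 t / fact 2 * (z - 0) ^ 2 \<le> 37/200 * z\<^sup>2"
    using mult_right_mono[of _ _ "z\<^sup>2"] by (metis diff_zero zero_le_power2)
  then show ?thesis unfolding e by (simp add: diff_def numeral_2_eq_2)
qed simp

text \<open>A positive superharmonic function: in dimension three and above, \<open>|x|\<^bsup>-2s\<^esup>\<close> is strictly superharmonic at
  infinity for \<open>0 < s < 1/2\<close>. The shift 420 makes the Taylor bound above applicable at all lattice points.\<close>

definition barrier :: "int^'n \<Rightarrow> int^'n \<Rightarrow> real" where
  "barrier a x = (420 + real_of_int (sqd x a)) powr (-1/4)"

lemma barrier_pos: "barrier a x > 0"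
  using sqd_nonneg[of x a] by (simp add: barrier_def)

text \<open>Opposite neighbours are paired so that the first-order terms in \<open>y\<close>
  cancel.\<close>

lemma barrier_superharmonic:
  fixes x :: "int^'n"
  assumes "CARD('n) \<ge> 3"
  shows "(\<Sum>j\<in>nbhd x. 1 - barrier a j / barrier a x) \<ge> 0"
proof -
  define q where "q = real_of_int (sqd x a)"
  define s where "s = 420 + q"
  define y where "y k = real_of_int (x $ k - a $ k)" for k
  have q: "q = (\<Sum>k\<in>UNIV. (y k)\<^sup>2)" by (simp add: q_def y_def sqd_def)
  have q0: "q \<ge> 0" using sqd_nonneg[of x a] by (simp add: q_def)
  have s: "s > 0" using q0 by (simp add: s_def)
  let ?b = "\<lambda>z. 1 - z / 4 + 37/200 * z\<^sup>2"
  have r: "barrier a (vupd x k (x $ k + e)) / barrier a x \<le> ?b ((1 + 2 * real_of_int e * y k) / s)"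
    if "e = 1 \<or> e = -1" for k e
  proof -
    let ?z = "(1 + 2 * real_of_int e * y k) / s"
    have sq: "real_of_int (sqd (vupd x k (x $ k + e)) a) = q + 1 + 2 * real_of_int e * y k"
      using that by (auto simp: sqd_vupd q_def y_def power2_eq_square algebra_simps)
    have "(y k)\<^sup>2 \<le> q" unfolding q by (rule member_le_sum) auto
    \<comment> \<open>This fixes the shift: 20(1 + 2|y|) is at most 20 + 400 + y^2, and 20 + 400 =
      420.\<close>
    moreover have "40 * \<bar>y k\<bar> \<le> (y k)\<^sup>2 + 400"
      using zero_le_power2[of "\<bar>y k\<bar> - 20"] by (simp add: power2_diff)
    ultimately have "20 * \<bar>1 + 2 * real_of_int e * y k\<bar> \<le> s" using that by (auto simp: s_def abs_if split: if_splits)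
    then have z: "\<bar>?z\<bar> \<le> 1/20" using s by (simp add: field_simps)
    have "420 + real_of_int (sqd (vupd x k (x $ k + e)) a) = s * (1 + ?z)"
      unfolding sq using s by (simp add: s_def field_simps)
    then have "barrier a (vupd x k (x $ k + e)) = s powr (-1/4) * (1 + ?z) powr (-1/4)"
      unfolding barrier_def using s z by (simp add: powr_mult)
    moreover have "barrier a x = s powr (-1/4)" by (simp add: barrier_def s_def q_def)
    ultimately have "barrier a (vupd x k (x $ k + e)) / barrier a x = (1 + ?z) powr (-1/4)"
      using s by simp
    then show ?thesis using inverse_fourth_root_bound[OF z] by simp
  qed
  have two: "?b ((1 + 2 * y) / s) + ?b ((1 - 2 * y) / s) = 2 - 1 / (2 * s) + 37/100 / s\<^sup>2 + 148/100 * (y\<^sup>2 / s\<^sup>2)" for y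
    using s by (simp add: field_simps power2_eq_square)
  have "(\<Sum>j\<in>nbhd x. barrier a j / barrier a x) =
      (\<Sum>k\<in>UNIV. barrier a (vupd x k (x $ k + 1)) / barrier a x + barrier a (vupd x k (x $ k - 1)) / barrier a x)"
    by (rule sum_nbhd)
  also have "\<dots> \<le> (\<Sum>k\<in>UNIV. 2 - 1 / (2 * s) + 37/100 / s\<^sup>2 + 148/100 * ((y k)\<^sup>2 / s\<^sup>2))"
  proof (rule sum_mono)
    fix k
    show "barrier a (vupd x k (x $ k + 1)) / barrier a x + barrier a (vupd x k (x $ k - 1)) / barrier a x
      \<le> 2 - 1 / (2 * s) + 37/100 / s\<^sup>2 + 148/100 * ((y k)\<^sup>2 / s\<^sup>2)"
      using r[of 1 k] r[of "-1" k] two[of "y k"] by simp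
  qed
  also have "\<dots> = CARD('n) * (2 - 1 / (2 * s) + 37/100 / s\<^sup>2) + 148/100 * (q / s\<^sup>2)"
    unfolding sum.distrib sum_distrib_left[symmetric] sum_divide_distrib[symmetric] q sum_constant sum_subtractf
    by (simp add: algebra_simps)
  also have "\<dots> \<le> 2 * real CARD('n)"
  proof -
    \<comment> \<open>The decisive comparison is 148/100 against d/2: it holds from d = 3 on, and it
      is why the Taylor constant has to be as small as 37/200.\<close>
    have "CARD('n) * (37/100) + 148/100 * q \<le> CARD('n) * (s / 2)"
      using assms q0 mult_right_mono[of 3 "real CARD('n)" q] by (simp add: s_def algebra_simps)
    then have "(CARD('n) * (37/100) + 148/100 * q) / s\<^sup>2 \<le> CARD('n) * (s / 2) / s\<^sup>2"
      by (intro divide_right_mono) auto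
    then show ?thesis using s by (simp add: field_simps power2_eq_square)
  qed
  also have "2 * real CARD('n) = (\<Sum>j\<in>nbhd x. 1)" by (subst sum_nbhd) simp
  finally show ?thesis by (simp add: sum_subtractf)
qed

text \<open>Twice the superharmonicity sum at the centre of the barrier, where each of the 2d
  neighbours has ratio \<open>(421/420) powr (-1/4)\<close>.\<close>

definition hardy :: "('n::finite) itself \<Rightarrow> real" where
  "hardy _ = 4 * real CARD('n) * (1 - (421/420) powr (-1/4))"

lemma hardy_pos: "hardy TYPE('n::finite) > 0"
proof -
  have "(421/420 :: real) powr (-1/4) < 1 powr (-1/4)" by (rule powr_less_mono2_neg) auto
  then show ?thesis by (simp add: hardy_def)
qed

text \<open>Ground state substitution: a positive superharmonic g bounds the energy below by twice
  the sum of u(i)^2 times the nonnegative defect of g at i. Only the term at \<open>a\<close> is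
  kept. This is transience: small energy forces small values everywhere.\<close>

lemma hardy_ineq:
  fixes u :: "int^'n \<Rightarrow> real"
  assumes d: "CARD('n) \<ge> 3" and fin: "finite (supp u)"
  shows "hardy TYPE('n) * (u a)\<^sup>2 \<le> dirichlet u"
proof -
  let ?g = "barrier a"
  define A where "A = insert a (supp u)"
  have A: "finite A" "supp u \<subseteq> A" using fin by (auto simp: A_def)
  let ?F = "{b \<in> bonds. fst b \<in> A \<or> snd b \<in> A}"
  define P where "P b = (u (fst b))\<^sup>2 * (1 - ?g (snd b) / ?g (fst b))" for b :: "(int^'n) \<times> (int^'n)"
  have fF: "finite ?F" by (rule finite_bonds_touching[OF A(1)])
  have le: "P b + P (prod.swap b) \<le> bond_sq u b" for b
  proof -
    obtain i j where b: "b = (i, j)" by (cases b)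
    have g: "?g i > 0" "?g j > 0" by (rule barrier_pos)+
    \<comment> \<open>Picone's inequality on one bond.\<close>
    have "0 \<le> (u i * ?g j - u j * ?g i)\<^sup>2 / (?g i * ?g j)" using g by simp
    also have "\<dots> = (u i)\<^sup>2 * (?g j / ?g i) + (u j)\<^sup>2 * (?g i / ?g j) - 2 * u i * u j"
      using g by (simp add: field_simps power2_eq_square)
    finally show ?thesis by (simp add: b P_def bond_sq_def power2_eq_square algebra_simps)
  qed
  have bij: "bij_betw prod.swap ?F ?F"
    by (rule bij_betwI[where g = prod.swap]) (auto simp: bonds_def adj_commute)
  have sw: "(\<Sum>b\<in>?F. P (prod.swap b)) = (\<Sum>b\<in>?F. P b)"
    by (rule sum.reindex_bij_betw[OF bij])
  have "(\<Sum>b\<in>?F. P b) = (\<Sum>b\<in>Sigma A nbhd. P b)"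
  proof (rule sum.mono_neutral_right[OF fF])
    show "Sigma A nbhd \<subseteq> ?F" by (auto simp: bonds_def nbhd_def)
    show "\<forall>b\<in>?F - Sigma A nbhd. P b = 0"
    proof
      fix b assume "b \<in> ?F - Sigma A nbhd"
      then have "fst b \<notin> A" by (cases b) (auto simp: bonds_def nbhd_def)
      then have "u (fst b) = 0" using A(2) by (auto simp: supp_def)
      then show "P b = 0" by (simp add: P_def)
    qed
  qed
  also have "\<dots> = (\<Sum>i\<in>A. \<Sum>j\<in>nbhd i. P (i, j))"
    using A(1) by (subst sum.Sigma) auto
  also have "\<dots> = (\<Sum>i\<in>A. (u i)\<^sup>2 * (\<Sum>j\<in>nbhd i. 1 - ?g j / ?g i))"
    by (simp add: P_def sum_distrib_left)
  also have "\<dots> \<ge> (u a)\<^sup>2 * (\<Sum>j\<in>nbhd a. 1 - ?g j / ?g a)"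
    using A(1) barrier_superharmonic[OF d]
    by (intro member_le_sum[where f = "\<lambda>i. (u i)\<^sup>2 * (\<Sum>j\<in>nbhd i. 1 - ?g j / ?g i)"])
       (auto simp: A_def)
  also have "(\<Sum>j\<in>nbhd a. 1 - ?g j / ?g a) = hardy TYPE('n) / 2"
  proof -
    have "?g (vupd a k (a $ k + e)) / ?g a = (421/420) powr (-1/4)" if "e = 1 \<or> e = -1" for k e
      using that by (auto simp: barrier_def sqd_vupd powr_divide)
    from this[of 1] this[of "-1"] show ?thesis by (subst sum_nbhd) (simp add: hardy_def)
  qed
  finally have "hardy TYPE('n) * (u a)\<^sup>2 \<le> 2 * (\<Sum>b\<in>?F. P b)" by (simp add: mult.commute)
  also have "\<dots> = (\<Sum>b\<in>?F. P b + P (prod.swap b))" by (simp add: sum.distrib sw)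
  also have "\<dots> \<le> (\<Sum>b\<in>?F. bond_sq u b)" by (rule sum_mono) (rule le)
  also have "\<dots> = dirichlet u" by (rule dirichlet_finite(1)[OF A, symmetric])
  finally show ?thesis .
qed

text \<open>\<open>B\<close> is the whole lattice for the capacity and a ball for the relative
  capacity, so that both share one treatment.\<close>

definition potentials :: "(int^'n) set \<Rightarrow> (int^'n) set \<Rightarrow> (int^'n \<Rightarrow> real) set" where
  "potentials B X = {u. finite (supp u) \<and> supp u \<subseteq> B \<and> (\<forall>i\<in>X. u i \<ge> 1)}"

definition dcap :: "(int^'n) set \<Rightarrow> (int^'n) set \<Rightarrow> real" where
  "dcap B X = Inf (dirichlet ` potentials B X)"

lemma dcap_le: "u \<in> potentials B X \<Longrightarrow> dcap B X \<le> dirichlet u"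
  unfolding dcap_def by (rule cInf_lower) (auto intro!: bdd_belowI[of _ 0] dirichlet_nonneg)

text \<open>Cutting off at height \<open>e\<close> and dividing by \<open>1 - e\<close> gives an
  admissible function of finite support whose energy grows by at most the factor (1 - e)^(-2); then
  \<open>e\<close> tends to 0.\<close>

lemma dcap_le_tame:
  assumes "tame u" "supp u \<subseteq> B" "\<And>i. i \<in> X \<Longrightarrow> u i \<ge> 1"
  shows "dcap B X \<le> dirichlet u"
proof -
  have le: "dcap B X * (1 - e)\<^sup>2 \<le> dirichlet u" if e: "0 < e" "e < 1" for e
  proof -
    define v where "v i = inverse (1 - e) * max (u i - e) 0" for i
    have fin: "finite {i. \<bar>u i\<bar> \<ge> e}" using assms(1) e by (simp add: tame_def)
    have "supp v \<subseteq> {i. \<bar>u i\<bar> \<ge> e}" using e by (auto simp: supp_def v_def)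
    then have "finite (supp v)" by (rule finite_subset[OF _ fin])
    moreover have "supp v \<subseteq> B"
    proof
      fix i assume "i \<in> supp v"
      then have "u i \<noteq> 0" using e by (auto simp: supp_def v_def max_def split: if_splits)
      then show "i \<in> B" using assms(2) by (auto simp: supp_def)
    qed
    moreover have "v i \<ge> 1" if "i \<in> X" for i
      using assms(3)[OF that] e by (simp add: v_def field_simps max_def)
    ultimately have "v \<in> potentials B X" by (simp add: potentials_def)
    then have "dcap B X \<le> dirichlet v" by (rule dcap_le)
    also have "dirichlet v = (inverse (1 - e))\<^sup>2 * dirichlet (\<lambda>i. max (u i - e) 0)"
      unfolding v_def by (rule dirichlet_cmult)
    also have "dirichlet (\<lambda>i. max (u i - e) 0) \<le> dirichlet u"
    proof (rule dirichlet_mono(2))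
      show "bond_sq u summable_on bonds" using assms(1) by (simp add: tame_def)
      show "bond_sq (\<lambda>i. max (u i - e) 0) b \<le> bond_sq u b" for b
        unfolding bond_sq_def by (intro abs_le_square_iff[THEN iffD1]) (auto simp: max_def)
    qed
    finally show ?thesis using e by (simp add: field_simps mult_left_mono)
  qed
  have "((\<lambda>e. dcap B X * (1 - e)\<^sup>2) \<longlongrightarrow> dcap B X * (1 - 0)\<^sup>2) (at_right 0)"
    by (intro tendsto_intros)
  moreover have "eventually (\<lambda>e. dcap B X * (1 - e)\<^sup>2 \<le> dirichlet u) (at_right (0::real))"
    unfolding eventually_at_right_field by (intro exI[of _ 1]) (auto intro: le)
  ultimately have "dcap B X * (1 - 0)\<^sup>2 \<le> dirichlet u"
    by (intro tendsto_upperbound) auto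
  then show ?thesis by simp
qed

text \<open>By the parallelogram identity, differences of a minimizing sequence have small energy;
  by \<open>hardy_ineq\<close> the sequence is then uniformly Cauchy.\<close>

lemma dcap_attained:
  fixes X B :: "(int^'n) set"
  assumes d: "CARD('n) \<ge> 3" and X: "finite X" "X \<subseteq> B"
  obtains u where "tame u" "supp u \<subseteq> B" "\<And>i. i \<in> X \<Longrightarrow> u i \<ge> 1" "dirichlet u \<le> dcap B X"
proof -
  let ?c = "hardy TYPE('n)"
  define s where "s = dcap B X"
  have "(\<lambda>i. if i \<in> X then 1 else 0) \<in> potentials B X"
    using X by (auto simp: potentials_def supp_def)
  then have ne: "dirichlet ` potentials B X \<noteq> {}" by blast
  have "\<exists>u\<in>potentials B X. dirichlet u < s + 1 / (real n + 1)" for n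
    using cInf_lessD[OF ne, of "s + 1 / (real n + 1)"] by (auto simp: s_def dcap_def)
  then obtain f where f: "\<And>n. f n \<in> potentials B X" "\<And>n. dirichlet (f n) < s + 1 / (real n + 1)"
    by metis
  have fs: "finite (supp (f n))" "supp (f n) \<subseteq> B" for n using f(1) by (auto simp: potentials_def)
  have f1: "f n i \<ge> 1" if "i \<in> X" for n i using f(1) that by (auto simp: potentials_def)
  have diff: "?c * (f m i - f n i)\<^sup>2 \<le> 2 * (1 / (real m + 1) + 1 / (real n + 1))" for m n i
  proof -
    have fsd: "finite (supp (\<lambda>i. f m i - f n i))" "finite (supp (\<lambda>i. f m i + f n i))"
      by (rule finite_subset[of _ "supp (f m) \<union> supp (f n)"]; use fs in \<open>auto simp: supp_def\<close>)+
    \<comment> \<open>The midpoint is admissible, so its energy is at least the infimum.\<close>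
    have "(\<lambda>i. 1/2 * (f m i + f n i)) \<in> potentials B X"
    proof -
      have "supp (\<lambda>i. 1/2 * (f m i + f n i)) \<subseteq> supp (f m) \<union> supp (f n)" by (auto simp: supp_def)
      moreover have "1/2 * (f m i + f n i) \<ge> 1" if "i \<in> X" for i using f1[OF that, of m] f1[OF that, of n] by simp
      moreover have "finite (supp (f m) \<union> supp (f n))" "supp (f m) \<union> supp (f n) \<subseteq> B" using fs by auto
      ultimately show ?thesis unfolding potentials_def by (blast intro: finite_subset)
    qed
    then have "s \<le> dirichlet (\<lambda>i. 1/2 * (f m i + f n i))" unfolding s_def by (rule dcap_le)
    also have "\<dots> = 1/4 * dirichlet (\<lambda>i. f m i + f n i)" by (subst dirichlet_cmult) (simp add: power2_eq_square)
    finally have "dirichlet (\<lambda>i. f m i - f n i) \<le> 2 * (1 / (real m + 1) + 1 / (real n + 1))"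
      using dirichlet_parallelogram[OF fs(1) fs(1), of m n] f(2)[of m] f(2)[of n] by simp
    then show ?thesis using hardy_ineq[OF d fsd(1), of i] by linarith
  qed
  have unif: "\<exists>M. \<forall>m\<ge>M. \<forall>n\<ge>M. \<forall>i. \<bar>f m i - f n i\<bar> < e" if "e > 0" for e
  proof -
    have cpos: "?c > 0" by (rule hardy_pos)
    obtain M :: nat where M: "4 / (?c * e\<^sup>2) < real M" using reals_Archimedean2 by blast
    show ?thesis
    proof (intro exI[of _ M] allI impI)
      fix m n i assume mn: "M \<le> m" "M \<le> n"
      have M0: "real M > 0" using M cpos that by (smt (verit) divide_pos_pos mult_pos_pos zero_less_power)
      have "1 / (real m + 1) \<le> 1 / real M" "1 / (real n + 1) \<le> 1 / real M" using mn M0 by (auto intro!: divide_left_mono)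
      then have "?c * (f m i - f n i)\<^sup>2 \<le> 4 / real M" using diff[of m i n] by (simp add: algebra_simps)
      also have "\<dots> < ?c * e\<^sup>2" using M M0 cpos that by (simp add: field_simps)
      finally have "\<bar>f m i - f n i\<bar>\<^sup>2 < e\<^sup>2" using cpos by simp
      then show "\<bar>f m i - f n i\<bar> < e" by (rule power2_less_imp_less) (use that in simp)
    qed
  qed
  have "uniformly_Cauchy_on UNIV f"
    unfolding uniformly_Cauchy_on_def dist_real_def using unif by simp metis
  then obtain u where u: "uniform_limit UNIV f u sequentially"
    by (auto simp: uniformly_convergent_on_def dest!: Cauchy_uniformly_convergent)
  have lim: "(\<lambda>n. f n i) \<longlonglongrightarrow> u i" for i using tendsto_uniform_limitI[OF u] by simp
  show ?thesis
  proof
    show u1: "u i \<ge> 1" if "i \<in> X" for i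
      using f1[OF that] by (intro tendsto_lowerbound[OF lim[of i]]) auto
    show "supp u \<subseteq> B"
    proof
      fix i assume "i \<in> supp u"
      show "i \<in> B"
      proof (rule ccontr)
        assume "i \<notin> B"
        then have "f n i = 0" for n using fs(2)[of n] by (auto simp: supp_def)
        then have "u i = 0" using lim[of i] by (simp add: LIMSEQ_const_iff)
        then show False using \<open>i \<in> supp u\<close> by (simp add: supp_def)
      qed
    qed
    \<comment> \<open>Lower semicontinuity of the energy: on finitely many bonds pointwise
      convergence suffices.\<close>
    have part: "sum (bond_sq u) F \<le> s" if "finite F" "F \<subseteq> bonds" for F
    proof (rule LIMSEQ_le)
      show "(\<lambda>n. sum (bond_sq (f n)) F) \<longlonglongrightarrow> sum (bond_sq u) F"
        unfolding bond_sq_def by (intro tendsto_intros lim)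
      show "(\<lambda>n. s + 1 / (real n + 1)) \<longlonglongrightarrow> s"
        using tendsto_add[OF tendsto_const[of s] LIMSEQ_inverse_real_of_nat] by (simp add: inverse_eq_divide add.commute)
      show "\<exists>N. \<forall>n\<ge>N. sum (bond_sq (f n)) F \<le> s + 1 / (real n + 1)"
      proof (intro exI allI impI)
        fix n
        have "sum (bond_sq (f n)) F \<le> dirichlet (f n)"
          unfolding dirichlet_def by (rule finite_sum_le_infsum) (use that dirichlet_finite(2)[OF fs(1) order_refl] in auto)
        then show "sum (bond_sq (f n)) F \<le> s + 1 / (real n + 1)" using f(2)[of n] by simp
      qed
    qed
    have su: "bond_sq u summable_on bonds"
      by (rule nonneg_bdd_above_summable_on) (auto intro!: bdd_aboveI[of _ s] part)
    show "dirichlet u \<le> dcap B X"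
      unfolding dirichlet_def s_def[symmetric] by (rule infsum_le_finite_sums[OF su part])
    \<comment> \<open>Where |u| is at least \<open>e\<close>, a member of the sequence uniformly
      closer than \<open>e\<close> cannot vanish.\<close>
    have "finite {i. \<bar>u i\<bar> \<ge> e}" if e: "e > 0" for e
    proof -
      obtain n where n: "\<And>i. dist (f n i) (u i) < e"
        using uniform_limitD[OF u e] by (auto simp: eventually_sequentially)
      have "{i. \<bar>u i\<bar> \<ge> e} \<subseteq> supp (f n)" using n by (auto simp: supp_def dist_real_def) (metis abs_minus_cancel diff_0 not_le)
      then show ?thesis using fs(1) finite_subset by blast
    qed
    then show "tame u" using su by (simp add: tame_def)
  qed
qed

section \<open>Optimal sets for the capacity\<close>

lemma tame_update:
  fixes u :: "int^'n \<Rightarrow> real"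
  assumes "tame u"
  shows "tame (u(i := a))"
proof -
  have "bond_sq (u(i := u i + (a - u i))) summable_on bonds"
    by (rule dirichlet_perturb(1)) (use assms in \<open>simp add: tame_def\<close>)
  moreover have "finite {j. \<bar>(u(i := a)) j\<bar> \<ge> e}" if "e > 0" for e
    by (rule finite_subset[of _ "insert i {j. \<bar>u j\<bar> \<ge> e}"]) (use assms that in \<open>auto simp: tame_def\<close>)
  ultimately show ?thesis by (simp add: tame_def)
qed

text \<open>The maximum is attained at finitely many points. The one extreme in some coordinate
  direction has a strictly smaller neighbour, so its Laplacian is negative.\<close>

lemma tame_max:
  fixes u :: "int^'n \<Rightarrow> real"
  assumes "tame u" "u z > 0"
  obtains i where "u i \<ge> u z" "lap u i < 0"
proof -
  obtain k :: 'n where True by blast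
  define S where "S = {j. \<bar>u j\<bar> \<ge> u z}"
  have S: "finite S" "z \<in> S" using assms by (auto simp: S_def tame_def)
  define M where "M = Max (u ` S)"
  have Mge: "u j \<le> M" for j
  proof (cases "j \<in> S")
    case True
    then show ?thesis using S by (simp add: M_def)
  next
    case False
    have "u z \<le> M" using S by (simp add: M_def)
    then show ?thesis using False by (simp add: S_def)
  qed
  define T where "T = {j. u j = M}"
  have "M \<in> u ` S" using S unfolding M_def by (intro Max_in) auto
  then have "T \<noteq> {}" by (auto simp: T_def)
  have "u j = M \<Longrightarrow> j \<in> S" for j using Mge[of z] assms(2) by (simp add: S_def)
  then have "finite T" using S(1) by (auto simp: T_def intro: finite_subset)
  obtain i where i: "i \<in> T" "\<And>j. j \<in> T \<Longrightarrow> j $ k \<le> i $ k"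
    using arg_min_if_finite[OF \<open>finite T\<close> \<open>T \<noteq> {}\<close>, of "\<lambda>j. - (j $ k)"]
    by (metis linorder_not_less neg_less_iff_less)
  have ui: "u i = M" using i(1) by (simp add: T_def)
  let ?j = "vupd i k (i $ k + 1)"
  have "?j \<in> nbhd i" by (simp add: nbhd_def adj_vupdI)
  moreover have "u ?j < u i"
    using i(2)[of ?j] Mge[of ?j] ui by (auto simp: T_def less_le)
  ultimately have "(\<Sum>j\<in>nbhd i. u j - u i) < (\<Sum>j\<in>nbhd i. 0)"
    using Mge ui by (intro sum_strict_mono_ex1) auto
  then have "lap u i < 0" by (simp add: lap_def)
  then show ?thesis using that[of i] ui Mge[of z] by simp
qed

lemma lap_uminus: "lap (\<lambda>i. - u i) i = - lap u i"
  by (simp add: lap_def sum_negf[symmetric])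

text \<open>Set and function compete as a pair; this allows the set to be exchanged while the
  function is varied.\<close>

definition feasible :: "(int^'n) set \<Rightarrow> nat \<Rightarrow> (int^'n) set \<Rightarrow> (int^'n \<Rightarrow> real) \<Rightarrow> bool" where
  "feasible B N X u \<longleftrightarrow> tame u \<and> supp u \<subseteq> B \<and> X \<subseteq> B \<and> finite X \<and> card X = N \<and> (\<forall>i\<in>X. u i \<ge> 1)"

locale cap_optimal =
  fixes B :: "(int^'n) set" and N X u
  assumes N: "N \<ge> 1"
    and feasible: "feasible B N X u"
    and minimal: "\<And>Y v. feasible B N Y v \<Longrightarrow> dirichlet u \<le> dirichlet v"
begin

lemma basic: "tame u" "supp u \<subseteq> B" "X \<subseteq> B" "finite X" "card X = N" "i \<in> X \<Longrightarrow> u i \<ge> 1"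
  using feasible by (auto simp: feasible_def)

text \<open>The set \<open>Y\<close> may depend on the perturbation, which is what yields
  harmonicity even at a point of \<open>X\<close> that can be replaced.\<close>

lemma harmonic_if_perturbable:
  assumes "i \<in> B" "e > 0"
    and Y: "\<And>t. \<bar>t\<bar> < e \<Longrightarrow> \<exists>Y\<subseteq>B. finite Y \<and> card Y = N \<and> (\<forall>j\<in>Y. (u(i := u i + t)) j \<ge> 1)"
  shows "lap u i = 0"
proof -
  have s: "bond_sq u summable_on bonds" using basic(1) by (simp add: tame_def)
  have "- 4 * lap u i * t + 2 * real (card (nbhd i)) * t\<^sup>2 \<ge> 0" if t: "\<bar>t\<bar> < e" for t
  proof -
    obtain Y where "Y \<subseteq> B" "finite Y" "card Y = N" "\<forall>j\<in>Y. (u(i := u i + t)) j \<ge> 1"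
      using Y[OF t] by blast
    moreover have "supp (u(i := u i + t)) \<subseteq> B" using basic(2) assms(1) by (auto simp: supp_def split: if_splits)
    ultimately have "feasible B N Y (u(i := u i + t))" using basic(1) by (simp add: feasible_def tame_update)
    from minimal[OF this] show ?thesis unfolding dirichlet_perturb(2)[OF s] by (simp add: algebra_simps)
  qed
  from linear_coeff_zero[OF assms(2) this] show ?thesis by simp
qed

lemma harmonic: "i \<in> B \<Longrightarrow> i \<notin> X \<Longrightarrow> lap u i = 0"
  by (rule harmonic_if_perturbable[of i 1]) (use basic in \<open>auto intro!: exI[of _ X]\<close>)

text \<open>A further point \<open>z\<close> with \<open>u z \<ge> 1\<close> could replace any point of \<open>X\<close>, so \<open>u\<close> would be harmonic even at its maximum.\<close>

lemma superlevel_subset: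
  assumes "u z \<ge> 1"
  shows "z \<in> X"
proof (rule ccontr)
  assume z: "z \<notin> X"
  obtain i where i: "u i \<ge> u z" "lap u i < 0" using tame_max[OF basic(1), of z] assms by auto
  have B: "i \<in> B" "z \<in> B" using i(1) assms basic(2) by (auto simp: supp_def)
  have "lap u i = 0"
  proof (cases "i \<in> X")
    case True
    have "\<exists>Y\<subseteq>B. finite Y \<and> card Y = N \<and> (\<forall>j\<in>Y. (u(i := u i + t)) j \<ge> 1)" for t
    proof (intro exI conjI)
      show "insert z (X - {i}) \<subseteq> B" "finite (insert z (X - {i}))" using B basic by auto
      show "card (insert z (X - {i})) = N"
        using z True basic(4,5) by (simp add: card_Diff_singleton card_gt_0_iff) (metis N Suc_pred' less_eq_Suc_le One_nat_def)
      show "\<forall>j\<in>insert z (X - {i}). (u(i := u i + t)) j \<ge> 1" using basic(6) assms z True by auto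
    qed
    then show ?thesis using harmonic_if_perturbable[OF B(1) zero_less_one] by blast
  qed (rule harmonic[OF B(1)])
  then show False using i(2) by simp
qed

text \<open>With this, polarizing the function polarizes the set, and equal values of
  \<open>u\<close> imply equal membership in \<open>X\<close>.\<close>

lemma level: "X = {i. u i \<ge> 1}"
  using superlevel_subset basic(6) by auto

text \<open>A negative minimum would lie in \<open>B\<close> outside \<open>X\<close>, where
  \<open>u\<close> is harmonic, against \<open>tame_max\<close> for \<open>- u\<close>.\<close>

lemma nonneg: "u i \<ge> 0"
proof (rule ccontr)
  assume neg: "\<not> u i \<ge> 0"
  have t: "tame (\<lambda>i. - u i)" using basic(1) by (simp add: tame_def bond_sq_def[abs_def] power2_commute)
  obtain j where j: "- u j \<ge> - u i" "lap (\<lambda>i. - u i) j < 0"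
    using tame_max[OF t, of i] neg by auto
  then have "u j < 0" using neg by simp
  then have "j \<in> B" "j \<notin> X" using basic(2) basic(6)[of j] by (auto simp: supp_def)
  then show False using harmonic j(2) by (simp add: lap_uminus)
qed

lemma zero_neighbours:
  assumes "i \<in> B" "u i = 0" "adj i j"
  shows "u j = 0"
proof -
  have "i \<notin> X" using basic(6)[of i] assms(2) by auto
  then have "(\<Sum>j\<in>nbhd i. u j) = 0" using harmonic[OF assms(1)] assms(2) by (simp add: lap_def)
  then show ?thesis using assms(3) nonneg sum_nonneg_0[of "nbhd i" u j] by (simp add: nbhd_def[of i, symmetric]) (simp add: nbhd_def)
qed

end

text \<open>\<open>compat\<close> keeps the polarized pair inside \<open>B\<close>. It is trivial
  for the whole lattice and holds in a ball around 0 if \<open>H\<close> consists of the points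
  nearer to 0 than their images.\<close>

locale cap_polarized = cap_optimal B N X u + polarization \<sigma> H
  for B :: "(int^'n) set" and N X u \<sigma> H +
  assumes compat: "i \<in> H \<Longrightarrow> \<sigma> i \<in> B \<Longrightarrow> i \<in> B"
begin

abbreviation "v \<equiv> polF \<sigma> H u"
abbreviation "Y \<equiv> polS \<sigma> H X"

lemma pol_level: "Y = {i. v i \<ge> 1}"
  by (subst level) (rule polF_superlevel(1)[symmetric])

lemma feasible_pol: "feasible B N Y v"
  unfolding feasible_def
proof (intro conjI)
  show "tame v" by (rule tame_pol) (rule basic)
  show "finite Y" "card Y = N" by (simp_all add: finite_polS card_polS basic)
  show "\<forall>i\<in>Y. 1 \<le> v i" using pol_level by auto
  have uB: "i \<in> B" if "u i \<noteq> 0" for i using that basic(2) by (auto simp: supp_def)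
  show "supp v \<subseteq> B"
  proof
    fix i assume "i \<in> supp v"
    then have "v i \<noteq> 0" by (simp add: supp_def)
    then consider "i \<in> H" "u i \<noteq> 0 \<or> u (\<sigma> i) \<noteq> 0" | "u i \<noteq> 0"
      using nonneg[of i] nonneg[of "\<sigma> i"] by (auto simp: polF_def max_def min_def split: if_splits)
    then show "i \<in> B" by cases (use uB compat in blast)+
  qed
  show "Y \<subseteq> B"
  proof
    fix i assume "i \<in> Y"
    then consider "i \<in> X" | "i \<in> H" "\<sigma> i \<in> X" by (auto simp: mem_polS split: if_splits)
    then show "i \<in> B" by cases (use basic(3) compat in blast)+
  qed
qed

text \<open>The polarized pair is a competitor of no larger energy, hence optimal as well; all facts
  about \<open>u\<close> become available for \<open>v\<close>.\<close>

lemma dirichlet_pol_eq: "dirichlet v = dirichlet u"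
  using minimal[OF feasible_pol] dirichlet_pol(2)[of u] basic(1) by (simp add: tame_def)

sublocale pol: cap_optimal B N Y v
  using N feasible_pol minimal dirichlet_pol_eq by unfold_locales auto

lemma no_sign_change:
  "adj i j \<Longrightarrow> i \<in> H \<Longrightarrow> j \<in> H \<Longrightarrow> u i > u (\<sigma> i) \<Longrightarrow> u j \<ge> u (\<sigma> j)"
  by (rule dirichlet_pol(3)[OF _ dirichlet_pol_eq]) (use basic(1) in \<open>auto simp: tame_def\<close>)

text \<open>Since \<open>\<sigma> i \<notin> Y\<close>, at most one of \<open>i\<close>,
  \<open>\<sigma> i\<close> is in \<open>X\<close>; equal values exclude even one. So
  \<open>u\<close>, its reflection and \<open>v\<close> are all harmonic at
  \<open>i\<close>.\<close>

lemma eq_spreads: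
  assumes "adj i j" "i \<in> H" "j \<in> H" "i \<in> B" "\<sigma> i \<in> B" "\<sigma> i \<notin> Y" "u (\<sigma> i) = u i"
  shows "u (\<sigma> j) = u j"
proof -
  have "i \<in> X \<longleftrightarrow> u i \<ge> 1" "\<sigma> i \<in> X \<longleftrightarrow> u (\<sigma> i) \<ge> 1" using level by auto
  then have "i \<in> X \<longleftrightarrow> \<sigma> i \<in> X" using assms(7) by simp
  moreover have "\<not> (i \<in> X \<and> \<sigma> i \<in> X)" using assms(2,6) by (simp add: refl_polS)
  ultimately have "i \<notin> X" "\<sigma> i \<notin> X" by auto
  moreover from this have "i \<notin> Y" using assms(2) by (simp add: mem_polS)
  ultimately show ?thesis
    using zero_spreads[OF assms(2,7) harmonic[OF assms(4)] harmonic[OF assms(5)] pol.harmonic[OF assms(4)] assms(1,3)]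
    by simp
qed

text \<open>If the two values agreed at \<open>j\<close>, equality would spread back to
  \<open>i\<close>. The last hypothesis ensures that in this case \<open>\<sigma> j\<close> is in
  \<open>B\<close>, where \<open>u\<close> is harmonic off \<open>X\<close>.\<close>

lemma sign_spreads:
  assumes "adj i j" "i \<in> H" "j \<in> H" "j \<in> B" "\<sigma> j \<notin> Y" "\<sigma> j \<in> B \<or> u j > 0"
  shows "u i > u (\<sigma> i) \<Longrightarrow> u j > u (\<sigma> j)" "u i < u (\<sigma> i) \<Longrightarrow> u j < u (\<sigma> j)"
proof -
  have ne: "u (\<sigma> j) \<noteq> u j" if "u (\<sigma> i) \<noteq> u i"
  proof
    assume e: "u (\<sigma> j) = u j"
    then have "\<sigma> j \<in> B" using assms(6) basic(2) by (auto simp: supp_def)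
    then show False
      using eq_spreads[of j i] assms e that by (simp add: adj_commute)
  qed
  show "u i > u (\<sigma> i) \<Longrightarrow> u j > u (\<sigma> j)"
    using no_sign_change[OF assms(1-3)] ne by fastforce
  show "u i < u (\<sigma> i) \<Longrightarrow> u j < u (\<sigma> j)"
    using no_sign_change[of j i] assms(1-3) ne by (fastforce simp: adj_commute)
qed

end

section \<open>Rigidity in the whole space\<close>

context polarization
begin

text \<open>Polarization can only alter mirror pairs of which exactly one point is in
  \<open>X\<close>; the premise looks at just these pairs.\<close>

lemma polS_eq_self:
  assumes "\<And>x. x \<in> H \<Longrightarrow> x \<in> polS \<sigma> H X \<Longrightarrow> \<sigma> x \<notin> polS \<sigma> H X \<Longrightarrow> x \<in> X"
  shows "polS \<sigma> H X = X"
proof (rule set_eqI)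
  fix x
  consider "x \<in> H" "\<sigma> x \<notin> H" | "x \<notin> H" "\<sigma> x \<in> H" | "x \<notin> H" "\<sigma> x \<notin> H" using half by blast
  then show "x \<in> polS \<sigma> H X \<longleftrightarrow> x \<in> X"
    using assms[of x] assms[of "\<sigma> x"] mem_polS[of x \<sigma> H X] refl_polS[of x X]
    by cases (simp_all, blast+)
qed

lemma polS_eq_refl:
  assumes "\<And>x. x \<in> H \<Longrightarrow> x \<in> polS \<sigma> H X \<Longrightarrow> \<sigma> x \<notin> polS \<sigma> H X \<Longrightarrow> x \<notin> X"
  shows "X = \<sigma> ` polS \<sigma> H X"
proof (rule set_eqI)
  fix x
  have im: "x \<in> \<sigma> ` polS \<sigma> H X \<longleftrightarrow> \<sigma> x \<in> polS \<sigma> H X"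
    by (metis image_iff invol)
  consider "x \<in> H" "\<sigma> x \<notin> H" | "x \<notin> H" "\<sigma> x \<in> H" | "x \<notin> H" "\<sigma> x \<notin> H" using half by blast
  then show "x \<in> X \<longleftrightarrow> x \<in> \<sigma> ` polS \<sigma> H X" unfolding im
    using assms[of x] assms[of "\<sigma> x"] mem_polS[of x \<sigma> H X] refl_polS[of x X]
    by cases (simp_all, blast+)
qed

end

text \<open>The direction \<open>j\<close> is parallel to the mirror. Moving far out along it leaves \<open>Y\<close>, after which the
  remaining coordinates are unconstrained.\<close>

locale transversal =
  fixes \<sigma> :: "int^'n \<Rightarrow> int^'n" and H Y :: "(int^'n) set" and c :: "int^'n" and j :: 'n and L :: int
  assumes cen: "centred c Y"
    and L: "\<And>y a. y \<in> Y \<Longrightarrow> \<bar>y $ a - c $ a\<bar> \<le> L"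
    and \<sigma>j: "\<And>z t. \<sigma> (vupd z j t) = vupd (\<sigma> z) j t" "\<And>z. \<sigma> z $ j = z $ j"
    and Hj: "\<And>z t. z \<in> H \<Longrightarrow> vupd z j t \<in> H"
begin

text \<open>The point is pushed along \<open>j\<close> away from \<open>c\<close>, on the side where
  it already lies, to a distance that no point of \<open>Y\<close> has.\<close>

definition out :: "int^'n \<Rightarrow> int^'n" where
  "out z = vupd z j (if z $ j \<ge> c $ j then max (z $ j) (c $ j + L + 1) else min (z $ j) (c $ j - L - 1))"

lemma far_notin: "\<bar>z $ j - c $ j\<bar> > L \<Longrightarrow> \<sigma> z \<notin> Y"
  using L[of "\<sigma> z" j] \<sigma>j(2)[of z] by auto

lemma out_far: "\<bar>out z $ j - c $ j\<bar> > L"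
  by (auto simp: out_def)

lemma out_H: "z \<in> H \<Longrightarrow> out z \<in> H"
  by (simp add: out_def Hj)

text \<open>If a mirror image on the way were in \<open>Y\<close>, moving its \<open>j\<close>-th
  coordinate back towards \<open>c\<close> would put \<open>\<sigma> x\<close> in
  \<open>Y\<close>.\<close>

lemma out_hull:
  assumes x: "x \<in> H" "\<sigma> x \<notin> Y"
    and z: "\<And>k. min (x $ k) (out x $ k) \<le> z $ k \<and> z $ k \<le> max (x $ k) (out x $ k)"
  shows "z \<in> H" "\<sigma> z \<notin> Y"
proof -
  have "z $ k = x $ k" if "k \<noteq> j" for k using z[of k] that by (simp add: out_def)
  then have e: "z = vupd x j (z $ j)" by (auto simp: vec_eq_iff)
  show "z \<in> H" by (subst e) (rule Hj[OF x(1)])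
  have jj: "x $ j = z $ j \<or> \<bar>x $ j - c $ j\<bar> < \<bar>z $ j - c $ j\<bar>"
    using z[of j] by (auto simp: out_def split: if_splits)
  show "\<sigma> z \<notin> Y"
  proof
    assume a: "\<sigma> z \<in> Y"
    have e2: "\<sigma> z = vupd (\<sigma> x) j (z $ j)" by (subst e) (rule \<sigma>j(1))
    have "\<sigma> x \<in> Y"
    proof (rule centred_box[OF cen a])
      fix k
      show "\<sigma> x $ k = \<sigma> z $ k \<or> \<bar>\<sigma> x $ k - c $ k\<bar> < \<bar>\<sigma> z $ k - c $ k\<bar>"
        using jj unfolding e2 by (cases "k = j") (simp_all add: \<sigma>j(2))
    qed
    then show False using x by simp
  qed
qed

text \<open>The path from \<open>x\<close> runs outwards along \<open>j\<close>, then along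
  \<open>k\<close> away from the mirror to a common level \<open>K\<close>, across that level to the
  corresponding point for \<open>x'\<close>, and back in reverse. \<open>P\<close> is any property
  inherited along bonds of the free region.\<close>

lemma connected:
  assumes jk: "j \<noteq> k" and s: "s = 1 \<or> s = -1"
    and Hk: "\<And>z t. z \<in> H \<Longrightarrow> s * t \<ge> s * z $ k \<Longrightarrow> vupd z k t \<in> H"
    and far: "\<And>x x'. x \<in> H \<Longrightarrow> x' \<in> H \<Longrightarrow> \<exists>K. s * K \<ge> s * x $ k \<and> s * K \<ge> s * x' $ k \<and>
       (\<forall>z. z $ k = K \<longrightarrow> (\<forall>a. a \<noteq> k \<longrightarrow> a \<noteq> j \<longrightarrow> min (x $ a) (x' $ a) \<le> z $ a \<and> z $ a \<le> max (x $ a) (x' $ a))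
         \<longrightarrow> z \<in> H \<and> \<sigma> z \<notin> Y)"
    and closed: "\<And>a b. a \<in> P \<Longrightarrow> a \<in> H \<Longrightarrow> \<sigma> a \<notin> Y \<Longrightarrow> b \<in> H \<Longrightarrow> \<sigma> b \<notin> Y \<Longrightarrow> adj a b \<Longrightarrow> b \<in> P"
    and x: "x \<in> P" "x \<in> H" "\<sigma> x \<notin> Y" and x': "x' \<in> H" "\<sigma> x' \<notin> Y"
  shows "x' \<in> P"
proof -
  define G where "G = {i \<in> H. \<sigma> i \<notin> Y}"
  have cl: "\<And>a b. a \<in> P \<Longrightarrow> a \<in> G \<Longrightarrow> b \<in> G \<Longrightarrow> adj a b \<Longrightarrow> b \<in> P" using closed by (auto simp: G_def)
  obtain K where K: "s * K \<ge> s * x $ k" "s * K \<ge> s * x' $ k" and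
    Kf: "\<And>z. z $ k = K \<Longrightarrow> (\<And>a. a \<noteq> k \<Longrightarrow> a \<noteq> j \<Longrightarrow> min (x $ a) (x' $ a) \<le> z $ a \<and> z $ a \<le> max (x $ a) (x' $ a))
         \<Longrightarrow> z \<in> G"
    using far[OF x(2) x'(1)] unfolding G_def by blast
  have h1: "z \<in> G" if "y \<in> H" "\<sigma> y \<notin> Y" "\<And>a. min (y $ a) (out y $ a) \<le> z $ a \<and> z $ a \<le> max (y $ a) (out y $ a)" for y z
    using out_hull[OF that] by (simp add: G_def)
  have h2: "z \<in> G" if y: "y \<in> H" "s * K \<ge> s * y $ k"
    and z: "\<And>a. min (out y $ a) (vupd (out y) k K $ a) \<le> z $ a \<and> z $ a \<le> max (out y $ a) (vupd (out y) k K $ a)" for y z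
  proof -
    have "z $ a = out y $ a" if "a \<noteq> k" for a using z[of a] that by simp
    then have e: "z = vupd (out y) k (z $ k)" by (auto simp: vec_eq_iff)
    have zk: "min (y $ k) K \<le> z $ k \<and> z $ k \<le> max (y $ k) K" using z[of k] jk by (simp add: out_def)
    have "s * z $ k \<ge> s * out y $ k" using s y(2) zk jk by (auto simp: out_def)
    then have "z \<in> H" using Hk[OF out_H[OF y(1)]] e by metis
    moreover have "z $ j = out y $ j" using z[of j] jk by simp
    then have "\<sigma> z \<notin> Y" using out_far[of y] far_notin[of z] by simp
    ultimately show ?thesis by (simp add: G_def)
  qed
  have 1: "out x \<in> P" by (rule box_move[OF cl h1[OF x(2,3)] x(1)])
  have 2: "vupd (out x) k K \<in> P" by (rule box_move[OF cl h2[OF x(2) K(1)] 1])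
  have 3: "vupd (out x') k K \<in> P"
  proof (rule box_move[OF cl _ 2])
    fix z assume z: "\<And>a. min (vupd (out x) k K $ a) (vupd (out x') k K $ a) \<le> z $ a \<and>
      z $ a \<le> max (vupd (out x) k K $ a) (vupd (out x') k K $ a)"
    show "z \<in> G"
    proof (rule Kf)
      show "z $ k = K" using z[of k] by simp
      show "min (x $ a) (x' $ a) \<le> z $ a \<and> z $ a \<le> max (x $ a) (x' $ a)" if "a \<noteq> k" "a \<noteq> j" for a
        using z[of a] that by (simp add: out_def)
    qed
  qed
  have 4: "out x' \<in> P"
  proof (rule box_move[OF cl _ 3])
    fix z assume z: "\<And>a. min (vupd (out x') k K $ a) (out x' $ a) \<le> z $ a \<and>
      z $ a \<le> max (vupd (out x') k K $ a) (out x' $ a)"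
    show "z \<in> G"
    proof (rule h2[OF x'(1) K(2)])
      show "min (out x' $ a) (vupd (out x') k K $ a) \<le> z $ a \<and> z $ a \<le> max (out x' $ a) (vupd (out x') k K $ a)" for a
        using z[of a] by linarith
    qed
  qed
  show "x' \<in> P"
  proof (rule box_move[OF cl _ 4])
    fix z assume z: "\<And>a. min (out x' $ a) (x' $ a) \<le> z $ a \<and> z $ a \<le> max (out x' $ a) (x' $ a)"
    show "z \<in> G"
    proof (rule h1[OF x'])
      show "min (x' $ a) (out x' $ a) \<le> z $ a \<and> z $ a \<le> max (x' $ a) (out x' $ a)" for a
        using z[of a] by linarith
    qed
  qed
qed

end

lemma third_coordinate:
  fixes k l :: "'n::finite"
  assumes "CARD('n) \<ge> 3"
  obtains j where "j \<noteq> k" "j \<noteq> l"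
proof -
  have "card {k, l} < CARD('n)" using assms card_insert_le_m1[of 2 "{l}" k] by (auto simp: card_insert_if)
  then have "{k, l} \<noteq> UNIV" by (metis less_irrefl)
  then show ?thesis using that by blast
qed

lemma finite_coord_bound:
  fixes Y :: "(int^'n) set"
  assumes "finite Y"
  obtains L where "\<And>y a. y \<in> Y \<Longrightarrow> \<bar>y $ a - c $ a\<bar> \<le> L"
proof
  fix y a assume y: "y \<in> Y"
  have "\<bar>y $ a - c $ a\<bar> \<le> (\<Sum>a\<in>UNIV. \<bar>y $ a - c $ a\<bar>)" by (rule member_le_sum) auto
  also have "\<dots> \<le> (\<Sum>y\<in>Y. \<Sum>a\<in>UNIV. \<bar>y $ a - c $ a\<bar>)"
    by (rule member_le_sum[OF y]) (auto simp: assms intro: sum_nonneg)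
  finally show "\<bar>y $ a - c $ a\<bar> \<le> (\<Sum>y\<in>Y. \<Sum>a\<in>UNIV. \<bar>y $ a - c $ a\<bar>)" .
qed

text \<open>Exchanging \<open>k\<close> and \<open>l\<close> reverses the sign in the diagonal case,
  so the side of \<open>c\<close> can always be taken as x_k - x_l < m.\<close>

lemma Refl_normal_form:
  assumes "\<sigma> \<in> Refl" "\<sigma> c \<noteq> c"
  obtains (coord) k m where "\<sigma> = refl1 k m" "m \<noteq> 2 * c $ k"
  | (diag) k l m where "\<sigma> = refl2 k l m" "k \<noteq> l" "c $ k - c $ l < m"
  using assms(1)
proof cases
  case (refl1 k m)
  then show ?thesis using coord assms(2) by (auto simp: refl1_fixed)
next
  case (refl2 k l m)
  then have "m \<noteq> c $ k - c $ l" using assms(2) by (auto simp: refl2_fixed)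
  then consider "c $ k - c $ l < m" | "c $ l - c $ k < - m" by linarith
  then show ?thesis
  proof cases
    case 1
    then show ?thesis using diag refl2 by blast
  next
    case 2
    then show ?thesis using diag[of l k "- m"] refl2 refl2_swap by metis
  qed
qed

lemma transversal_refl1:
  assumes "centred c Y" "\<And>y a. y \<in> Y \<Longrightarrow> \<bar>y $ a - c $ a\<bar> \<le> L" "j \<noteq> k"
  shows "transversal (refl1 k m) (Hs (refl1 k m) c) Y c j L"
  using assms by unfold_locales (auto simp: refl1_def Hs_refl1 vec_eq_iff)

lemma transversal_refl2:
  assumes "centred c Y" "\<And>y a. y \<in> Y \<Longrightarrow> \<bar>y $ a - c $ a\<bar> \<le> L" "j \<noteq> k" "j \<noteq> l" "k \<noteq> l"
  shows "transversal (refl2 k l m) (Hs (refl2 k l m) c) Y c j L"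
  using assms by unfold_locales (auto simp: refl2_def Hs_refl2 vec_eq_iff)

lemma free_half_space_connected:
  fixes c :: "int^'n"
  assumes d: "CARD('n) \<ge> 3" and \<sigma>: "\<sigma> \<in> Refl" "\<sigma> c \<noteq> c" and Y: "centred c Y" "finite Y"
    and closed: "\<And>a b. a \<in> P \<Longrightarrow> a \<in> Hs \<sigma> c \<Longrightarrow> \<sigma> a \<notin> Y \<Longrightarrow> b \<in> Hs \<sigma> c \<Longrightarrow> \<sigma> b \<notin> Y \<Longrightarrow> adj a b \<Longrightarrow> b \<in> P"
    and x: "x \<in> P" "x \<in> Hs \<sigma> c" "\<sigma> x \<notin> Y" and x': "x' \<in> Hs \<sigma> c" "\<sigma> x' \<notin> Y"
  shows "x' \<in> P"
proof -
  obtain L where L: "\<And>y a. y \<in> Y \<Longrightarrow> \<bar>y $ a - c $ a\<bar> \<le> L"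
    using finite_coord_bound[OF Y(2), of c] by blast
  from \<sigma> show ?thesis
  proof (cases rule: Refl_normal_form)
    case (coord k m)
    obtain j where j: "j \<noteq> k" using third_coordinate[OF d, of k k] by blast
    interpret transversal \<sigma> "Hs \<sigma> c" Y c j L
      unfolding coord(1) by (rule transversal_refl1[OF Y(1) L j])
    \<comment> \<open>The direction along \<open>k\<close> that leads away from the mirror within
      \<open>Hs \<sigma> c\<close>.\<close>
    define s :: int where "s = (if m > 2 * c $ k then -1 else 1)"
    show ?thesis
    proof (rule connected[OF j _ _ _ closed x x', of s])
      show "s = 1 \<or> s = - 1" by (simp add: s_def)
      show "vupd z k t \<in> Hs \<sigma> c" if "z \<in> Hs \<sigma> c" "s * z $ k \<le> s * t" for z t
        using that coord(2) by (auto simp: coord(1) Hs_refl1 s_def zero_less_mult_iff split: if_splits)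
      fix x x' assume h: "x \<in> Hs \<sigma> c" "x' \<in> Hs \<sigma> c"
      \<comment> \<open>Reflection sends this level to \<open>m - ?K\<close>, which is further than
        \<open>L\<close> from \<open>c $ k\<close>.\<close>
      let ?K = "if s = 1 then max (max (x $ k) (x' $ k)) (m - c $ k + L + 1)
        else min (min (x $ k) (x' $ k)) (m - c $ k - L - 1)"
      have "\<sigma> z \<notin> Y" if "z $ k = ?K" for z
        using L[of "\<sigma> z" k] that by (auto simp: coord(1) refl1_def split: if_splits)
      moreover have "z \<in> Hs \<sigma> c" if "z $ k = ?K" for z
        using that h coord(2) by (auto simp: coord(1) Hs_refl1 s_def zero_less_mult_iff max_def min_def split: if_splits)
      moreover have "s * ?K \<ge> s * x $ k" "s * ?K \<ge> s * x' $ k" by (auto simp: s_def)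
      ultimately show "\<exists>K. s * x $ k \<le> s * K \<and> s * x' $ k \<le> s * K \<and>
        (\<forall>z. z $ k = K \<longrightarrow> (\<forall>a. a \<noteq> k \<longrightarrow> a \<noteq> j \<longrightarrow> min (x $ a) (x' $ a) \<le> z $ a \<and> z $ a \<le> max (x $ a) (x' $ a))
         \<longrightarrow> z \<in> Hs \<sigma> c \<and> \<sigma> z \<notin> Y)" by (intro exI[of _ ?K]) blast
    qed
  next
    case (diag k l m)
    obtain j where j: "j \<noteq> k" "j \<noteq> l" using third_coordinate[OF d] by blast
    interpret transversal \<sigma> "Hs \<sigma> c" Y c j L
      unfolding diag(1) by (rule transversal_refl2[OF Y(1) L j diag(2)])
    have H: "z \<in> Hs \<sigma> c \<longleftrightarrow> z $ k - z $ l < m" for z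
      using diag(3) by (auto simp: diag(1) Hs_refl2[OF diag(2)] zero_less_mult_iff)
    show ?thesis
    proof (rule connected[OF j(1) _ _ _ closed x x', of "-1"])
      show "vupd z k t \<in> Hs \<sigma> c" if "z \<in> Hs \<sigma> c" "- 1 * z $ k \<le> - 1 * t" for z t
        using that diag(2) by (auto simp: H)
      fix x x' assume h: "x \<in> Hs \<sigma> c" "x' \<in> Hs \<sigma> c"
      \<comment> \<open>The \<open>l\<close>-th coordinate of the mirror image is then
        \<open>?K - m\<close>, below \<open>c $ l - L\<close>.\<close>
      let ?K = "min (min (x $ k) (x' $ k)) (c $ l - L - 1 + m)"
      have "\<sigma> z \<notin> Y" if "z $ k = ?K" for z
        using L[of "\<sigma> z" l] that diag(2) by (auto simp: diag(1) refl2_def split: if_splits)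
      moreover have "z \<in> Hs \<sigma> c" if "z $ k = ?K" "min (x $ l) (x' $ l) \<le> z $ l" for z
        using that h by (auto simp: H)
      ultimately show "\<exists>K. - 1 * x $ k \<le> - 1 * K \<and> - 1 * x' $ k \<le> - 1 * K \<and>
        (\<forall>z. z $ k = K \<longrightarrow> (\<forall>a. a \<noteq> k \<longrightarrow> a \<noteq> j \<longrightarrow> min (x $ a) (x' $ a) \<le> z $ a \<and> z $ a \<le> max (x $ a) (x' $ a))
         \<longrightarrow> z \<in> Hs \<sigma> c \<and> \<sigma> z \<notin> Y)"
        using diag(2) j(2) by (intro exI[of _ ?K]) auto
    qed simp
  qed
qed

text \<open>One altered pair with larger value in the half space spreads that sign to all such
  pairs, so nothing moved. Otherwise every altered pair has its point of \<open>X\<close> on the far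
  side.\<close>

lemma rigid_whole_space:
  fixes c :: "int^'n"
  assumes d: "CARD('n) \<ge> 3" and opt: "cap_optimal UNIV N X u" and \<sigma>: "\<sigma> \<in> Refl" "\<sigma> c \<noteq> c"
    and cen: "centred c (polS \<sigma> (Hs \<sigma> c) X)"
  shows "polS \<sigma> (Hs \<sigma> c) X = X \<or> X = \<sigma> ` polS \<sigma> (Hs \<sigma> c) X"
proof -
  let ?H = "Hs \<sigma> c"
  interpret cap_optimal UNIV N X u by (rule opt)
  interpret polarization \<sigma> ?H by (rule polarization_Refl[OF \<sigma>])
  interpret cap_polarized UNIV N X u \<sigma> ?H by unfold_locales simp
  define P where "P = {i. u i > u (\<sigma> i)}"
  have closed: "b \<in> P" if "a \<in> P" "a \<in> ?H" "\<sigma> a \<notin> Y" "b \<in> ?H" "\<sigma> b \<notin> Y" "adj a b" for a b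
    using sign_spreads(1)[of a b] that by (simp add: P_def)
  have lev: "i \<in> X \<longleftrightarrow> u i \<ge> 1" for i using level by auto
  show ?thesis
  proof (cases "\<exists>x\<in>?H. x \<in> Y \<and> \<sigma> x \<notin> Y \<and> x \<in> P")
    case True
    then obtain x where x: "x \<in> P" "x \<in> ?H" "\<sigma> x \<notin> Y" by blast
    have "x' \<in> X" if x': "x' \<in> ?H" "x' \<in> Y" "\<sigma> x' \<notin> Y" for x'
    proof -
      have "x' \<in> P"
        by (rule free_half_space_connected[OF d \<sigma> cen _ closed x x'(1,3)]) (simp_all add: pol.basic)
      moreover have "x' \<in> X \<or> \<sigma> x' \<in> X" using x' by (simp add: mem_polS)
      ultimately show ?thesis by (auto simp: lev P_def)
    qed
    then show ?thesis using polS_eq_self by blast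
  next
    case False
    have "x \<notin> X" if x: "x \<in> ?H" "x \<in> Y" "\<sigma> x \<notin> Y" for x
    proof
      assume a: "x \<in> X"
      have "u x \<le> u (\<sigma> x)" using False x by (auto simp: P_def not_less)
      then have "\<sigma> x \<in> X" using a by (simp add: lev)
      then show False using x a by (simp add: refl_polS)
    qed
    then show ?thesis using polS_eq_refl by blast
  qed
qed

section \<open>Rigidity in a ball\<close>

lemma mem_lattice_ball: "i \<in> lattice_ball r \<longleftrightarrow> norm (emb i) < r"
  by (simp add: lattice_ball_def)

lemma norm_emb_sq: "(norm (emb x))\<^sup>2 = real_of_int (sqd x 0)"
  using norm_emb_diff_sq[of x 0] by (simp add: emb_def zero_vec_def[symmetric])

lemma lattice_ball_le:
  assumes "x \<in> lattice_ball r" "sqd z 0 \<le> sqd x 0"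
  shows "z \<in> lattice_ball r"
proof -
  have "norm (emb z) \<le> norm (emb x)"
    by (rule power2_le_imp_le) (use assms(2) in \<open>simp_all add: norm_emb_sq\<close>)
  then show ?thesis using assms(1) by (simp add: mem_lattice_ball)
qed

lemma sqd_mono: "(\<And>k. \<bar>z $ k\<bar> \<le> \<bar>x $ k\<bar>) \<Longrightarrow> sqd z 0 \<le> sqd x 0"
  unfolding sqd_def by (rule sum_mono) (simp add: abs_le_square_iff[symmetric])

lemma lattice_ball_coord:
  assumes "x \<in> lattice_ball r"
  shows "\<bar>x $ k\<bar> \<le> \<lceil>r\<rceil>"
proof -
  have "\<bar>emb x $ k\<bar> \<le> norm (emb x)" by (rule component_le_norm_cart)
  then have "\<bar>real_of_int (x $ k)\<bar> \<le> r" using assms by (simp add: mem_lattice_ball emb_def)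
  then show ?thesis by linarith
qed

lemma finite_lattice_ball: "finite (lattice_ball r :: (int^'n) set)"
proof (rule finite_subset)
  show "lattice_ball r \<subseteq> (\<lambda>f. \<chi> k. f k) ` (PiE (UNIV :: 'n set) (\<lambda>_. {- \<lceil>r\<rceil>..\<lceil>r\<rceil>}))"
  proof
    fix x :: "int^'n" assume x: "x \<in> lattice_ball r"
    have "x = (\<chi> k. x $ k)" by simp
    moreover have "(\<lambda>k. x $ k) \<in> PiE (UNIV :: 'n set) (\<lambda>_. {- \<lceil>r\<rceil>..\<lceil>r\<rceil>})"
      using lattice_ball_coord[OF x] by (auto simp: PiE_iff abs_le_iff minus_le_iff)
    ultimately show "x \<in> (\<lambda>f. \<chi> k. f k) ` (PiE (UNIV :: 'n set) (\<lambda>_. {- \<lceil>r\<rceil>..\<lceil>r\<rceil>}))" by blast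
  qed
qed (intro finite_imageI finite_PiE; simp)

text \<open>Take the extreme lattice point of the finite chord through \<open>y\<close>. Setting a
  coordinate to 0 never leaves the ball, whence \<open>s * t \<ge> 0\<close>.\<close>

lemma lattice_ball_exit:
  assumes y: "y \<in> lattice_ball r" and s: "s = 1 \<or> s = -1"
  obtains t where "s * t \<ge> s * y $ k" "s * t \<ge> 0" "vupd y k t \<in> lattice_ball r"
    "vupd y k (t + s) \<notin> lattice_ball r"
proof -
  define T where "T = {t. vupd y k t \<in> lattice_ball r}"
  have "T \<subseteq> {- \<lceil>r\<rceil>..\<lceil>r\<rceil>}" using lattice_ball_coord[of _ r k] by (fastforce simp: T_def abs_le_iff)
  then have fin: "finite T" by (rule finite_subset) simp
  have yT: "y $ k \<in> T" using y by (simp add: T_def)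
  have "\<exists>t\<in>T. \<forall>t'\<in>T. s * t' \<le> s * t"
    using fin yT by (intro bexI[of _ "arg_min_on (\<lambda>t. - (s * t)) T"] ballI)
      (auto dest: arg_min_least[of T _ "\<lambda>t. - (s * t)"] intro: arg_min_if_finite(1))
  then obtain t where t: "t \<in> T" "\<And>t'. t' \<in> T \<Longrightarrow> s * t' \<le> s * t" by blast
  have "vupd y k 0 \<in> lattice_ball r" by (rule lattice_ball_le[OF y sqd_mono]) simp
  then have "s * t \<ge> 0" using t(2)[of 0] by (simp add: T_def)
  moreover have "t + s \<notin> T" using t(2)[of "t + s"] s by (auto simp: algebra_simps)
  ultimately show ?thesis using that[of t] t yT by (auto simp: T_def)
qed

text \<open>A zero would spread from \<open>i\<close> to the origin and on to a point of
  \<open>X\<close>; the boxes spanned with the origin lie in the ball.\<close>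

lemma positive_on_lattice_ball:
  fixes i :: "int^'n"
  assumes opt: "cap_optimal (lattice_ball r) N X u" and i: "i \<in> lattice_ball r"
  shows "u i > 0"
proof (rule ccontr)
  interpret cap_optimal "lattice_ball r" N X u by (rule opt)
  let ?B = "lattice_ball r"
  assume "\<not> u i > 0"
  then have i0: "i \<in> {i. u i = 0}" using nonneg[of i] by simp
  have cl: "\<And>a b. a \<in> {i. u i = 0} \<Longrightarrow> a \<in> ?B \<Longrightarrow> b \<in> ?B \<Longrightarrow> adj a b \<Longrightarrow> b \<in> {i. u i = 0}"
    using zero_neighbours by blast
  have h: "z \<in> ?B" if "x \<in> ?B" "\<And>k. min (x $ k) ((0::int^'n) $ k) \<le> z $ k \<and> z $ k \<le> max (x $ k) ((0::int^'n) $ k)" for x z :: "int^'n"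
  proof (rule lattice_ball_le[OF that(1) sqd_mono])
    show "\<bar>z $ k\<bar> \<le> \<bar>x $ k\<bar>" for k using that(2)[of k] by simp linarith
  qed
  have z: "0 \<in> {i. u i = 0}"
    by (rule box_move[OF cl h[OF i] i0]) simp
  have "X \<noteq> {}" using basic(5) N by auto
  then obtain x where x: "x \<in> X" by blast
  have "x \<in> {i. u i = 0}"
  proof (rule box_move[OF cl _ z])
    fix z assume z: "\<And>k. min ((0::int^'n) $ k) (x $ k) \<le> z $ k \<and> z $ k \<le> max (0 $ k) (x $ k)"
    show "z \<in> ?B"
    proof (rule h)
      show "x \<in> ?B" using x basic(3) by blast
      show "min (x $ k) ((0::int^'n) $ k) \<le> z $ k \<and> z $ k \<le> max (x $ k) ((0::int^'n) $ k)" for k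
        using z[of k] by linarith
    qed
  qed
  then show False using basic(6)[OF x] by simp
qed

context transversal
begin

text \<open>Moving away from the mirror, the mirror image leaves the ball strictly before the point does. At such a
  point \<open>u > 0 = u \<circ> \<sigma>\<close>, which fixes the sign.\<close>

lemma ball_exit:
  assumes jk: "j \<noteq> k" and s: "s = 1 \<or> s = -1"
    and y: "y \<in> P" "y \<in> H" "y \<in> lattice_ball r" "\<bar>y $ j - c $ j\<bar> > L"
    and Hk: "\<And>z t. z \<in> H \<Longrightarrow> s * t \<ge> s * z $ k \<Longrightarrow> vupd z k t \<in> H"
    and esc: "\<And>t. s * t \<ge> 0 \<Longrightarrow> vupd y k t \<in> H \<Longrightarrow> sqd (vupd y k (t + s)) 0 \<le> sqd (\<sigma> (vupd y k t)) 0"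
    and closed: "\<And>a b. a \<in> P \<Longrightarrow> a \<in> {i \<in> H \<inter> lattice_ball r. \<sigma> i \<notin> Y} \<Longrightarrow>
      b \<in> {i \<in> H \<inter> lattice_ball r. \<sigma> i \<notin> Y} \<Longrightarrow> adj a b \<Longrightarrow> b \<in> P"
  shows "\<exists>p\<in>P. p \<in> lattice_ball r \<and> \<sigma> p \<notin> lattice_ball r"
proof -
  obtain t where t: "s * t \<ge> s * y $ k" "s * t \<ge> 0" "vupd y k t \<in> lattice_ball r"
    "vupd y k (t + s) \<notin> lattice_ball r"
    using lattice_ball_exit[OF y(3) s] by blast
  let ?p = "vupd y k t"
  have pH: "?p \<in> H" by (rule Hk[OF y(2) t(1)])
  have "?p \<in> P"
  proof (rule box_move[OF closed _ y(1)])
    fix z assume z: "\<And>a. min (y $ a) (?p $ a) \<le> z $ a \<and> z $ a \<le> max (y $ a) (?p $ a)"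
    have "z $ a = y $ a" if "a \<noteq> k" for a using z[of a] that by simp
    then have e: "z = vupd y k (z $ k)" by (auto simp: vec_eq_iff)
    have zk: "min (y $ k) t \<le> z $ k \<and> z $ k \<le> max (y $ k) t" using z[of k] by simp
    then have "s * z $ k \<ge> s * y $ k" using s t(1) by auto
    then have "z \<in> H" using Hk[OF y(2)] e by metis
    moreover have "z $ j = y $ j" using z[of j] jk by (intro order_antisym) simp_all
    then have "\<sigma> z \<notin> Y" using y(4) by (intro far_notin) simp
    moreover have "z \<in> lattice_ball r"
    proof (cases "\<bar>z $ k\<bar> \<le> \<bar>y $ k\<bar>")
      case True
      show ?thesis by (rule lattice_ball_le[OF y(3) sqd_mono]) (subst e, use True in simp)
    next
      case False
      then have "\<bar>z $ k\<bar> \<le> \<bar>t\<bar>" using zk by linarith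
      then show ?thesis by (intro lattice_ball_le[OF t(3) sqd_mono]) (subst e, simp)
    qed
    ultimately show "z \<in> {i \<in> H \<inter> lattice_ball r. \<sigma> i \<notin> Y}" by blast
  qed
  moreover have "\<sigma> ?p \<notin> lattice_ball r"
    using lattice_ball_le[OF _ esc[OF t(2) pH]] t(4) by blast
  ultimately show ?thesis using t(3) by blast
qed

end

text \<open>An altered pair with the point of \<open>X\<close> on the far side would carry its sign
  \<open>u < u \<circ> \<sigma>\<close> along free points to a point of the ball whose image lies
  outside, where \<open>u \<circ> \<sigma>\<close> is 0. So this alternative cannot occur.\<close>

lemma rigid_ball:
  fixes X :: "(int^'n) set"
  assumes d: "CARD('n) \<ge> 3" and opt: "cap_optimal (lattice_ball r) N X u" and \<sigma>: "\<sigma> \<in> Refl" "\<sigma> 0 \<noteq> 0"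
    and cen: "centred 0 (polS \<sigma> (Hs \<sigma> 0) X)"
    and L: "\<And>y a. y \<in> polS \<sigma> (Hs \<sigma> 0) X \<Longrightarrow> \<bar>y $ a\<bar> \<le> L"
    and box: "\<And>z :: int^'n. (\<And>a. \<bar>z $ a\<bar> \<le> L + 1) \<Longrightarrow> z \<in> lattice_ball r"
  shows "polS \<sigma> (Hs \<sigma> 0) X = X"
proof -
  let ?H = "Hs \<sigma> 0" and ?B = "lattice_ball r"
  interpret cap_optimal ?B N X u by (rule opt)
  interpret polarization \<sigma> ?H by (rule polarization_Refl[OF \<sigma>])
  interpret cap_polarized ?B N X u \<sigma> ?H
    by unfold_locales (auto simp: Hs_def intro: lattice_ball_le)
  define P where "P = {i. u i < u (\<sigma> i)}"
  let ?G = "{i \<in> ?H \<inter> ?B. \<sigma> i \<notin> Y}"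
  have pos: "u i > 0" if "i \<in> ?B" for i by (rule positive_on_lattice_ball[OF opt that])
  have closed: "b \<in> P" if "a \<in> P" "a \<in> ?G" "b \<in> ?G" "adj a b" for a b
    using sign_spreads(2)[of a b] that pos[of b] by (simp add: P_def)
  have noexit: "\<not> (\<exists>p\<in>P. p \<in> ?B \<and> \<sigma> p \<notin> ?B)"
  proof
    assume "\<exists>p\<in>P. p \<in> ?B \<and> \<sigma> p \<notin> ?B"
    then obtain p where p: "p \<in> P" "\<sigma> p \<notin> ?B" by blast
    then have "u (\<sigma> p) = 0" using basic(2) by (auto simp: supp_def)
    then show False using p(1) nonneg[of p] by (simp add: P_def)
  qed
  show ?thesis
  proof (rule polS_eq_self, rule ccontr)
    fix x assume x: "x \<in> ?H" "x \<in> Y" "\<sigma> x \<notin> Y" "x \<notin> X"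
    have "\<sigma> x \<in> X" using x by (simp add: mem_polS)
    then have "u x < u (\<sigma> x)" using x(4) level by auto
    then have xP: "x \<in> P" by (simp add: P_def)
    have L': "\<And>y a. y \<in> Y \<Longrightarrow> \<bar>y $ a - 0 $ a\<bar> \<le> L" using L by simp
    have L0: "0 \<le> L" using L[OF x(2)] by (meson abs_ge_zero order_trans)
    have out: "transversal.out 0 j L x \<in> P \<and> transversal.out 0 j L x \<in> ?B \<and> \<bar>transversal.out 0 j L x $ j - 0 $ j\<bar> > L
        \<and> transversal.out 0 j L x \<in> ?H \<and> (\<forall>a. a \<noteq> j \<longrightarrow> transversal.out 0 j L x $ a = x $ a)"
      and outB: "\<And>a. \<bar>transversal.out 0 j L x $ a\<bar> \<le> L + 1"
      if "transversal \<sigma> ?H Y 0 j L" for j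
    proof -
      interpret transversal \<sigma> ?H Y 0 j L by (rule that)
      show bd: "\<bar>out x $ a\<bar> \<le> L + 1" for a using L[OF x(2), of a] by (auto simp: out_def)
      have "out x \<in> P"
      proof (rule box_move[OF closed _ xP])
        fix z assume z: "\<And>k. min (x $ k) (out x $ k) \<le> z $ k \<and> z $ k \<le> max (x $ k) (out x $ k)"
        have "z \<in> ?B"
        proof (rule box)
          show "\<bar>z $ a\<bar> \<le> L + 1" for a using z[of a] bd[of a] L[OF x(2), of a] by simp linarith
        qed
        then show "z \<in> ?G" using out_hull[OF x(1,3) z] by blast
      qed
      then show "out x \<in> P \<and> out x \<in> ?B \<and> \<bar>out x $ j - 0 $ j\<bar> > L
        \<and> out x \<in> ?H \<and> (\<forall>a. a \<noteq> j \<longrightarrow> out x $ a = x $ a)"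
        using out_far[of x] out_H[OF x(1)] box[OF bd] by (simp add: out_def)
    qed
    from \<sigma> have "\<exists>p\<in>P. p \<in> ?B \<and> \<sigma> p \<notin> ?B"
    proof (cases rule: Refl_normal_form)
      case (coord k m)
      obtain j where j: "j \<noteq> k" using third_coordinate[OF d, of k k] by blast
      have tr: "transversal \<sigma> ?H Y 0 j L"
        unfolding coord(1) by (rule transversal_refl1[OF cen[unfolded coord(1)] L'[unfolded coord(1)] j])
      interpret transversal \<sigma> ?H Y 0 j L by (rule tr)
      define s :: int where "s = (if m > 0 then -1 else 1)"
      have m: "m \<noteq> 0" using coord(2) by simp
      have H: "z \<in> ?H \<longleftrightarrow> m * (m - 2 * z $ k) > 0" for z by (simp add: coord(1) Hs_refl1)
      show ?thesis
      proof (rule ball_exit[OF j, of s "out x"])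
        show "s = 1 \<or> s = -1" by (simp add: s_def)
        show "out x \<in> P" "out x \<in> ?H" "out x \<in> ?B" "\<bar>out x $ j - 0 $ j\<bar> > L" using out[OF tr] by blast+
        show "vupd z k t \<in> ?H" if "z \<in> ?H" "s * z $ k \<le> s * t" for z t
          using that m by (auto simp: H s_def zero_less_mult_iff split: if_splits)
        show "sqd (vupd (out x) k (t + s)) 0 \<le> sqd (\<sigma> (vupd (out x) k t)) 0" if "s * t \<ge> 0" for t
        proof -
          have "sqd (\<sigma> (vupd (out x) k t)) 0 - sqd (vupd (out x) k t) 0 = m * (m - 2 * t)"
            unfolding coord(1) sqd_refl1_diff by simp
          moreover have "sqd (vupd (out x) k (t + s)) 0 - sqd (vupd (out x) k t) 0 = 2 * s * t + s * s"
            by (simp add: sqd_vupd power2_eq_square algebra_simps)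
          \<comment> \<open>The factors on the right have absolute values at least 1 and 1 + 2|t|:
            reflecting costs at least as much norm as one further step.\<close>
          moreover have "2 * s * t + s * s \<le> m * (m - 2 * t)"
          proof (cases "m > 0")
            case True
            then have "1 * (1 - 2 * t) \<le> m * (m - 2 * t)" using that by (intro mult_mono) (auto simp: s_def)
            then show ?thesis using True by (simp add: s_def)
          next
            case False
            then have "1 * (1 + 2 * t) \<le> (- m) * (- m + 2 * t)" using that m by (intro mult_mono) (auto simp: s_def)
            then show ?thesis using False by (simp add: s_def algebra_simps)
          qed
          ultimately show ?thesis by linarith
        qed
      qed (rule closed)
    next
      case (diag k l m)
      obtain j where j: "j \<noteq> k" "j \<noteq> l" using third_coordinate[OF d] by blast
      have tr: "transversal \<sigma> ?H Y 0 j L"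
        unfolding diag(1) by (rule transversal_refl2[OF cen[unfolded diag(1)] L'[unfolded diag(1)] j diag(2)])
      interpret transversal \<sigma> ?H Y 0 j L by (rule tr)
      have m: "m \<ge> 1" using diag(3) by simp
      have H: "z \<in> ?H \<longleftrightarrow> z $ k - z $ l < m" for z
        using m by (auto simp: diag(1) Hs_refl2[OF diag(2)] zero_less_mult_iff)
      \<comment> \<open>Lowering the \<open>k\<close>-th coordinate to at most \<open>m - 1\<close>
        makes \<open>m - (y $ k - t) \<ge> 1 + t\<close>, so that the reflection outweighs a step
        along \<open>l\<close>.\<close>
      define y where "y = vupd (out x) k (min (x $ k) (m - 1))"
      have oj: "out x $ a = x $ a" if "a \<noteq> j" for a using that out[OF tr] by blast
      have kB: "\<bar>min (x $ k) (m - 1)\<bar> \<le> L" using L[OF x(2), of k] m L0 by simp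
      have oP: "out x \<in> P" using out[OF tr] by blast
      have yP: "y \<in> P"
      proof (rule box_move[OF closed _ oP])
        fix z assume z: "\<And>a. min (out x $ a) (y $ a) \<le> z $ a \<and> z $ a \<le> max (out x $ a) (y $ a)"
        have "z \<in> ?B"
        proof (rule box)
          show "\<bar>z $ a\<bar> \<le> L + 1" for a
            using z[of a] outB[OF tr, of a] kB by (cases "a = k") (simp_all add: y_def, linarith+)
        qed
        moreover have "z \<in> ?H"
          using z[of k] z[of l] x(1) oj[of k] oj[of l] j diag(2) by (auto simp: H y_def)
        moreover have "z $ j = out x $ j" using z[of j] j by (intro order_antisym) (simp_all add: y_def)
        then have "\<sigma> z \<notin> Y" using out[OF tr] by (intro far_notin) simp
        ultimately show "z \<in> ?G" by blast
      qed
      have yH: "y \<in> ?H" using x(1) oj[of l] j diag(2) by (auto simp: H y_def)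
      show ?thesis
      proof (rule ball_exit[OF j(2), of 1 y])
        show "y \<in> P" "y \<in> ?H" by (rule yP yH)+
        show "y \<in> ?B"
        proof (rule box)
          show "\<bar>y $ a\<bar> \<le> L + 1" for a
            using outB[OF tr, of a] kB by (cases "a = k") (simp_all add: y_def)
        qed
        show "\<bar>y $ j - 0 $ j\<bar> > L" using out[OF tr] j by (simp add: y_def)
        show "vupd z l t \<in> ?H" if "z \<in> ?H" "1 * z $ l \<le> 1 * t" for z t
          using that diag(2) by (auto simp: H)
        show "sqd (vupd y l (t + 1)) 0 \<le> sqd (\<sigma> (vupd y l t)) 0" if "1 * t \<ge> 0" for t
        proof -
          have e1: "sqd (\<sigma> (vupd y l t)) 0 - sqd (vupd y l t) 0 = 2 * m * (m - (y $ k - t))"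
            unfolding diag(1) sqd_refl2_diff[OF diag(2)] using diag(2) by simp
          have e2: "sqd (vupd y l (t + 1)) 0 - sqd (vupd y l t) 0 = 2 * t + 1"
            by (simp add: sqd_vupd power2_eq_square algebra_simps)
          have "m * (m - (y $ k - t)) \<ge> 1 * (1 + t)"
            using m that by (intro mult_mono) (auto simp: y_def)
          then have "2 * t + 1 \<le> 2 * m * (m - (y $ k - t))" by simp
          then have "sqd (vupd y l (t + 1)) 0 - sqd (vupd y l t) 0 \<le> sqd (\<sigma> (vupd y l t)) 0 - sqd (vupd y l t) 0"
            by (simp only: e1 e2)
          then show ?thesis by simp
        qed
      qed (simp, rule closed)
    qed
    then show False using noexit by blast
  qed
qed

section \<open>The first Dirichlet eigenvalue\<close>

definition norm_sq :: "(int^'n \<Rightarrow> real) \<Rightarrow> real" where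
  "norm_sq u = (\<Sum>\<^sub>\<infinity>i. (u i)\<^sup>2)"

lemma norm_sq_has_sum:
  assumes "finite A" "supp u \<subseteq> A"
  shows "((\<lambda>i. (u i)\<^sup>2) has_sum (\<Sum>i\<in>A. (u i)\<^sup>2)) UNIV"
  by (rule has_sum_finite_neutralI[OF assms(1)]) (use assms(2) in \<open>auto simp: supp_def\<close>)

lemma norm_sq_finite: "finite A \<Longrightarrow> supp u \<subseteq> A \<Longrightarrow> norm_sq u = (\<Sum>i\<in>A. (u i)\<^sup>2)"
  unfolding norm_sq_def by (rule infsumI[OF norm_sq_has_sum])

lemma norm_sq_cmult: "norm_sq (\<lambda>i. a * u i) = a\<^sup>2 * norm_sq u"
  by (simp add: norm_sq_def power_mult_distrib infsum_cmult_right')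

lemma norm_sq_pos:
  assumes "finite (supp u)" "supp u \<noteq> {}"
  shows "norm_sq u > 0"
  unfolding norm_sq_finite[OF assms(1) order_refl]
  by (rule sum_pos[OF assms]) (auto simp: supp_def)

locale eig_optimal =
  fixes N :: nat and u :: "int^'n \<Rightarrow> real" and \<mu> :: real
  assumes fin: "finite (supp u)" and ne: "supp u \<noteq> {}" and cardle: "card (supp u) \<le> N"
    and nonneg: "u i \<ge> 0"
    and eq: "dirichlet u = \<mu> * norm_sq u"
    and minimal: "\<And>z :: int^'n \<Rightarrow> real. finite (supp z) \<Longrightarrow> card (supp z) \<le> N \<Longrightarrow> \<mu> * norm_sq z \<le> dirichlet z"
begin

lemma eigen_equation:
  assumes "card (insert i (supp u)) \<le> N"
  shows "lap u i = - (\<mu> / 2) * u i"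
proof -
  have s: "bond_sq u summable_on bonds" by (rule dirichlet_finite(2)[OF fin order_refl])
  let ?A = "insert i (supp u)"
  have A: "finite ?A" "supp u \<subseteq> ?A" using fin by auto
  have "(- 4 * lap u i - 2 * \<mu> * u i) * t + (2 * real (card (nbhd i)) - \<mu>) * t\<^sup>2 \<ge> 0" for t
  proof -
    let ?u = "u(i := u i + t)"
    have sub: "supp ?u \<subseteq> ?A" by (auto simp: supp_def split: if_splits)
    then have "finite (supp ?u)" "card (supp ?u) \<le> N"
      using A(1) finite_subset card_mono[OF A(1) sub] assms by auto
    then have "\<mu> * norm_sq ?u \<le> dirichlet ?u" by (rule minimal)
    moreover have "norm_sq ?u = norm_sq u + 2 * t * u i + t\<^sup>2"
      unfolding norm_sq_finite[OF A(1) sub] norm_sq_finite[OF A]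
      by (subst (1 2) sum.remove[of _ i]) (auto simp: fin power2_eq_square algebra_simps intro!: sum.cong)
    ultimately show ?thesis
      unfolding dirichlet_perturb(2)[OF s] eq by (simp add: algebra_simps)
  qed
  from linear_coeff_zero[OF zero_less_one this] show ?thesis by simp
qed

text \<open>With room for one more point the eigenvalue equation would hold at a zero next to the
  support, where nonnegativity would force all neighbours to vanish.\<close>

lemma card_supp: "card (supp u) = N"
proof (rule ccontr)
  assume "card (supp u) \<noteq> N"
  then have lt: "card (supp u) < N" using cardle by simp
  obtain k :: 'n where True by blast
  obtain x where x: "x \<in> supp u" "\<And>y. y \<in> supp u \<Longrightarrow> y $ k \<le> x $ k"
    using arg_min_if_finite[OF fin ne, of "\<lambda>j. - (j $ k)"] by (metis linorder_not_less neg_less_iff_less)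
  define i where "i = vupd x k (x $ k + 1)"
  have "i \<notin> supp u" using x(2)[of i] by (auto simp: i_def)
  then have ui: "u i = 0" by (simp add: supp_def)
  have "lap u i = - (\<mu> / 2) * u i" using lt fin by (intro eigen_equation) (simp add: card_insert_if)
  then have "(\<Sum>j\<in>nbhd i. u j) = 0" using ui by (simp add: lap_def)
  moreover have "x \<in> nbhd i" using adj_vupdI[of "x $ k + 1" x k] by (simp add: nbhd_def i_def adj_commute)
  ultimately have "u x = 0" using sum_nonneg_0[of "nbhd i" u x] nonneg by simp
  then show False using x(1) by (simp add: supp_def)
qed

lemma eigen_on_supp: "u i > 0 \<Longrightarrow> lap u i = - (\<mu> / 2) * u i"
  by (rule eigen_equation) (use cardle in \<open>auto simp: supp_def insert_absorb\<close>)

lemma supp_eq: "supp u = {i. u i > 0}"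
  using nonneg by (auto simp: supp_def less_le)

end

context polarization
begin

lemma norm_sq_pol:
  assumes "finite (supp u)" "finite (supp (polF \<sigma> H u))"
  shows "norm_sq (polF \<sigma> H u) = norm_sq u"
proof -
  have bij: "bij_betw \<sigma> UNIV UNIV" by (rule bij_betwI[where g = \<sigma>]) auto
  have hs: "((\<lambda>i. (z i)\<^sup>2 + (z (\<sigma> i))\<^sup>2) has_sum (norm_sq z + norm_sq z)) UNIV" if "finite (supp z)" for z
  proof -
    have 1: "((\<lambda>i. (z i)\<^sup>2) has_sum norm_sq z) UNIV"
      using norm_sq_has_sum[OF that order_refl] norm_sq_finite[OF that order_refl] by simp
    then have "((\<lambda>i. (z (\<sigma> i))\<^sup>2) has_sum norm_sq z) UNIV"
      using has_sum_reindex_bij_betw[OF bij, of "\<lambda>i. (z i)\<^sup>2"] by simp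
    from has_sum_add[OF 1 this] show ?thesis .
  qed
  have "(polF \<sigma> H u i)\<^sup>2 + (polF \<sigma> H u (\<sigma> i))\<^sup>2 = (u i)\<^sup>2 + (u (\<sigma> i))\<^sup>2" for i
    using half[of i] by (auto simp: polF_def max_def min_def)
  then have "norm_sq (polF \<sigma> H u) + norm_sq (polF \<sigma> H u) = norm_sq u + norm_sq u"
    using has_sum_unique[OF hs[OF assms(2)]] hs[OF assms(1)] by simp
  then show ?thesis by linarith
qed

end

locale eig_polarized = eig_optimal N u \<mu> + polarization \<sigma> H for N and u :: "int^'n \<Rightarrow> real" and \<mu> and \<sigma> :: "int^'n \<Rightarrow> int^'n" and H
begin

abbreviation "v \<equiv> polF \<sigma> H u"
abbreviation "X \<equiv> supp u"
abbreviation "Y \<equiv> polS \<sigma> H X"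

lemma v_nonneg: "v i \<ge> 0"
  using nonneg[of i] nonneg[of "\<sigma> i"] by (simp add: polF_def le_max_iff_disj)

lemma supp_pol: "supp v = Y"
proof -
  have "supp v = {i. v i > 0}" using v_nonneg by (auto simp: supp_def less_le)
  then show ?thesis by (simp add: supp_eq polF_superlevel(2))
qed

lemma dirichlet_pol_eq: "dirichlet v = dirichlet u"
proof (rule antisym)
  show "dirichlet v \<le> dirichlet u" by (rule dirichlet_pol(2)) (rule dirichlet_finite(2)[OF fin order_refl])
  have "\<mu> * norm_sq v \<le> dirichlet v"
    by (rule minimal) (use cardle fin in \<open>simp_all add: supp_pol finite_polS card_polS\<close>)
  then show "dirichlet u \<le> dirichlet v"
    using norm_sq_pol[OF fin] fin by (simp add: eq supp_pol finite_polS)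
qed

sublocale pol: eig_optimal N v \<mu>
proof
  show "finite (supp v)" "card (supp v) \<le> N" using fin cardle by (simp_all add: supp_pol finite_polS card_polS)
  then show "supp v \<noteq> {}" using ne fin unfolding supp_pol by (metis card_0_eq card_polS finite_polS)
  show "v i \<ge> 0" for i by (rule v_nonneg)
  show "dirichlet v = \<mu> * norm_sq v"
    using norm_sq_pol[OF fin] fin by (simp add: dirichlet_pol_eq eq supp_pol finite_polS)
qed (rule minimal)

lemma no_sign_change:
  "adj i j \<Longrightarrow> i \<in> H \<Longrightarrow> j \<in> H \<Longrightarrow> u i > u (\<sigma> i) \<Longrightarrow> u j \<ge> u (\<sigma> j)"
  by (rule dirichlet_pol(3)[OF dirichlet_finite(2)[OF fin order_refl] dirichlet_pol_eq])

text \<open>If the values agreed at \<open>j\<close>, positivity of \<open>v j\<close> would make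
  them all positive there, and the eigenvalue equations of \<open>u\<close>, its reflection and
  \<open>v\<close> would coincide at this point.\<close>

lemma sign_spreads:
  assumes "adj i j" "i \<in> H" "j \<in> H" "j \<in> Y" "u i > u (\<sigma> i)"
  shows "u j > u (\<sigma> j)"
proof -
  have "u (\<sigma> j) \<noteq> u j"
  proof
    assume e: "u (\<sigma> j) = u j"
    then have vj: "v j = u j" using assms(3) by (simp add: polF_def)
    have "v j > 0" using assms(4) pol.supp_eq by (auto simp: supp_pol)
    then have "u (\<sigma> i) = u i"
      using zero_spreads[OF assms(3) e eigen_on_supp[of j], of i] eigen_on_supp[of "\<sigma> j"] pol.eigen_on_supp[of j]
        assms(1,2) vj e by (simp add: adj_commute)
    then show False using assms(5) by simp
  qed
  then show ?thesis using no_sign_change[OF assms(1-3,5)] by simp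
qed

end

text \<open>Every point of the region is linked to \<open>c\<close> itself, so one point decides the
  sign everywhere.\<close>

lemma centred_half_connected:
  fixes c :: "int^'n"
  assumes \<sigma>: "\<sigma> \<in> Refl" "\<sigma> c \<noteq> c" and Y: "centred c Y" and x: "x \<in> Y" "x \<in> Hs \<sigma> c"
    and closed: "\<And>a b. a \<in> P \<Longrightarrow> a \<in> Y \<inter> Hs \<sigma> c \<Longrightarrow> b \<in> Y \<inter> Hs \<sigma> c \<Longrightarrow> adj a b \<Longrightarrow> b \<in> P"
  shows "x \<in> P \<longleftrightarrow> c \<in> P"
proof -
  let ?G = "Y \<inter> Hs \<sigma> c"
  have hullY: "z \<in> Y" if "\<And>k. min (x $ k) (c $ k) \<le> z $ k \<and> z $ k \<le> max (x $ k) (c $ k)" for z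
  proof (rule centred_box[OF Y x(1)])
    show "z $ k = x $ k \<or> \<bar>z $ k - c $ k\<bar> < \<bar>x $ k - c $ k\<bar>" for k using that[of k] by linarith
  qed
  have move: "a \<in> P \<longleftrightarrow> b \<in> P"
    if h: "\<And>z. (\<And>k. min (a $ k) (b $ k) \<le> z $ k \<and> z $ k \<le> max (a $ k) (b $ k)) \<Longrightarrow> z \<in> ?G" for a b
  proof
    show "b \<in> P" if "a \<in> P" by (rule box_move[OF closed h that])
    show "a \<in> P" if "b \<in> P"
    proof (rule box_move[OF closed _ that])
      fix z assume z: "\<And>k. min (b $ k) (a $ k) \<le> z $ k \<and> z $ k \<le> max (b $ k) (a $ k)"
      show "z \<in> ?G"
      proof (rule h)
        show "min (a $ k) (b $ k) \<le> z $ k \<and> z $ k \<le> max (a $ k) (b $ k)" for k using z[of k] by linarith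
      qed
    qed
  qed
  from \<sigma> show ?thesis
  proof (cases rule: Refl_normal_form)
    case (coord k m)
    have H: "z \<in> Hs \<sigma> c \<longleftrightarrow> (m - 2 * c $ k) * (m - 2 * z $ k) > 0" for z by (simp add: coord(1) Hs_refl1)
    show ?thesis
    proof (rule move)
      fix z assume z: "\<And>k. min (x $ k) (c $ k) \<le> z $ k \<and> z $ k \<le> max (x $ k) (c $ k)"
      have "z \<in> Hs \<sigma> c" using z[of k] x(2) coord(2) unfolding H by (auto simp: zero_less_mult_iff)
      then show "z \<in> ?G" using hullY[OF z] by blast
    qed
  next
    case (diag k l m)
    have H: "z \<in> Hs \<sigma> c \<longleftrightarrow> z $ k - z $ l < m" for z
      using diag(3) by (auto simp: diag(1) Hs_refl2[OF diag(2)] zero_less_mult_iff)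
    \<comment> \<open>The box between \<open>x\<close> and \<open>c\<close> may cross a diagonal
      mirror. Moving first the coordinate whose change does not bring the point past it avoids
      this.\<close>
    define y where "y = (if x $ k \<ge> c $ k then vupd x k (c $ k) else vupd x l (c $ l))"
    have 1: "x \<in> P \<longleftrightarrow> y \<in> P"
    proof (rule move)
      fix z assume z: "\<And>a. min (x $ a) (y $ a) \<le> z $ a \<and> z $ a \<le> max (x $ a) (y $ a)"
      have "z \<in> Hs \<sigma> c"
        using z[of k] z[of l] x(2) diag(2,3) unfolding H y_def by (auto split: if_splits)
      moreover have "z \<in> Y"
      proof (rule hullY)
        show "min (x $ a) (c $ a) \<le> z $ a \<and> z $ a \<le> max (x $ a) (c $ a)" for a
          using z[of a] by (auto simp: y_def split: if_splits)
      qed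
      ultimately show "z \<in> ?G" by blast
    qed
    have 2: "y \<in> P \<longleftrightarrow> c \<in> P"
    proof (rule move)
      fix z assume z: "\<And>a. min (y $ a) (c $ a) \<le> z $ a \<and> z $ a \<le> max (y $ a) (c $ a)"
      have "z \<in> Hs \<sigma> c"
        using z[of k] z[of l] x(2) diag(2,3) unfolding H y_def by (auto split: if_splits)
      moreover have "z \<in> Y"
      proof (rule hullY)
        show "min (x $ a) (c $ a) \<le> z $ a \<and> z $ a \<le> max (x $ a) (c $ a)" for a
          using z[of a] by (auto simp: y_def split: if_splits)
      qed
      ultimately show "z \<in> ?G" by blast
    qed
    show ?thesis using 1 2 by simp
  qed
qed

lemma rigid_eigenvalue:
  fixes c :: "int^'n"
  assumes opt: "eig_optimal N u \<mu>" and \<sigma>: "\<sigma> \<in> Refl" "\<sigma> c \<noteq> c"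
    and cen: "centred c (polS \<sigma> (Hs \<sigma> c) (supp u))"
  shows "polS \<sigma> (Hs \<sigma> c) (supp u) = supp u \<or> supp u = \<sigma> ` polS \<sigma> (Hs \<sigma> c) (supp u)"
proof -
  let ?H = "Hs \<sigma> c"
  interpret eig_optimal N u \<mu> by (rule opt)
  interpret polarization \<sigma> ?H by (rule polarization_Refl[OF \<sigma>])
  interpret eig_polarized N u \<mu> \<sigma> ?H by unfold_locales
  define P where "P = {i. u i > u (\<sigma> i)}"
  have closed: "b \<in> P" if "a \<in> P" "a \<in> Y \<inter> ?H" "b \<in> Y \<inter> ?H" "adj a b" for a b
    using sign_spreads[of a b] that by (simp add: P_def)
  have con: "x \<in> P \<longleftrightarrow> c \<in> P" if "x \<in> ?H" "x \<in> Y" for x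
    by (rule centred_half_connected[OF \<sigma> cen that(2,1) closed])
  have lev: "i \<in> X \<longleftrightarrow> u i > 0" for i using supp_eq by auto
  show ?thesis
  proof (cases "c \<in> P")
    case True
    have "x \<in> X" if x: "x \<in> ?H" "x \<in> Y" for x
      using con[OF x] True nonneg[of "\<sigma> x"] by (simp add: lev P_def)
    then show ?thesis using polS_eq_self by blast
  next
    case False
    have "x \<notin> X" if x: "x \<in> ?H" "x \<in> Y" "\<sigma> x \<notin> Y" for x
    proof
      assume a: "x \<in> X"
      have "u x \<le> u (\<sigma> x)" using con[OF x(1,2)] False by (simp add: P_def)
      then have "\<sigma> x \<in> X" using a by (simp add: lev)
      then show False using x a by (simp add: refl_polS)
    qed
    then show ?thesis using polS_eq_refl by blast
  qed
qed

section \<open>Existence of minimizing eigenfunctions on a finite set\<close>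

lemma compact_Pi_real:
  fixes S :: "'a \<Rightarrow> real set"
  assumes "\<And>i. compact (S i)"
  shows "compact (PiE UNIV S)"
proof -
  have "compactin (product_topology (\<lambda>_. euclidean) UNIV) (PiE UNIV S)"
    using assms by (simp add: compactin_PiE)
  then show ?thesis by (simp add: euclidean_product_topology)
qed

lemma eigenfunction_exists:
  fixes Y :: "(int^'n) set"
  assumes Y: "finite Y" "Y \<noteq> {}" and r: "r > 0"
  obtains u where "supp u \<subseteq> Y" "norm_sq u = r" "\<And>z. supp z \<subseteq> Y \<Longrightarrow> norm_sq z = r \<Longrightarrow> dirichlet u \<le> dirichlet z"
proof -
  \<comment> \<open>A compact box containing all candidates: their entries satisfy u(i)^2 \<le> r
    \<le> (r+1)^2.\<close>
  define S where "S = (\<lambda>i. if i \<in> Y then {- (r + 1)..r + 1} else {0::real})"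
  define K where "K = PiE UNIV S \<inter> {u. (\<Sum>i\<in>Y. (u i)\<^sup>2) = r}"
  let ?F = "{b \<in> bonds. fst b \<in> Y \<or> snd b \<in> Y}"
  have co: "continuous_on A (\<lambda>u. u i)" for A and i :: "int^'n"
    by (rule continuous_on_subset[OF continuous_on_product_coordinates]) simp
  have cl: "closed {u :: int^'n \<Rightarrow> real. (\<Sum>i\<in>Y. (u i)\<^sup>2) = r}"
    by (intro closed_Collect_eq continuous_intros co)
  have "compact K" unfolding K_def
    by (intro compact_Int_closed cl compact_Pi_real) (simp add: S_def)
  have K: "u \<in> K \<longleftrightarrow> supp u \<subseteq> Y \<and> norm_sq u = r" for u
  proof
    assume u: "u \<in> K"
    then have s: "supp u \<subseteq> Y" by (auto simp: K_def S_def PiE_iff supp_def split: if_splits)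
    then show "supp u \<subseteq> Y \<and> norm_sq u = r" using u Y by (simp add: K_def norm_sq_finite)
  next
    assume u: "supp u \<subseteq> Y \<and> norm_sq u = r"
    then have e: "(\<Sum>i\<in>Y. (u i)\<^sup>2) = r" using norm_sq_finite[OF Y(1)] by metis
    have "u i \<in> S i" for i
    proof (cases "i \<in> Y")
      case True
      have "(u i)\<^sup>2 \<le> r" unfolding e[symmetric] by (rule member_le_sum[OF True]) (auto simp: Y)
      also have "r \<le> (r + 1)\<^sup>2" using r by (simp add: power2_eq_square algebra_simps)
      finally have "\<bar>u i\<bar> \<le> r + 1" using r by (simp add: power2_le_iff_abs_le)
      then show ?thesis using True by (simp add: S_def abs_le_iff)
    next
      case False
      then show ?thesis using u by (auto simp: S_def supp_def)
    qed
    then show "u \<in> K" using e by (auto simp: K_def PiE_iff)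
  qed
  obtain y where y: "y \<in> Y" using Y(2) by blast
  let ?e = "\<lambda>i. if i = y then sqrt r else 0"
  have "supp ?e \<subseteq> {y}" by (auto simp: supp_def)
  then have "norm_sq ?e = r" using r by (subst norm_sq_finite[of "{y}"]) auto
  then have "?e \<in> K" using y by (auto simp: K supp_def)
  then have ne: "K \<noteq> {}" by blast
  have "continuous_on K (\<lambda>u. \<Sum>b\<in>?F. bond_sq u b)"
    unfolding bond_sq_def by (intro continuous_intros co)
  from continuous_attains_inf[OF \<open>compact K\<close> ne this]
  obtain u where u: "u \<in> K" "\<And>z. z \<in> K \<Longrightarrow> (\<Sum>b\<in>?F. bond_sq u b) \<le> (\<Sum>b\<in>?F. bond_sq z b)" by blast
  show ?thesis
  proof
    show "supp u \<subseteq> Y" "norm_sq u = r" using u(1) K by auto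
    show "dirichlet u \<le> dirichlet z" if "supp z \<subseteq> Y" "norm_sq z = r" for z
      using u(2)[of z] u(1) that by (simp add: K dirichlet_finite(1)[OF Y(1)])
  qed
qed

section \<open>The diameter bounds\<close>

lemma Inf_cmult_pos:
  fixes S :: "real set"
  assumes "a > 0" "S \<noteq> {}" "bdd_below S"
  shows "Inf ((\<lambda>x. a * x) ` S) = a * Inf S"
proof (rule antisym)
  have bdd: "bdd_below ((\<lambda>x. a * x) ` S)"
    using assms(1,3) by (auto simp: bdd_below_def) (metis mult_le_cancel_left_pos)
  have "Inf ((\<lambda>x. a * x) ` S) / a \<le> Inf S"
  proof (rule cInf_greatest[OF assms(2)])
    fix x assume "x \<in> S"
    then have "Inf ((\<lambda>x. a * x) ` S) \<le> a * x" by (intro cInf_lower bdd) auto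
    then show "Inf ((\<lambda>x. a * x) ` S) / a \<le> x" using assms(1) by (simp add: field_simps)
  qed
  then show "Inf ((\<lambda>x. a * x) ` S) \<le> a * Inf S" using assms(1) by (simp add: field_simps)
  show "a * Inf S \<le> Inf ((\<lambda>x. a * x) ` S)"
    using assms by (intro cInf_greatest) (auto intro!: cInf_lower)
qed

lemma potentials_nonempty: "finite X \<Longrightarrow> X \<subseteq> B \<Longrightarrow> potentials B X \<noteq> {}"
  by (auto simp: potentials_def supp_def intro!: exI[of _ "\<lambda>i. if i \<in> X then 1 else 0"] split: if_splits)

lemma Inf_energy_eq:
  fixes X :: "(int^'n) set"
  assumes "finite X" "X \<subseteq> B" "N \<ge> 1"
  shows "Inf ((\<lambda>u. energy N u) ` potentials B X) = escale TYPE('n) N * dcap B X"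
proof -
  have "(\<lambda>u. energy N u) ` potentials B X = (\<lambda>x. escale TYPE('n) N * x) ` dirichlet ` potentials B X"
    by (auto simp: energy_eq image_image)
  then show ?thesis unfolding dcap_def
    using potentials_nonempty[OF assms(1,2)]
    by (simp add: Inf_cmult_pos escale_pos[OF assms(3)] bdd_belowI2[of _ 0] dirichlet_nonneg)
qed

lemma dcap_nonneg: "finite X \<Longrightarrow> X \<subseteq> B \<Longrightarrow> dcap B X \<ge> 0"
  unfolding dcap_def using potentials_nonempty by (intro cInf_greatest) (auto intro: dirichlet_nonneg)

lemma cap_eq:
  fixes X :: "(int^'n) set"
  assumes "finite X" "N \<ge> 1"
  shows "cap N X = escale TYPE('n) N * dcap UNIV X"
  unfolding Inf_energy_eq[OF assms(1) subset_UNIV assms(2), symmetric] cap_def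
  by (rule arg_cong[of _ _ Inf]) (auto simp: potentials_def)

lemma rel_cap_eq:
  fixes X :: "(int^'n) set"
  assumes "X \<subseteq> lattice_ball (R * real N powr (1 / real CARD('n)))" "N \<ge> 1"
  shows "rel_cap N X R = escale TYPE('n) N * dcap (lattice_ball (R * real N powr (1 / real CARD('n)))) X"
  unfolding Inf_energy_eq[OF finite_subset[OF assms(1) finite_lattice_ball] assms(1,2), symmetric] rel_cap_def
  by (rule arg_cong[of _ _ Inf]) (auto simp: potentials_def intro: finite_subset[OF _ finite_lattice_ball])

lemma cap_nonneg: "finite X \<Longrightarrow> N \<ge> 1 \<Longrightarrow> cap N X \<ge> 0"
  by (simp only: cap_eq) (intro mult_nonneg_nonneg dcap_nonneg less_imp_le[OF escale_pos] subset_UNIV)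

lemma rel_cap_nonneg:
  fixes X :: "(int^'n) set"
  assumes "X \<subseteq> lattice_ball (R * real N powr (1 / real CARD('n)))" "N \<ge> 1"
  shows "rel_cap N X R \<ge> 0"
  unfolding rel_cap_eq[OF assms]
  using dcap_nonneg[OF finite_subset[OF assms(1) finite_lattice_ball] assms(1)] escale_pos[OF assms(2), where 'n = 'n]
  by simp

text \<open>\<open>dcap_attained\<close> provides the potential, and \<open>dcap_le_tame\<close>
  makes it compete with tame functions although the infimum only ranges over finite
  supports.\<close>

lemma cap_optimal_if_minimal:
  fixes X :: "(int^'n) set"
  assumes d: "CARD('n) \<ge> 3" and X: "finite X" "card X = N" "X \<subseteq> B" and N: "N \<ge> 1"
    and min: "\<And>Y. finite Y \<Longrightarrow> card Y = N \<Longrightarrow> Y \<subseteq> B \<Longrightarrow> dcap B X \<le> dcap B Y"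
  shows "\<exists>u. cap_optimal B N X u"
proof -
  obtain u where u: "tame u" "supp u \<subseteq> B" "\<And>i. i \<in> X \<Longrightarrow> u i \<ge> 1" "dirichlet u \<le> dcap B X"
    using dcap_attained[OF d X(1,3)] by blast
  have "cap_optimal B N X u"
  proof
    show "feasible B N X u" using u X by (simp add: feasible_def)
    fix Y v assume v: "feasible B N Y v"
    then have "dcap B X \<le> dcap B Y" by (intro min) (auto simp: feasible_def)
    also have "\<dots> \<le> dirichlet v" using v by (intro dcap_le_tame) (auto simp: feasible_def)
    finally show "dirichlet u \<le> dirichlet v" using u(4) by simp
  qed (rule N)
  then show ?thesis by blast
qed

lemma centred_diameter:
  fixes X :: "(int^'n) set"
  assumes "centred c X" "finite X" "card X = N" "N \<ge> 1"
  shows "diameter (emb ` X) \<le> 2 * real CARD('n) * (real CARD('n) + 1) * real N powr (1 / real CARD('n))"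
  using diameter_emb_bound[OF centred_coord_bound[OF assms(1) _ assms(2-4)], of X] by (simp add: mult.assoc)

lemma cap_optimal_polS:
  assumes "cap_optimal UNIV N X u" "\<sigma> \<in> Refl" "\<sigma> c \<noteq> c"
  shows "cap_optimal UNIV N (polS \<sigma> (Hs \<sigma> c) X) (polF \<sigma> (Hs \<sigma> c) u)"
proof -
  interpret cap_optimal UNIV N X u by (rule assms)
  interpret polarization \<sigma> "Hs \<sigma> c" by (rule polarization_Refl[OF assms(2,3)])
  interpret cap_polarized UNIV N X u \<sigma> "Hs \<sigma> c" by unfold_locales simp
  show ?thesis by (rule pol.cap_optimal_axioms)
qed

lemma cap_optimal_ball_polS:
  assumes "cap_optimal (lattice_ball r) N X u" "\<sigma> \<in> Refl" "\<sigma> 0 \<noteq> 0"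
  shows "cap_optimal (lattice_ball r) N (polS \<sigma> (Hs \<sigma> 0) X) (polF \<sigma> (Hs \<sigma> 0) u)"
proof -
  interpret cap_optimal "lattice_ball r" N X u by (rule assms)
  interpret polarization \<sigma> "Hs \<sigma> 0" by (rule polarization_Refl[OF assms(2,3)])
  interpret cap_polarized "lattice_ball r" N X u \<sigma> "Hs \<sigma> 0"
    by unfold_locales (auto simp: Hs_def intro: lattice_ball_le)
  show ?thesis by (rule pol.cap_optimal_axioms)
qed

lemma capacity_diameter:
  fixes X :: "(int^'n) set"
  assumes d: "CARD('n) \<ge> 3" and N: "N \<ge> 1" and X: "finite X" "card X = N"
    and min: "cap N X = min_cap TYPE('n) N"
  shows "diameter (emb ` X) \<le> 2 * real CARD('n) * (real CARD('n) + 1) * real N powr (1 / real CARD('n))"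
proof -
  let ?O = "{X :: (int^'n) set. \<exists>u. cap_optimal UNIV N X u}"
  have "dcap UNIV X \<le> dcap UNIV Y" if Y: "finite Y" "card Y = N" for Y :: "(int^'n) set"
  proof -
    have "min_cap TYPE('n) N \<le> cap N Y"
      unfolding min_cap_def
    proof (rule cInf_lower)
      show "cap N Y \<in> {cap N X |X :: (int^'n) set. finite X \<and> card X = N}" using Y by blast
      show "bdd_below {cap N X |X :: (int^'n) set. finite X \<and> card X = N}"
        using cap_nonneg N by (intro bdd_belowI[of _ 0]) blast
    qed
    then have "escale TYPE('n) N * dcap UNIV X \<le> escale TYPE('n) N * dcap UNIV Y"
      unfolding min[symmetric] cap_eq[OF X(1) N] cap_eq[OF Y(1) N] .
    then show ?thesis by (simp only: mult_le_cancel_left_pos[OF escale_pos[OF N]])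
  qed
  then have XO: "X \<in> ?O" using cap_optimal_if_minimal[OF d X subset_UNIV N] by blast
  obtain c where c: "\<And>c'. moment c X \<le> moment c' X"
    using ex_has_least_nat[of "\<lambda>_. True" undefined "\<lambda>c. moment c X"] by blast
  have "centred c X"
  proof (rule moment_minimal_imp_centred[of ?O UNIV, OF _ _ _ XO UNIV_I c])
    show "finite X" if "X \<in> ?O" for X using that by (auto dest: cap_optimal.basic)
    show "polS \<sigma> (Hs \<sigma> c) X \<in> ?O" if "X \<in> ?O" "\<sigma> \<in> Refl" "\<sigma> c \<noteq> c" for X \<sigma> c
      using that cap_optimal_polS by blast
    show "polS \<sigma> (Hs \<sigma> c) X = X \<or> X = \<sigma> ` polS \<sigma> (Hs \<sigma> c) X \<and> \<sigma> c \<in> UNIV"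
      if "X \<in> ?O" "\<sigma> \<in> Refl" "\<sigma> c \<noteq> c" "centred c (polS \<sigma> (Hs \<sigma> c) X)" for X \<sigma> c
      using that rigid_whole_space[OF d] by blast
  qed
  then show ?thesis by (rule centred_diameter[OF _ X N])
qed

lemma relative_capacity_diameter:
  fixes X :: "(int^'n) set"
  assumes d: "CARD('n) \<ge> 3" and N: "N \<ge> 1" and X: "finite X" "card X = N"
    and R: "X \<subseteq> lattice_ball (R * real N powr (1 / real CARD('n)))"
      "real CARD('n) * (real CARD('n) + 2) < R"
    and min: "rel_cap N X R = min_rel_cap TYPE('n) N R"
  shows "diameter (emb ` X) \<le> 2 * real CARD('n) * (real CARD('n) + 1) * real N powr (1 / real CARD('n))"
proof -
  define \<rho> where "\<rho> = real N powr (1 / real CARD('n))"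
  let ?B = "lattice_ball (R * \<rho>) :: (int^'n) set"
  let ?O = "{X. \<exists>u. cap_optimal ?B N X u}"
  have \<rho>: "\<rho> \<ge> 1" using N by (simp add: \<rho>_def ge_one_powr_ge_zero)
  have rc: "rel_cap N Y R = escale TYPE('n) N * dcap ?B Y" if "Y \<subseteq> ?B" for Y
    using rel_cap_eq[of Y R N] that N by (simp add: \<rho>_def)
  have "dcap ?B X \<le> dcap ?B Y" if Y: "finite Y" "card Y = N" "Y \<subseteq> ?B" for Y :: "(int^'n) set"
  proof -
    have "min_rel_cap TYPE('n) N R \<le> rel_cap N Y R"
      unfolding min_rel_cap_def \<rho>_def[symmetric]
    proof (rule cInf_lower)
      show "rel_cap N Y R \<in> {rel_cap N X R |X. X \<subseteq> ?B \<and> finite X \<and> card X = N}" using Y by blast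
      show "bdd_below {rel_cap N X R |X. X \<subseteq> ?B \<and> finite X \<and> card X = N}"
        using rel_cap_nonneg[OF _ N] by (intro bdd_belowI[of _ 0]) (auto simp: \<rho>_def)
    qed
    then have "escale TYPE('n) N * dcap ?B X \<le> escale TYPE('n) N * dcap ?B Y"
      unfolding min[symmetric] rc[OF Y(3)] rc[OF R(1)[folded \<rho>_def]] .
    then show ?thesis by (simp only: mult_le_cancel_left_pos[OF escale_pos[OF N]])
  qed
  then have XO: "X \<in> ?O" using cap_optimal_if_minimal[OF d X R(1)[folded \<rho>_def] N] by blast
  \<comment> \<open>The coordinate bound for centred sets. The box of half-width
    \<open>L + 1\<close> lies in the ball because its points have norm at most d((d+1)\<rho> + 1)
    \<le> d(d+2)\<rho>.\<close>
  define L where "L = \<lfloor>(real CARD('n) + 1) * \<rho>\<rfloor>"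
  have box: "z \<in> ?B" if z: "\<And>a. \<bar>z $ a\<bar> \<le> L + 1" for z
  proof -
    have "norm (emb z) \<le> (\<Sum>a\<in>UNIV. \<bar>emb z $ a\<bar>)" by (rule norm_le_l1_cart)
    also have "\<dots> \<le> (\<Sum>a\<in>(UNIV::'n set). (real CARD('n) + 1) * \<rho> + 1)"
    proof (rule sum_mono)
      fix a
      have "\<bar>emb z $ a\<bar> = real_of_int \<bar>z $ a\<bar>" by (simp add: emb_def)
      also have "\<dots> \<le> real_of_int L + 1" using z[of a] by linarith
      also have "\<dots> \<le> (real CARD('n) + 1) * \<rho> + 1" by (simp add: L_def)
      finally show "\<bar>emb z $ a\<bar> \<le> (real CARD('n) + 1) * \<rho> + 1" .
    qed
    also have "\<dots> = real CARD('n) * ((real CARD('n) + 1) * \<rho> + 1)" by simp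
    also have "\<dots> \<le> real CARD('n) * ((real CARD('n) + 1) * \<rho> + \<rho>)" using \<rho> by (intro mult_left_mono) auto
    also have "\<dots> = real CARD('n) * (real CARD('n) + 2) * \<rho>" by (simp add: algebra_simps)
    also have "\<dots> < R * \<rho>" using R(2) \<rho> by (intro mult_strict_right_mono) auto
    finally show ?thesis by (simp add: mem_lattice_ball)
  qed
  have "centred 0 X"
  proof (rule moment_minimal_imp_centred[of ?O "{0}", OF _ _ _ XO])
    show "finite X" if "X \<in> ?O" for X using that by (auto dest: cap_optimal.basic)
    show "polS \<sigma> (Hs \<sigma> c) X \<in> ?O" if "X \<in> ?O" "\<sigma> \<in> Refl" "c \<in> {0}" "\<sigma> c \<noteq> c" for X \<sigma> c
      using that cap_optimal_ball_polS by blast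
    fix X \<sigma> c
    assume h: "X \<in> ?O" "\<sigma> \<in> Refl" "c \<in> {0}" "\<sigma> c \<noteq> c" "centred c (polS \<sigma> (Hs \<sigma> c) X)"
    then obtain u where u: "cap_optimal ?B N X u" by blast
    have c: "c = 0" using h by simp
    have opt: "cap_optimal ?B N (polS \<sigma> (Hs \<sigma> 0) X) (polF \<sigma> (Hs \<sigma> 0) u)"
      using cap_optimal_ball_polS[OF u h(2)] h(4) c by simp
    have "polS \<sigma> (Hs \<sigma> 0) X = X"
    proof (rule rigid_ball[OF d u h(2) _ _ _ box])
      show "\<bar>y $ a\<bar> \<le> L" if "y \<in> polS \<sigma> (Hs \<sigma> 0) X" for y a
        using centred_coord_bound[OF h(5)[unfolded c] that cap_optimal.basic(4,5)[OF opt] N, of a]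
        by (simp add: L_def \<rho>_def le_floor_iff)
    qed (use h c in auto)
    then show "polS \<sigma> (Hs \<sigma> c) X = X \<or> X = \<sigma> ` polS \<sigma> (Hs \<sigma> c) X \<and> \<sigma> c \<in> {0}" using c by blast
  qed auto
  then show ?thesis by (rule centred_diameter[OF _ X N])
qed

lemma lattice_ball_diameter:
  fixes X :: "(int^'n) set"
  assumes "X \<subseteq> lattice_ball r" "r \<ge> 0"
  shows "diameter (emb ` X) \<le> 2 * r"
proof (rule diameter_le)
  fix a b assume "a \<in> emb ` X" "b \<in> emb ` X"
  then have "norm a < r" "norm b < r" using assms(1) mem_lattice_ball by blast+
  then show "norm (a - b) \<le> 2 * r" using norm_triangle_ineq4[of a b] by linarith
qed (use assms(2) in simp)

text \<open>The \<open>LEAST\<close> in the definition is meaningful since the minimum is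
  attained.\<close>

lemma dirichlet_eigenvalue_attained:
  fixes Y :: "(int^'n) set"
  assumes Y: "finite Y" "card Y = N" and N: "N \<ge> 1"
  obtains u where "supp u \<subseteq> Y" "norm_sq u = real N" "dirichlet_eigenvalue N Y = escale TYPE('n) N * dirichlet u"
    "\<And>z. supp z \<subseteq> Y \<Longrightarrow> norm_sq z = real N \<Longrightarrow> dirichlet u \<le> dirichlet z"
proof -
  have "Y \<noteq> {}" using Y N by auto
  then obtain u where u: "supp u \<subseteq> Y" "norm_sq u = real N"
    "\<And>z. supp z \<subseteq> Y \<Longrightarrow> norm_sq z = real N \<Longrightarrow> dirichlet u \<le> dirichlet z"
    using eigenfunction_exists[OF Y(1), of "real N"] N by auto
  have adm: "((\<forall>i. i \<notin> Y \<longrightarrow> z i = 0) \<and> (1 / real N) * (\<Sum>\<^sub>\<infinity>i\<in>UNIV. \<bar>z i\<bar>\<^sup>2) = 1) \<longleftrightarrow>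
    supp z \<subseteq> Y \<and> norm_sq z = real N" for z :: "int^'n \<Rightarrow> real"
    using N by (auto simp: supp_def norm_sq_def)
  have "dirichlet_eigenvalue N Y = energy N u"
    unfolding dirichlet_eigenvalue_def adm
    by (rule Least_equality) (use u escale_pos[OF N, where 'n = 'n] in \<open>auto simp: energy_eq\<close>)
  then show ?thesis using that u by (simp add: energy_eq)
qed

lemma extend_finite_set:
  fixes A :: "(int^'n) set"
  assumes "finite A" "card A \<le> N"
  obtains Y where "A \<subseteq> Y" "finite Y" "card Y = N"
proof -
  have "inj (\<lambda>t. vupd (0::int^'n) undefined t)" by (auto simp: inj_on_def vupd_eq_iff)
  then have "infinite (UNIV :: (int^'n) set)"
    using finite_imageD[of "\<lambda>t. vupd (0::int^'n) undefined t" UNIV] finite_subset[OF subset_UNIV] infinite_UNIV_int by blast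
  then have "infinite (UNIV - A)" using assms(1) by simp
  then obtain W where W: "finite W" "card W = N - card A" "W \<subseteq> UNIV - A"
    using infinite_arbitrarily_large by blast
  have "card (A \<union> W) = N" using W assms by (subst card_Un_disjoint) auto
  then show ?thesis using that[of "A \<union> W"] W assms by auto
qed

lemma eig_optimal_if_minimal:
  fixes X :: "(int^'n) set"
  assumes X: "finite X" "card X = N" and N: "N \<ge> 1"
    and min: "dirichlet_eigenvalue N X = min_dirichlet_eigenvalue TYPE('n) N"
  shows "\<exists>u \<mu>. eig_optimal N u \<mu> \<and> supp u = X"
proof -
  let ?\<kappa> = "escale TYPE('n) N"
  have \<kappa>: "?\<kappa> > 0" by (rule escale_pos[OF N])
  obtain w where w: "supp w \<subseteq> X" "norm_sq w = real N" "dirichlet_eigenvalue N X = ?\<kappa> * dirichlet w"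
    by (rule dirichlet_eigenvalue_attained[OF X N])
  define \<mu> where "\<mu> = dirichlet w / real N"
  have minimal: "\<mu> * norm_sq z \<le> dirichlet z" if z: "finite (supp z)" "card (supp z) \<le> N" for z :: "int^'n \<Rightarrow> real"
  proof (cases "supp z = {}")
    case True
    then have "norm_sq z = 0" by (simp add: supp_def norm_sq_def)
    then show ?thesis by (simp add: dirichlet_nonneg)
  next
    case False
    have p: "norm_sq z > 0" by (rule norm_sq_pos[OF z(1) False])
    \<comment> \<open>A smaller support is padded to \<open>N\<close> points and \<open>z\<close>
      rescaled to the norm required in the definition.\<close>
    obtain Y where Y: "supp z \<subseteq> Y" "finite Y" "card Y = N" using extend_finite_set[OF z] by blast
    define a where "a = sqrt (real N / norm_sq z)"
    have a2: "a\<^sup>2 = real N / norm_sq z" using p by (simp add: a_def)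
    have z': "supp (\<lambda>i. a * z i) \<subseteq> Y" "norm_sq (\<lambda>i. a * z i) = real N"
      using Y(1) p by (auto simp: supp_def norm_sq_cmult a2)
    obtain y where "supp y \<subseteq> Y" "norm_sq y = real N"
      and y: "dirichlet_eigenvalue N Y = ?\<kappa> * dirichlet y"
      "\<And>z. supp z \<subseteq> Y \<Longrightarrow> norm_sq z = real N \<Longrightarrow> dirichlet y \<le> dirichlet z"
      by (rule dirichlet_eigenvalue_attained[OF Y(2,3) N]) (rule that)
    have "min_dirichlet_eigenvalue TYPE('n) N \<le> dirichlet_eigenvalue N Y"
      unfolding min_dirichlet_eigenvalue_def
    proof (rule cInf_lower)
      show "dirichlet_eigenvalue N Y \<in> {dirichlet_eigenvalue N X |X :: (int^'n) set. finite X \<and> card X = N}"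
        using Y by blast
      show "bdd_below {dirichlet_eigenvalue N X |X :: (int^'n) set. finite X \<and> card X = N}"
      proof (rule bdd_belowI[of _ 0])
        fix e assume "e \<in> {dirichlet_eigenvalue N X |X :: (int^'n) set. finite X \<and> card X = N}"
        then obtain Z :: "(int^'n) set" where Z: "e = dirichlet_eigenvalue N Z" "finite Z" "card Z = N" by blast
        then obtain q :: "int^'n \<Rightarrow> real" where "e = ?\<kappa> * dirichlet q"
          by (metis dirichlet_eigenvalue_attained[OF Z(2,3) N])
        then show "0 \<le> e" using \<kappa> by (simp add: dirichlet_nonneg)
      qed
    qed
    then have "?\<kappa> * dirichlet w \<le> ?\<kappa> * dirichlet y" unfolding min[symmetric] w(3) y(1) .
    then have "dirichlet w \<le> dirichlet y" by (simp only: mult_le_cancel_left_pos[OF \<kappa>])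
    also have "\<dots> \<le> dirichlet (\<lambda>i. a * z i)" by (rule y(2)[OF z'])
    also have "\<dots> = real N / norm_sq z * dirichlet z" by (simp add: dirichlet_cmult a2)
    finally show ?thesis using p N by (simp add: \<mu>_def field_simps)
  qed
  \<comment> \<open>Passing to absolute values keeps the norm and does not raise the energy;
    \<open>card_supp\<close> later shows that the support is all of \<open>X\<close>.\<close>
  define u where "u i = \<bar>w i\<bar>" for i
  have su: "supp u = supp w" by (simp add: supp_def u_def)
  have fw: "finite (supp w)" "card (supp w) \<le> N" using w(1) X finite_subset card_mono by auto
  have nu: "norm_sq u = real N" using w(2) by (simp add: norm_sq_def u_def)
  have "dirichlet u \<le> dirichlet w"
    by (rule dirichlet_mono(2)[OF dirichlet_finite(2)[OF fw(1) order_refl]])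
      (auto simp: bond_sq_def u_def abs_le_square_iff[symmetric])
  moreover have "\<mu> * norm_sq u \<le> dirichlet u" by (rule minimal) (use fw su in auto)
  moreover have "\<mu> * norm_sq u = dirichlet w" using N by (simp add: nu \<mu>_def)
  ultimately have eq: "dirichlet u = \<mu> * norm_sq u" by simp
  have opt: "eig_optimal N u \<mu>"
  proof
    show "supp u \<noteq> {}"
    proof
      assume "supp u = {}"
      then have "norm_sq u = 0" by (simp add: supp_def norm_sq_def)
      then show False using nu N by simp
    qed
  qed (use fw su eq minimal in \<open>auto simp: u_def\<close>)
  then have "supp u = X"
    using eig_optimal.card_supp[OF opt] X w(1) su by (metis card_subset_eq)
  then show ?thesis using opt by blast
qed

lemma eig_optimal_polS:
  assumes "eig_optimal N u \<mu>" "\<sigma> \<in> Refl" "\<sigma> c \<noteq> c"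
  shows "eig_optimal N (polF \<sigma> (Hs \<sigma> c) u) \<mu>" "supp (polF \<sigma> (Hs \<sigma> c) u) = polS \<sigma> (Hs \<sigma> c) (supp u)"
proof -
  interpret eig_optimal N u \<mu> by (rule assms)
  interpret polarization \<sigma> "Hs \<sigma> c" by (rule polarization_Refl[OF assms(2,3)])
  interpret eig_polarized N u \<mu> \<sigma> "Hs \<sigma> c" by unfold_locales
  show "eig_optimal N (polF \<sigma> (Hs \<sigma> c) u) \<mu>" by (rule pol.eig_optimal_axioms)
  show "supp (polF \<sigma> (Hs \<sigma> c) u) = polS \<sigma> (Hs \<sigma> c) (supp u)" by (rule supp_pol)
qed

lemma eigenvalue_diameter:
  fixes X :: "(int^'n) set"
  assumes N: "N \<ge> 1" and X: "finite X" "card X = N"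
    and min: "dirichlet_eigenvalue N X = min_dirichlet_eigenvalue TYPE('n) N"
  shows "diameter (emb ` X) \<le> 2 * real CARD('n) * (real CARD('n) + 1) * real N powr (1 / real CARD('n))"
proof -
  obtain w \<mu> where w: "eig_optimal N w \<mu>" "supp w = X"
    using eig_optimal_if_minimal[OF X N min] by blast
  let ?O = "{X :: (int^'n) set. \<exists>u. eig_optimal N u \<mu> \<and> supp u = X}"
  have XO: "X \<in> ?O" using w by blast
  obtain c where c: "\<And>c'. moment c X \<le> moment c' X"
    using ex_has_least_nat[of "\<lambda>_. True" undefined "\<lambda>c. moment c X"] by blast
  have "centred c X"
  proof (rule moment_minimal_imp_centred[of ?O UNIV, OF _ _ _ XO UNIV_I c])
    show "finite X" if "X \<in> ?O" for X using that by (auto dest: eig_optimal.fin)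
    show "polS \<sigma> (Hs \<sigma> c) X \<in> ?O" if "X \<in> ?O" "\<sigma> \<in> Refl" "\<sigma> c \<noteq> c" for X \<sigma> c
      using that eig_optimal_polS by blast
    show "polS \<sigma> (Hs \<sigma> c) X = X \<or> X = \<sigma> ` polS \<sigma> (Hs \<sigma> c) X \<and> \<sigma> c \<in> UNIV"
      if "X \<in> ?O" "\<sigma> \<in> Refl" "\<sigma> c \<noteq> c" "centred c (polS \<sigma> (Hs \<sigma> c) X)" for X \<sigma> c
      using that rigid_eigenvalue by blast
  qed
  then show ?thesis by (rule centred_diameter[OF _ X N])
qed

theorem proposition5p15:
  assumes "CARD('n::finite) \<ge> 3"
  shows "\<exists>C::real. C > 0 \<and>
    (\<forall>(N::nat) (X :: (int^'n) set). N \<ge> 1 \<longrightarrow> finite X \<longrightarrow> card X = N \<longrightarrow>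
      (cap N X = min_cap TYPE('n) N \<longrightarrow>
         diameter (emb ` X) \<le> C * real N powr (1 / real CARD('n))) \<and>
      (\<forall>R::real. R > 0 \<longrightarrow>
         X \<subseteq> lattice_ball (R * real N powr (1 / real CARD('n))) \<longrightarrow>
         rel_cap N X R = min_rel_cap TYPE('n) N R \<longrightarrow>
         diameter (emb ` X) \<le> C * real N powr (1 / real CARD('n))) \<and>
      (dirichlet_eigenvalue N X = min_dirichlet_eigenvalue TYPE('n) N \<longrightarrow>
         diameter (emb ` X) \<le> C * real N powr (1 / real CARD('n))))"
proof (intro exI[of _ "2 * real CARD('n) * (real CARD('n) + 2)"] conjI allI impI)
  let ?d = "real CARD('n)"
  show "2 * ?d * (?d + 2) > 0" by simp
  fix N :: nat and X :: "(int^'n) set" assume N: "N \<ge> 1" and X: "finite X" "card X = N"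
  let ?\<rho> = "real N powr (1 / ?d)"
  have weaken: "x \<le> 2 * ?d * (?d + 2) * ?\<rho>" if "x \<le> 2 * ?d * (?d + 1) * ?\<rho>" for x
  proof -
    have "2 * ?d * (?d + 1) * ?\<rho> \<le> 2 * ?d * (?d + 2) * ?\<rho>"
      by (intro mult_right_mono mult_left_mono) auto
    then show ?thesis using that by linarith
  qed
  show "diameter (emb ` X) \<le> 2 * ?d * (?d + 2) * ?\<rho>" if "cap N X = min_cap TYPE('n) N"
    by (rule weaken[OF capacity_diameter[OF assms N X that]])
  show "diameter (emb ` X) \<le> 2 * ?d * (?d + 2) * ?\<rho>"
    if "dirichlet_eigenvalue N X = min_dirichlet_eigenvalue TYPE('n) N"
    by (rule weaken[OF eigenvalue_diameter[OF N X that]])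
  fix R :: real assume R: "R > 0" "X \<subseteq> lattice_ball (R * ?\<rho>)" "rel_cap N X R = min_rel_cap TYPE('n) N R"
  \<comment> \<open>Up to the threshold d(d+2) the set is confined by its ball, whose diameter is at
    most 2d(d+2)N^(1/d); this determines the final constant.\<close>
  show "diameter (emb ` X) \<le> 2 * ?d * (?d + 2) * ?\<rho>"
  proof (cases "?d * (?d + 2) < R")
    case True
    show ?thesis by (rule weaken[OF relative_capacity_diameter[OF assms N X R(2) True R(3)]])
  next
    case False
    have "diameter (emb ` X) \<le> 2 * (R * ?\<rho>)" by (rule lattice_ball_diameter[OF R(2)]) (use R(1) in simp)
    also have "\<dots> \<le> 2 * (?d * (?d + 2) * ?\<rho>)" using False by (intro mult_left_mono mult_right_mono) auto
    finally show ?thesis by (simp add: mult.assoc)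
  qed
qed

end
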